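(* Assume A1 and A2, and consider the stationary process $(\Gamma,\Gamma^\bullet,\zeta)$ described in the context, with $\varepsilon\in(0,\varepsilon_0]$. Then for each $t\in\mathbb Z$, $$R_{D,\zeta}(t)=B\,R_\zeta(t-1)+O(\varepsilon^3),\qquad B^{T}=\pi_0\mathcal E,$$ $$R_D(t)=R_{B\zeta}(t)+R_\Delta(t)+R_{B\zeta,\Delta}(t-1)+R_{B\zeta,\Delta}(-t-1)^{T}+R_{V\zeta^2,\Delta}(t-1)+R_{V\zeta^2,\Delta}(-t-1)^{T}+O(\varepsilon^3),$$ where the terms on the right-hand side of the last equation satisfy the following. (a) $R_{B\zeta}(t)=\mathsf E[B_t\zeta_tB_0^{T}\zeta_0]$ satisfies, for $t\ge0$, with $\Pi_0=\mathrm{diag}(\pi_0)$, $$R_{B\zeta}(t)=(P_0^t\mathcal E)^{T}\Pi_0\,\mathcal E\,R_\zeta(t)+O(\varepsilon^3).$$ (b) $R_\Delta(t)=0$ for $t\ne0$, and, with $\pi_\varepsilon=\mathsf E[\Gamma_t]$, $\Pi_\varepsilon=\mathrm{diag}(\pi_\varepsilon)$ and $R_{\Gamma,\zeta}(t)=\mathsf E[\Gamma_t^{T}\zeta_0]$, $$\begin{aligned}R_\Delta(0)=\Sigma^\Delta={}&\Pi_\varepsilon-P_0^{T}\Pi_\varepsilon P_0-\bigl[P_0^{T}\mathrm{diag}(R_{\Gamma,\zeta}(0))\mathcal E+\mathcal E^{T}\mathrm{diag}(R_{\Gamma,\zeta}(0))P_0\bigr]\\&-\tfrac12R_\zeta(0)\bigl[P_0^{T}\Pi_0\mathcal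 W+2\mathcal E^{T}\Pi_0\mathcal E+\mathcal W^{T}\Pi_0P_0\bigr]+O(\varepsilon^3).\end{aligned}$$ When $\varepsilon=0$ this becomes $\Sigma^{\Delta^\bullet}=\Pi_0-P_0^{T}\Pi_0P_0$. (c) With $A=P_0^{T}$ and $R_{\Delta^2,\zeta}(t)=\mathsf E[\Delta_t^{T}\Delta_t\zeta_0]$, the cross-covariance $R_{B\zeta,\Delta}(t)=\mathsf E[B_t\zeta_t\Delta_0]$ satisfies $$R_{B\zeta,\Delta}(t)=\begin{cases}0,&t<0,\\ \mathcal E^{T}R_{\Delta^2,\zeta}(0)+O(\varepsilon^3),&t=0,\\ \mathcal E^{T}A^tR_{\Delta^2,\zeta}(-t)+\mathcal E^{T}\sum_{i=0}^{t-1}A^{t-1-i}\mathcal E^{T}A^iR_\zeta(t-i)\,\Sigma^{\Delta^\bullet}+O(\varepsilon^3),&t\ge1.\end{cases}$$ (d) The cross-covariance $R_{V\zeta^2,\Delta}(t)=\mathsf E[V_t\zeta_t^2\Delta_0]$ satisfies, with $\sigma_\zeta^2=\mathsf E[\zeta_t^2]$, $$R_{V\zeta^2,\Delta}(t)=\begin{cases}0,&t<0,\\ \tfrac12\sigma_\zeta^2(P_0^t\mathcal W)^{T}\Sigma^{\Delta^\bullet}+O(\varepsilon^3),&t\ge0.\end{cases}$$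
   Context: Setting. For each $\zeta\in\mathbb R$, $P_\zeta$ is a $d\times d$ transition (row-stochastic) matrix. A1: $P_0$ is irreducible and aperiodic; $\zeta\mapsto P_\zeta$ is twice continuously differentiable in a neighborhood of $\zeta=0$, with Lipschitz continuous second derivative. A2: $\zeta_t=\varepsilon\zeta^1_t$, where $\zeta^1=\{\zeta^1_t:t\in\mathbb Z\}$ is a real-valued stationary process with zero mean, $|\zeta^1_t|\le 1$ for all $t$ almost surely, and $\sum_{t\ge 0}|R_{\zeta^1}(t)|<\infty$, where $R_{\zeta^1}(t)=\mathsf E[\zeta^1_t\zeta^1_0]$. $\pi_0$ is the invariant probability (row) vector of $P_0$; $\mathcal E=\frac{d}{d\zeta}P_\zeta|_{\zeta=0}$, $\mathcal W=\frac{d^2}{d\zeta^2}P_\zeta|_{\zeta=0}$; $R_\zeta(t)=\mathsf E[\zeta_t\zeta_0]$. The stationary process $(\Gamma,\Gamma^\bullet,\zeta)$. Let $\mathcal G_{i,j}(z,s)=1$ if $\sum_{k=1}^{j-1}P_z(i,k)\le s<\sum_{k=1}^{j}P_z(i,k)$ and $0$ otherwise. Let $N^\circ,N^\bullet$ be i.i.d. sequences uniform on $[0,1]$, with $\zeta,N^\circ,N^\bullet$ mutually independent. $\Gamma_t,\Gamma^\bullet_t$ take values in the standard basis $\{e^1,\dots,e^d\}$ of $\mathbb R^d$ (row vectors) and satisfy, for $t\in\mathbb Z$, $\Gamma^\bullet_{t+1}=\Gamma^\bullet_t\mathcal G(0,N^\bullet_{t+1})$ and $\Gamma_{t+1}=\Gamma_tG_{t+1}$,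 $G_{t+1}=\mathcal G(\zeta_t,N_{t+1})$, where $N_{t+1}=N^\bullet_{t+1}$ if $\Gamma_t=\Gamma_t^\bullet$ and $N_{t+1}=N^\circ_{t+1}$ otherwise; $(N^\circ_{t+1},N^\bullet_{t+1})$ is independent of $(\zeta,(\Gamma_s,\Gamma^\bullet_s)_{s\le t})$. There is $\varepsilon_0>0$ such that for every $\varepsilon\in(0,\varepsilon_0]$ such a jointly stationary $(\Gamma,\Gamma^\bullet,\zeta)$ on $\mathbb Z$ exists, with $\Gamma^\bullet$ independent of $\zeta$ and $\mathsf E\|\Gamma_t-\Gamma_t^\bullet\|=O(\varepsilon)$. Notation. $B_t^{T}=\Gamma_t\mathcal E$, $V_t^{T}=\frac12\Gamma_t\mathcal W$, $\Delta_{t+1}=\Gamma_t(G_{t+1}-P_{\zeta_t})$ (row vector), $D_{t+1}=B_t^{T}\zeta_t+V_t^{T}\zeta_t^2+\Delta_{t+1}$ (row vector). Correlations, in steady state: $R_D(t)=\mathsf E[D_t^{T}D_0]$, $R_{D,\zeta}(t)=\mathsf E[D_t^{T}\zeta_0]$, $R_\Delta(t)=\mathsf E[\Delta_t^{T}\Delta_0]$, $\Sigma^\Delta=\mathsf E[\Delta_t^T\Delta_t]$. $\Sigma^{\Delta^\bullet}$ is the corresponding covariance for $\zeta\equiv0$. $\mathrm{diag}(v)$ is the diagonal matrix with diagonal $v$. $O(\varepsilon^3)$ denotes a term bounded in norm by $C\varepsilon^3$ for all $\varepsilon\in(0,\varepsilon_0]$, with $C$ independent of $\varepsilon$. *)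

theory Defs
  imports "HOL-Probability.Probability"
begin

section \<open>Matrices\<close>

text \<open>A vector \<open>v :: real ^ 'n\<close> serves both as a row and as a column: \<open>v v* A\<close> is the product of
  the row \<open>v\<close> with \<open>A\<close>, and \<open>outer u v\<close> is the product of the column \<open>u\<close> with the row \<open>v\<close>.\<close>

text \<open>Unlike \<open>real ^ 'n\<close>, these synonyms impose no sort on \<open>'n\<close>, which must also be linearly ordered
  in the definitions involving \<open>Gmat\<close>.\<close>

type_synonym 'n rvec = "(real, 'n) vec"
type_synonym 'n rmat = "((real, 'n) vec, 'n) vec"

definition outer :: "real ^ 'n \<Rightarrow> real ^ 'm \<Rightarrow> real ^ 'm ^ 'n" where
  "outer u v = (\<chi> i j. u $ i * v $ j)"

definition diag :: "real ^ 'n \<Rightarrow> real ^ 'n ^ 'n" where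
  "diag v = (\<chi> i j. if i = j then v $ i else 0)"

text \<open>The type-class power \<open>A ^ n\<close> is componentwise, hence the following.\<close>

primrec mpow :: "real ^ 'n ^ 'n \<Rightarrow> nat \<Rightarrow> real ^ 'n ^ 'n" where
  "mpow A 0 = mat 1"
| "mpow A (Suc n) = A ** mpow A n"

section \<open>The family of transition matrices\<close>

definition stochastic :: "real ^ 'n ^ 'n \<Rightarrow> bool" where
  "stochastic Q \<longleftrightarrow> (\<forall>i j. 0 \<le> Q $ i $ j) \<and> (\<forall>i. (\<Sum>j\<in>UNIV. Q $ i $ j) = 1)"

definition irreducible_matrix :: "real ^ 'n ^ 'n \<Rightarrow> bool" where
  "irreducible_matrix Q \<longleftrightarrow> (\<forall>i j. \<exists>n>0. 0 < mpow Q n $ i $ j)"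

definition aperiodic_matrix :: "real ^ 'n ^ 'n \<Rightarrow> bool" where
  "aperiodic_matrix Q \<longleftrightarrow> (\<forall>i. Gcd {n. 0 < n \<and> 0 < mpow Q n $ i $ i} = 1)"

definition invariant_probability :: "real ^ 'n ^ 'n \<Rightarrow> real ^ 'n \<Rightarrow> bool" where
  "invariant_probability Q p \<longleftrightarrow>
     (\<forall>i. 0 \<le> p $ i) \<and> (\<Sum>i\<in>UNIV. p $ i) = 1 \<and> p v* Q = p"

text \<open>Borel measurability of \<open>z \<mapsto> P z\<close> is only used to make \<open>P (\<zeta>\<^sub>t)\<close> and \<open>\<G> (\<zeta>\<^sub>t) (N\<^sub>t\<^sub>+\<^sub>1)\<close>
  random variables; smoothness is only required near \<open>0\<close>.\<close>

definition transition_family :: "(real \<Rightarrow> real ^ 'n ^ 'n) \<Rightarrow> bool" where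
  "transition_family P \<longleftrightarrow> (\<forall>z. stochastic (P z)) \<and> P \<in> borel_measurable borel"

definition deriv1 :: "(real \<Rightarrow> real ^ 'n ^ 'n) \<Rightarrow> real \<Rightarrow> real ^ 'n ^ 'n" where
  "deriv1 P z = vector_derivative P (at z)"

definition deriv2 :: "(real \<Rightarrow> real ^ 'n ^ 'n) \<Rightarrow> real \<Rightarrow> real ^ 'n ^ 'n" where
  "deriv2 P z = vector_derivative (deriv1 P) (at z)"

definition assumption_A1 :: "(real \<Rightarrow> real ^ 'n ^ 'n) \<Rightarrow> bool" where
  "assumption_A1 P \<longleftrightarrow>
     irreducible_matrix (P 0) \<and> aperiodic_matrix (P 0) \<and>
     (\<exists>r>0. (\<forall>z\<in>ball 0 r. P differentiable (at z) \<and> deriv1 P differentiable (at z)) \<and>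
        continuous_on (ball 0 r) (deriv2 P) \<and>
        (\<exists>L. L-lipschitz_on (ball 0 r) (deriv2 P)))"

section \<open>Processes indexed by the integers\<close>

abbreviation path_space :: "'i set \<Rightarrow> ('i \<Rightarrow> 'b::topological_space) measure" where
  "path_space I \<equiv> PiM I (\<lambda>_. borel)"

definition process_law ::
    "'w measure \<Rightarrow> (int \<Rightarrow> 'w \<Rightarrow> 'b::topological_space) \<Rightarrow> (int \<Rightarrow> 'b) measure" where
  "process_law M X = distr M (path_space UNIV) (\<lambda>\<omega> t. X t \<omega>)"

definition stationary_process ::
    "'w measure \<Rightarrow> (int \<Rightarrow> 'w \<Rightarrow> 'b::topological_space) \<Rightarrow> bool" where
  "stationary_process M X \<longleftrightarrow>
     (\<forall>t. X t \<in> borel_measurable M) \<and>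
     (\<forall>h. process_law M (\<lambda>t. X (t + h)) = process_law M X)"

text \<open>\<open>prob_space.indep_var\<close> forces the two variables to have the same value type.\<close>

definition indep_rv ::
    "'w measure \<Rightarrow> 'b measure \<Rightarrow> ('w \<Rightarrow> 'b) \<Rightarrow> 'c measure \<Rightarrow> ('w \<Rightarrow> 'c) \<Rightarrow> bool" where
  "indep_rv M S X T Y \<longleftrightarrow>
     X \<in> measurable M S \<and> Y \<in> measurable M T \<and>
     prob_space.indep_set M {X -` A \<inter> space M | A. A \<in> sets S} {Y -` A \<inter> space M | A. A \<in> sets T}"

definition iid_uniform :: "'w measure \<Rightarrow> (int \<Rightarrow> 'w \<Rightarrow> real) \<Rightarrow> bool" where
  "iid_uniform M N \<longleftrightarrow>
     prob_space.indep_vars M (\<lambda>_. borel) N UNIV \<and>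
     (\<forall>t. distr M borel (N t) = uniform_measure lborel {0..1})"

text \<open>Correlations \<open>E[X\<^sub>t Y\<^sub>0]\<close> for the various combinations of scalar and vector processes, and
  the one-time moment \<open>E[X\<^sub>t\<^sup>T X\<^sub>t]\<close>, which for a stationary process does not depend on \<open>t\<close>.\<close>

definition corr_ss :: "'w measure \<Rightarrow> (int \<Rightarrow> 'w \<Rightarrow> real) \<Rightarrow> (int \<Rightarrow> 'w \<Rightarrow> real) \<Rightarrow> int \<Rightarrow> real" where
  "corr_ss M x y t = (\<integral>\<omega>. x t \<omega> * y 0 \<omega> \<partial>M)"

definition corr_vs ::
    "'w measure \<Rightarrow> (int \<Rightarrow> 'w \<Rightarrow> 'b::{banach, second_countable_topology}) \<Rightarrow>
     (int \<Rightarrow> 'w \<Rightarrow> real) \<Rightarrow> int \<Rightarrow> 'b" where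
  "corr_vs M X y t = (\<integral>\<omega>. y 0 \<omega> *\<^sub>R X t \<omega> \<partial>M)"

definition corr_vv ::
    "'w measure \<Rightarrow> (int \<Rightarrow> 'w \<Rightarrow> real ^ 'n) \<Rightarrow> (int \<Rightarrow> 'w \<Rightarrow> real ^ 'm) \<Rightarrow> int \<Rightarrow> real ^ 'm ^ 'n" where
  "corr_vv M X Y t = (\<integral>\<omega>. outer (X t \<omega>) (Y 0 \<omega>) \<partial>M)"

definition second_moment ::
    "'w measure \<Rightarrow> (int \<Rightarrow> 'w \<Rightarrow> real ^ 'n) \<Rightarrow> int \<Rightarrow> real ^ 'n ^ 'n" where
  "second_moment M X t = (\<integral>\<omega>. outer (X t \<omega>) (X t \<omega>) \<partial>M)"

definition assumption_A2 :: "'w measure \<Rightarrow> (int \<Rightarrow> 'w \<Rightarrow> real) \<Rightarrow> bool" where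
  "assumption_A2 M z \<longleftrightarrow>
     stationary_process M z \<and>
     (\<forall>t. (\<integral>\<omega>. z t \<omega> \<partial>M) = 0) \<and>
     (AE \<omega> in M. \<forall>t. \<bar>z t \<omega>\<bar> \<le> 1) \<and>
     summable (\<lambda>t::nat. \<bar>corr_ss M z z (int t)\<bar>)"

section \<open>The coupled process\<close>

text \<open>The linear order on the index type stands for the order of the states \<open>1, \<dots>, d\<close>.\<close>

definition Gmat ::
    "(real \<Rightarrow> 'n::{finite, linorder} rmat) \<Rightarrow> real \<Rightarrow> real \<Rightarrow> 'n rmat" where
  "Gmat P z s = (\<chi> i j. if (\<Sum>k\<in>{..<j}. P z $ i $ k) \<le> s \<and> s < (\<Sum>k\<in>{..j}. P z $ i $ k)
                       then 1 else 0)"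

text \<open>\<open>\<Gamma>b\<close>, \<open>Nb\<close> and \<open>No\<close> stand for \<open>\<Gamma>\<^sup>\<bullet>\<close>, \<open>N\<^sup>\<bullet>\<close> and \<open>N\<^sup>\<circ>\<close>.\<close>

definition driving_noise ::
    "(int \<Rightarrow> 'w \<Rightarrow> 'b) \<Rightarrow> (int \<Rightarrow> 'w \<Rightarrow> 'b) \<Rightarrow> (int \<Rightarrow> 'w \<Rightarrow> real) \<Rightarrow>
     (int \<Rightarrow> 'w \<Rightarrow> real) \<Rightarrow> int \<Rightarrow> 'w \<Rightarrow> real" where
  "driving_noise \<Gamma> \<Gamma>b No Nb t \<omega> =
     (if \<Gamma> (t - 1) \<omega> = \<Gamma>b (t - 1) \<omega> then Nb t \<omega> else No t \<omega>)"

text \<open>The recursions can only hold almost surely, since \<open>Gmat P z 1 = 0\<close> for stochastic \<open>P z\<close>.\<close>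

definition coupled_process ::
    "(real \<Rightarrow> 'n::{finite, linorder} rmat) \<Rightarrow> 'w measure \<Rightarrow> (int \<Rightarrow> 'w \<Rightarrow> real) \<Rightarrow>
     (int \<Rightarrow> 'w \<Rightarrow> 'n rvec) \<Rightarrow> (int \<Rightarrow> 'w \<Rightarrow> 'n rvec) \<Rightarrow>
     (int \<Rightarrow> 'w \<Rightarrow> real) \<Rightarrow> (int \<Rightarrow> 'w \<Rightarrow> real) \<Rightarrow> bool" where
  "coupled_process P M \<zeta> \<Gamma> \<Gamma>b No Nb \<longleftrightarrow>
     iid_uniform M No \<and> iid_uniform M Nb \<and>
     prob_space.indep_vars M (\<lambda>_. path_space UNIV) (\<lambda>k \<omega> t. ([\<zeta>, No, Nb] ! k) t \<omega>) {..<3} \<and>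
     stationary_process M (\<lambda>t \<omega>. (\<Gamma> t \<omega>, \<Gamma>b t \<omega>, \<zeta> t \<omega>)) \<and>
     (\<forall>t. AE \<omega> in M. (\<exists>i. \<Gamma> t \<omega> = axis i 1) \<and> (\<exists>i. \<Gamma>b t \<omega> = axis i 1)) \<and>
     (\<forall>t. AE \<omega> in M. \<Gamma>b (t + 1) \<omega> = \<Gamma>b t \<omega> v* Gmat P 0 (Nb (t + 1) \<omega>)) \<and>
     (\<forall>t. AE \<omega> in M. \<Gamma> (t + 1) \<omega> =
        \<Gamma> t \<omega> v* Gmat P (\<zeta> t \<omega>) (driving_noise \<Gamma> \<Gamma>b No Nb (t + 1) \<omega>)) \<and>
     (\<forall>t. indep_rv M
        borel (\<lambda>\<omega>. (No (t + 1) \<omega>, Nb (t + 1) \<omega>))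
        (path_space UNIV \<Otimes>\<^sub>M path_space {..t})
        (\<lambda>\<omega>. (\<lambda>u. \<zeta> u \<omega>, \<lambda>u\<in>{..t}. (\<Gamma> u \<omega>, \<Gamma>b u \<omega>)))) \<and>
     indep_rv M
        (path_space UNIV) (\<lambda>\<omega> t. \<Gamma>b t \<omega>) (path_space UNIV) (\<lambda>\<omega> t. \<zeta> t \<omega>)"

text \<open>\<open>\<Delta>\<^sub>t = \<Gamma>\<^sub>t\<^sub>-\<^sub>1 (G\<^sub>t - P\<^bsub>\<zeta>\<^sub>t\<^sub>-\<^sub>1\<^esub>)\<close> with \<open>G\<^sub>t = \<G> (\<zeta>\<^sub>t\<^sub>-\<^sub>1) (N\<^sub>t)\<close>, for an arbitrary noise \<open>N\<close>. With
  \<open>\<Gamma>b\<close>, \<open>Nb\<close> and \<open>\<zeta> = 0\<close> this is the innovation of the unperturbed chain.\<close>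

definition innovation ::
    "(real \<Rightarrow> 'n::{finite, linorder} rmat) \<Rightarrow> (int \<Rightarrow> 'w \<Rightarrow> real) \<Rightarrow>
     (int \<Rightarrow> 'w \<Rightarrow> 'n rvec) \<Rightarrow> (int \<Rightarrow> 'w \<Rightarrow> real) \<Rightarrow> int \<Rightarrow> 'w \<Rightarrow> 'n rvec" where
  "innovation P \<zeta> \<Gamma> N t \<omega> =
     \<Gamma> (t - 1) \<omega> v* (Gmat P (\<zeta> (t - 1) \<omega>) (N t \<omega>) - P (\<zeta> (t - 1) \<omega>))"

section \<open>Equality up to an error of third order\<close>

definition eq_O3 :: "real \<Rightarrow> (real \<Rightarrow> 'b::real_normed_vector) \<Rightarrow> (real \<Rightarrow> 'b) \<Rightarrow> bool" where
  "eq_O3 \<epsilon>\<^sub>0 f g \<longleftrightarrow> (\<exists>C. \<forall>\<epsilon>\<in>{0<..\<epsilon>\<^sub>0}. norm (f \<epsilon> - g \<epsilon>) \<le> C * \<epsilon> ^ 3)"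

end

theory Submission
  imports Defs
begin

text \<open>The innovation \<open>\<Delta>\<close> is almost surely \<open>Y\<^sub>t = \<Gamma>\<^sub>t - \<Gamma>\<^sub>t\<^sub>-\<^sub>1 P(\<zeta>\<^sub>t\<^sub>-\<^sub>1)\<close>, a martingale difference for the
  filtration that contains all of \<open>\<zeta>\<close> and the past of both chains. Hence mixed moments such as
  \<open>E[\<zeta>\<^sub>t \<Gamma>\<^sub>k\<^sup>T Y\<^sub>0]\<close> satisfy exact one-step recursions in \<open>k\<close> with the random coefficient \<open>P(\<zeta>\<^sub>k)\<close>, and a
  Taylor expansion of \<open>P\<close> at \<open>0\<close> turns them into recursions up to order three. A moment that already
  carries two factors \<open>\<zeta>\<close> is of order two, so replacing \<open>\<Gamma>\<close> by \<open>\<Gamma>\<^sup>\<bullet>\<close> there costs only order three by the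
  coupling bound; as \<open>\<Gamma>\<^sup>\<bullet>\<close> is independent of \<open>\<zeta>\<close> with one-time law \<open>\<pi>\<^sub>0\<close>, the moment factorizes.\<close>

section \<open>Linear algebra\<close>

text \<open>The strength of the coupling decides which moments can be expanded.
  \<open>\<Gamma>\<close> and \<open>\<Gamma>b\<close> are close only in mean and only to order one,
  so with a single factor \<open>\<zeta>\<close> the exchange would leave an error of order two.
  Hence the means of \<open>\<Gamma>\<close>, of \<open>\<zeta>\<close> times
  \<open>\<Gamma>\<close> and of \<open>\<zeta>\<close> times the squared innovation stay unexpanded
  in the result. Since smallness in mean does not survive products of two such factors, two notions
  of order are needed: \<open>rv_O\<close> (almost sure) and \<open>mean_O\<close> (in mean). No
  conditional expectation is formed. The martingale property is used weakly, as equality of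
  integrals against bounded test functions measurable for \<open>F t\<close>. Such a test function
  may contain any part of the environment, even its future, so weights like
  \<open>\<zeta>\<zeta> a b\<close> pass unchanged through every step of a recursion. Two inputs
  have to be derived: a cubic Taylor bound on the whole range of the environment, although
  smoothness holds only near 0, and the fact that the stationary mean of \<open>\<Gamma>b\<close> is
  \<open>\<pi>\<^sub>0\<close>, which rests on uniqueness of the invariant probability.\<close>

lemma bounded_bilinear_outer: "bounded_bilinear (outer :: real ^ 'n \<Rightarrow> real ^ 'm \<Rightarrow> real ^ 'm ^ 'n)"
  unfolding bilinear_conv_bounded_bilinear[symmetric] bilinear_def linear_iff
  by (auto simp: outer_def vec_eq_iff algebra_simps)

lemma bounded_bilinear_vector_matrix:
  "bounded_bilinear ((v*) :: real ^ 'm \<Rightarrow> real ^ 'n ^ 'm \<Rightarrow> real ^ 'n)"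
  unfolding bilinear_conv_bounded_bilinear[symmetric] bilinear_def linear_iff
  by (auto simp: vector_matrix_mult_def vec_eq_iff algebra_simps sum.distrib sum_distrib_left)

lemma bounded_bilinear_matrix_matrix:
  "bounded_bilinear ((**) :: real ^ 'm ^ 'k \<Rightarrow> real ^ 'n ^ 'm \<Rightarrow> real ^ 'n ^ 'k)"
  unfolding bilinear_conv_bounded_bilinear[symmetric] bilinear_def linear_iff
  by (auto simp: matrix_matrix_mult_def vec_eq_iff algebra_simps sum.distrib sum_distrib_left)

lemma bounded_linear_transpose: "bounded_linear (transpose :: real ^ 'm ^ 'n \<Rightarrow> real ^ 'n ^ 'm)"
  unfolding linear_conv_bounded_linear[symmetric] linear_iff
  by (auto simp: transpose_def vec_eq_iff)

lemma bounded_linear_diag: "bounded_linear (diag :: real ^ 'n \<Rightarrow> real ^ 'n ^ 'n)"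
  unfolding linear_conv_bounded_linear[symmetric] linear_iff
  by (auto simp: diag_def vec_eq_iff)

lemmas bounded_linear_vector_matrix_left =
  bounded_bilinear.bounded_linear_left[OF bounded_bilinear_vector_matrix]
lemmas bounded_linear_matrix_matrix_left =
  bounded_bilinear.bounded_linear_left[OF bounded_bilinear_matrix_matrix]
lemmas bounded_linear_matrix_matrix_right =
  bounded_bilinear.bounded_linear_right[OF bounded_bilinear_matrix_matrix]

text \<open>For a basis vector \<open>x\<close> this matrix is the covariance of one step of a chain
  with matrix \<open>Q\<close> started in \<open>x\<close>: the diagonal of the new law minus its
  outer square. Written with \<open>diag x\<close> it is linear in \<open>x\<close>, so an
  expectation over the current state passes inside.\<close>

lemma bounded_linear_innovation_covariance:
  "bounded_linear (\<lambda>x. diag (x v* Q) - transpose Q ** diag x ** (Q :: real ^ 'n ^ 'n))"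
  by (intro bounded_linear_sub
      bounded_linear_compose[OF bounded_linear_diag bounded_linear_vector_matrix_left]
      bounded_linear_compose[OF bounded_linear_matrix_matrix_left]
      bounded_linear_compose[OF bounded_linear_matrix_matrix_right bounded_linear_diag])

lemma transpose_outer: "transpose (outer u v) = outer v u"
  by (simp add: transpose_def outer_def vec_eq_iff mult.commute)

lemma outer_vector_matrix_left: "outer (u v* Q) v = transpose Q ** outer u v"
  by (simp add: outer_def transpose_def matrix_matrix_mult_def vector_matrix_mult_def vec_eq_iff
      sum_distrib_left sum_distrib_right mult_ac)

lemma outer_vector_matrix_right: "outer u (v v* Q) = outer u v ** Q"
  by (simp add: outer_def matrix_matrix_mult_def vector_matrix_mult_def vec_eq_iff
      sum_distrib_left algebra_simps)

text \<open>This turns quadratic expressions in the state into linear ones, and thereby second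
  moments of the chain into first moments.\<close>

lemma outer_axis: "outer (axis i 1) (axis i 1) = diag (axis i (1::real))"
  by (auto simp: outer_def diag_def axis_def vec_eq_iff)

lemma transpose_add: "transpose (A + B) = transpose A + transpose (B :: real ^ 'm ^ 'n)"
  using linear_add[OF bounded_linear.linear[OF bounded_linear_transpose]] .

lemma transpose_diff: "transpose (A - B) = transpose A - transpose (B :: real ^ 'm ^ 'n)"
  using linear_diff[OF bounded_linear.linear[OF bounded_linear_transpose]] .

lemma transpose_scaleR: "transpose (c *\<^sub>R A) = c *\<^sub>R transpose (A :: real ^ 'm ^ 'n)"
  by (simp add: transpose_def vec_eq_iff)

lemma mpow_Suc_right: "mpow Q (Suc n) = mpow Q n ** Q"
  by (induction n) (simp_all add: matrix_mul_assoc)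

lemma mpow_transpose: "mpow (transpose Q) n = transpose (mpow Q n)"
proof (induction n)
  case (Suc n)
  then show ?case
    by (metis matrix_transpose_mul mpow.simps(2) mpow_Suc_right)
qed simp

section \<open>Uniqueness of the invariant probability\<close>

lemma stochastic_row_sum: "stochastic Q \<Longrightarrow> (\<Sum>j\<in>UNIV. (v v* Q) $ j) = (\<Sum>i\<in>UNIV. v $ i)"
proof -
  assume Q: "stochastic Q"
  have "(\<Sum>j\<in>UNIV. (v v* Q) $ j) = (\<Sum>j\<in>UNIV. \<Sum>i\<in>UNIV. v $ i * Q $ i $ j)"
    by (simp add: vector_matrix_mult_def mult.commute)
  also have "\<dots> = (\<Sum>i\<in>UNIV. v $ i * (\<Sum>j\<in>UNIV. Q $ i $ j))"
    by (subst sum.swap) (simp add: sum_distrib_left)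
  also have "\<dots> = (\<Sum>i\<in>UNIV. v $ i)"
    using Q by (simp add: stochastic_def)
  finally show ?thesis .
qed

lemma mpow_nonneg: "stochastic Q \<Longrightarrow> 0 \<le> mpow Q n $ i $ j"
  by (induction n arbitrary: i)
     (auto simp: mat_def matrix_matrix_mult_def stochastic_def intro!: sum_nonneg)

lemma invariant_mpow: "v v* Q = v \<Longrightarrow> v v* mpow Q n = v"
  by (induction n) (simp_all flip: vector_matrix_mul_assoc)

text \<open>Invariance under \<open>mpow Q n\<close>, read at the entry \<open>j\<close>, is a
  vanishing sum of nonnegative terms. Irreducibility supplies an \<open>n\<close> for which the term
  of a given \<open>i\<close> has a positive weight, so \<open>v\<close> vanishes at
  \<open>i\<close> too.\<close>

lemma invariant_nonneg_vanishing:
  assumes Q: "stochastic Q" "irreducible_matrix Q"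
    and v: "\<And>i. 0 \<le> v $ i" "v v* Q = v" and j: "v $ j = 0"
  shows "v = 0"
proof -
  have "v $ i = 0" for i
  proof -
    obtain n where n: "0 < mpow Q n $ i $ j"
      using Q(2) by (auto simp: irreducible_matrix_def)
    have "0 = (\<Sum>k\<in>UNIV. mpow Q n $ k $ j * v $ k)"
      using arg_cong[OF invariant_mpow[OF v(2), of n], of "\<lambda>u. u $ j"] j
      by (simp add: vector_matrix_mult_def mult.commute)
    then have "mpow Q n $ i $ j * v $ i = 0"
      by (subst (asm) eq_commute, subst (asm) sum_nonneg_eq_0_iff) (auto simp: v(1) mpow_nonneg[OF Q(1)])
    then show ?thesis using n by simp
  qed
  then show ?thesis by (simp add: vec_eq_iff)
qed

text \<open>The difference \<open>v\<close> is invariant with total mass zero, and its entrywise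
  absolute value \<open>a\<close> turns out to be invariant as well. Then \<open>a + v\<close> and
  \<open>a - v\<close> are nonnegative and invariant, and at any chosen state one of them vanishes,
  hence vanishes everywhere. So \<open>v\<close> has constant sign, and mass zero leaves only
  \<open>v = 0\<close>.\<close>

lemma invariant_probability_unique:
  assumes Q: "stochastic Q" "irreducible_matrix Q"
    and p: "invariant_probability Q p" and q: "invariant_probability Q q"
  shows "p = q"
proof -
  define v where "v = p - q"
  define a where "a = (\<chi> i. \<bar>v $ i\<bar>)"
  have vQ: "v v* Q = v" and sv: "(\<Sum>i\<in>UNIV. v $ i) = 0"
    using p q by (auto simp: v_def invariant_probability_def vector_matrix_mult_diff_distrib sum_subtractf)
  have le: "a $ j \<le> (a v* Q) $ j" for j
  proof -
    have "a $ j = \<bar>(v v* Q) $ j\<bar>" by (simp add: a_def vQ)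
    also have "\<dots> \<le> (\<Sum>i\<in>UNIV. \<bar>Q $ i $ j * v $ i\<bar>)"
      unfolding vector_matrix_mult_def by (simp add: sum_abs mult.commute)
    also have "\<dots> = (a v* Q) $ j"
      using Q(1) by (simp add: vector_matrix_mult_def a_def abs_mult stochastic_def mult.commute)
    finally show ?thesis .
  qed
  \<comment> \<open>\<open>a\<close> lies entrywise below its image under \<open>Q\<close>, and both
    have the same total mass, so no entry can increase.\<close>
  have aQ: "a v* Q = a"
  proof -
    have "(\<Sum>j\<in>UNIV. (a v* Q) $ j - a $ j) = 0"
      by (simp add: sum_subtractf stochastic_row_sum[OF Q(1)])
    then have "(a v* Q) $ j - a $ j = 0" for j
      using le by (subst (asm) sum_nonneg_eq_0_iff) auto
    then show ?thesis by (simp add: vec_eq_iff)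
  qed
  have zero: "u = 0" if "u = a + v \<or> u = a - v" "u $ j = 0" for u j
  proof (rule invariant_nonneg_vanishing[OF Q _ _ that(2)])
    show "0 \<le> u $ i" for i using that(1) by (auto simp: a_def)
    show "u v* Q = u"
      using that(1) by (auto simp: vQ aQ vector_matrix_left_distrib vector_matrix_mult_diff_distrib)
  qed
  obtain j :: 'a where True by simp
  have "a + v = 0 \<or> a - v = 0"
  proof (cases "0 \<le> v $ j")
    case True
    then have "(a - v) $ j = 0" by (simp add: a_def)
    then show ?thesis using zero by blast
  next
    case False
    then have "(a + v) $ j = 0" by (simp add: a_def)
    then show ?thesis using zero by blast
  qed
  then have "(\<Sum>i\<in>UNIV. a $ i) = 0"
    using sv by (auto simp: eq_neg_iff_add_eq_0[symmetric] sum_negf)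
  then have "v = 0"
    by (simp add: a_def sum_nonneg_eq_0_iff vec_eq_iff)
  then show ?thesis by (simp add: v_def)
qed

section \<open>Second-order expansion of the transition matrices\<close>

text \<open>The constant is crude; what counts is that it is the same for all stochastic matrices.
  It controls \<open>P z\<close> far from 0, where nothing is known about derivatives.\<close>

lemma norm_stochastic_le: "stochastic (Q :: real ^ 'n ^ 'n) \<Longrightarrow> norm Q \<le> real (CARD('n) * CARD('n))"
proof -
  assume Q: "stochastic Q"
  have "Q $ i $ j \<le> 1" for i j
    using Q member_le_sum[of j UNIV "\<lambda>j. Q $ i $ j"] by (simp add: stochastic_def)
  then have *: "\<bar>Q $ i $ j\<bar> \<le> 1" for i j
    using Q by (simp add: stochastic_def)
  have "norm Q \<le> (\<Sum>i\<in>UNIV. norm (Q $ i))"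
    by (simp add: norm_vec_def L2_set_le_sum)
  also have "\<dots> \<le> (\<Sum>i\<in>UNIV. \<Sum>j\<in>UNIV. \<bar>Q $ i $ j\<bar>)"
    by (intro sum_mono norm_le_l1_cart)
  also have "\<dots> \<le> (\<Sum>i\<in>(UNIV::'n set). \<Sum>j\<in>(UNIV::'n set). 1)"
    by (intro sum_mono *)
  finally show ?thesis by simp
qed

text \<open>The mean value inequality is applied twice, first to \<open>deriv1 P\<close> and then to
  \<open>P\<close>; each application turns a bound on the derivative into one with an additional
  factor of the modulus of \<open>z\<close>. The inequality keeps the Lipschitz constant itself
  instead of a sixth of it, which is harmless here.\<close>

lemma Taylor_remainder_local:
  assumes "assumption_A1 P"
  obtains r L where "0 < r" "0 \<le> L"
    "\<And>z. \<bar>z\<bar> < r \<Longrightarrow>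
       norm (P z - P 0 - z *\<^sub>R deriv1 P 0 - (z\<^sup>2 / 2) *\<^sub>R deriv2 P 0) \<le> L * \<bar>z\<bar> ^ 3"
proof -
  obtain r L where r: "0 < r"
    and d: "\<And>z. z \<in> ball 0 r \<Longrightarrow> P differentiable (at z)"
           "\<And>z. z \<in> ball 0 r \<Longrightarrow> deriv1 P differentiable (at z)"
    and L: "L-lipschitz_on (ball 0 r) (deriv2 P)"
    using assms unfolding assumption_A1_def by blast
  have L0: "0 \<le> L" using lipschitz_on_nonneg[OF L] .
  have D1: "(P has_vector_derivative deriv1 P z) (at z)" if "z \<in> ball 0 r" for z
    using d(1)[OF that] by (simp add: deriv1_def vector_derivative_works)
  have D2: "(deriv1 P has_vector_derivative deriv2 P z) (at z)" if "z \<in> ball 0 r" for z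
    using d(2)[OF that] by (simp add: deriv2_def vector_derivative_works)
  define E W where "E = deriv1 P 0" and "W = deriv2 P 0"
  have bound: "norm (f z - f 0) \<le> B * \<bar>z\<bar>"
    if z: "\<bar>z\<bar> < r"
      and f': "\<And>y. \<bar>y\<bar> \<le> \<bar>z\<bar> \<Longrightarrow> (f has_vector_derivative f' y) (at y)"
      and B: "\<And>y. \<bar>y\<bar> \<le> \<bar>z\<bar> \<Longrightarrow> norm (f' y) \<le> B"
    for f f' :: "real \<Rightarrow> (real, 'a) vec ^ 'a" and z B
  proof -
    have "norm (f z - f 0) \<le> B * norm (z - 0)"
    proof (rule differentiable_bound[where S = "cball 0 \<bar>z\<bar>" and f' = "\<lambda>y h. h *\<^sub>R f' y"])
      show "(f has_derivative (\<lambda>h. h *\<^sub>R f' y)) (at y within cball 0 \<bar>z\<bar>)"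
        if "y \<in> cball 0 \<bar>z\<bar>" for y
        using f'[of y] that has_derivative_at_withinI by (auto simp: has_vector_derivative_def)
      show "onorm (\<lambda>h. h *\<^sub>R f' y) \<le> B" if "y \<in> cball 0 \<bar>z\<bar>" for y
        using onorm_scaleR_left[OF bounded_linear_ident, of "f' y"] onorm_id[where 'a = real] B[of y] that
        by (simp add: id_def)
    qed auto
    then show ?thesis by simp
  qed
  have b1: "norm (deriv1 P z - E - z *\<^sub>R W) \<le> (L * \<bar>z\<bar>) * \<bar>z\<bar>" if z: "\<bar>z\<bar> < r" for z
  proof -
    \<comment> \<open>Subtracting the linear term leaves the derivative
      \<open>deriv2 P y - W\<close>, which the Lipschitz condition makes small near 0.\<close>
    have "norm ((deriv1 P z - z *\<^sub>R W) - (deriv1 P 0 - 0 *\<^sub>R W)) \<le> (L * \<bar>z\<bar>) * \<bar>z\<bar>"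
    proof (rule bound[OF z])
      fix y :: real assume y: "\<bar>y\<bar> \<le> \<bar>z\<bar>"
      show "((\<lambda>z. deriv1 P z - z *\<^sub>R W) has_vector_derivative (deriv2 P y - W)) (at y)"
        using y z by (auto intro!: derivative_eq_intros D2)
      have "norm (deriv2 P y - W) \<le> L * \<bar>y\<bar>"
        using lipschitz_onD[OF L, of y 0] y z r by (simp add: W_def dist_norm)
      also have "\<dots> \<le> L * \<bar>z\<bar>" using y L0 by (rule mult_left_mono)
      finally show "norm (deriv2 P y - W) \<le> L * \<bar>z\<bar>" .
    qed
    then show ?thesis by (simp add: E_def algebra_simps)
  qed
  have b2: "norm (P z - P 0 - z *\<^sub>R E - (z\<^sup>2 / 2) *\<^sub>R W) \<le> (L * \<bar>z\<bar> * \<bar>z\<bar>) * \<bar>z\<bar>" if z: "\<bar>z\<bar> < r" for z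
  proof -
    have "norm ((P z - z *\<^sub>R E - (z\<^sup>2 / 2) *\<^sub>R W) - (P 0 - 0 *\<^sub>R E - (0\<^sup>2 / 2) *\<^sub>R W))
            \<le> (L * \<bar>z\<bar> * \<bar>z\<bar>) * \<bar>z\<bar>"
    proof (rule bound[OF z])
      fix y :: real assume y: "\<bar>y\<bar> \<le> \<bar>z\<bar>"
      have q: "((\<lambda>z. (z\<^sup>2 / 2) *\<^sub>R W) has_vector_derivative y *\<^sub>R W) (at y)"
        by (rule has_vector_derivative_eq_rhs[OF has_vector_derivative_scaleR])
           (auto intro!: derivative_eq_intros)
      show "((\<lambda>z. P z - z *\<^sub>R E - (z\<^sup>2 / 2) *\<^sub>R W) has_vector_derivative
              (deriv1 P y - E - y *\<^sub>R W)) (at y)"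
        using y z by (auto intro!: derivative_eq_intros D1 q)
      have "norm (deriv1 P y - E - y *\<^sub>R W) \<le> L * \<bar>y\<bar> * \<bar>y\<bar>"
        using b1[of y] y z by simp
      also have "\<dots> \<le> L * \<bar>z\<bar> * \<bar>z\<bar>" using y L0 by (intro mult_mono) auto
      finally show "norm (deriv1 P y - E - y *\<^sub>R W) \<le> L * \<bar>z\<bar> * \<bar>z\<bar>" .
    qed
    then show ?thesis by (simp add: algebra_simps)
  qed
  show ?thesis
    by (rule that[OF r L0]) (use b2 in \<open>simp add: E_def W_def power3_eq_cube mult.assoc\<close>)
qed

text \<open>The bound \<open>b\<close>, later \<open>\<epsilon>\<^sub>0\<close>, may exceed the
  radius \<open>r\<close> of smoothness. Beyond \<open>r\<close> the remainder is at most a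
  constant, and a constant is dominated by a multiple of the cube of the modulus of \<open>z\<close>
  once that modulus is at least \<open>r\<close>.\<close>

lemma Taylor_remainder_bounded:
  assumes P: "transition_family (P :: real \<Rightarrow> real ^ 'n ^ 'n)" and A1: "assumption_A1 P"
  obtains C where
    "\<And>z. \<bar>z\<bar> \<le> b \<Longrightarrow>
       norm (P z - P 0 - z *\<^sub>R deriv1 P 0 - (z\<^sup>2 / 2) *\<^sub>R deriv2 P 0) \<le> C * \<bar>z\<bar> ^ 3"
proof -
  obtain r L where r: "0 < r" and L: "0 \<le> L" and
    near: "\<And>z. \<bar>z\<bar> < r \<Longrightarrow>
       norm (P z - P 0 - z *\<^sub>R deriv1 P 0 - (z\<^sup>2 / 2) *\<^sub>R deriv2 P 0) \<le> L * \<bar>z\<bar> ^ 3"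
    using Taylor_remainder_local[OF A1] by metis
  \<comment> \<open>Triangle inequality for the remainder: two stochastic matrices, and the two
    Taylor terms at their largest for a modulus of at most \<open>b\<close>. In \<open>C\<close> the
    absolute value of \<open>K\<close> avoids a sign condition on \<open>b\<close>.\<close>
  define K where "K = 2 * real (CARD('n) * CARD('n)) + b * norm (deriv1 P 0) + b\<^sup>2 / 2 * norm (deriv2 P 0)"
  define C where "C = L + \<bar>K\<bar> / r ^ 3"
  show ?thesis
  proof (rule that)
    fix z :: real assume z: "\<bar>z\<bar> \<le> b"
    let ?R = "P z - P 0 - z *\<^sub>R deriv1 P 0 - (z\<^sup>2 / 2) *\<^sub>R deriv2 P 0"
    show "norm ?R \<le> C * \<bar>z\<bar> ^ 3"
    proof (cases "\<bar>z\<bar> < r")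
      case True
      have "L * \<bar>z\<bar> ^ 3 \<le> C * \<bar>z\<bar> ^ 3"
        using r by (intro mult_right_mono) (simp_all add: C_def)
      then show ?thesis using near[OF True] by linarith
    next
      case False
      have n: "norm (P y) \<le> real (CARD('n) * CARD('n))" for y
        using P norm_stochastic_le[of "P y"] by (simp add: transition_family_def)
      have "z\<^sup>2 \<le> b\<^sup>2" using power_mono[OF z, of 2] by simp
      then have "z\<^sup>2 / 2 * norm (deriv2 P 0) \<le> b\<^sup>2 / 2 * norm (deriv2 P 0)"
        "\<bar>z\<bar> * norm (deriv1 P 0) \<le> b * norm (deriv1 P 0)"
        using z by (simp_all add: mult_right_mono)
      moreover have "norm ?R \<le> norm (P z) + norm (P 0) + norm (z *\<^sub>R deriv1 P 0) + norm ((z\<^sup>2 / 2) *\<^sub>R deriv2 P 0)"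
        using norm_triangle_ineq4[of "P z" "P 0"]
          norm_triangle_ineq4[of "P z - P 0" "z *\<^sub>R deriv1 P 0"]
          norm_triangle_ineq4[of "P z - P 0 - z *\<^sub>R deriv1 P 0" "(z\<^sup>2 / 2) *\<^sub>R deriv2 P 0"]
        by linarith
      ultimately have "norm ?R \<le> K"
        using n[of z] n[of 0] unfolding K_def by simp
      also have "\<dots> \<le> \<bar>K\<bar> / r ^ 3 * \<bar>z\<bar> ^ 3"
      proof -
        have "\<bar>K\<bar> * 1 \<le> \<bar>K\<bar> * (\<bar>z\<bar> / r) ^ 3"
          using False r by (intro mult_left_mono one_le_power) auto
        then show ?thesis by (simp add: power_divide)
      qed
      also have "\<dots> \<le> C * \<bar>z\<bar> ^ 3"
        using L by (intro mult_right_mono) (simp_all add: C_def)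
      finally show ?thesis .
    qed
  qed
qed

section \<open>Essentially bounded random variables\<close>

text \<open>Measurability refers to \<open>N\<close>, the almost sure bound to \<open>M\<close>: a
  generated sigma-algebra such as \<open>F t\<close> carries no probability of its own, so its null
  sets would mean nothing.\<close>

definition bounded_rv :: "'w measure \<Rightarrow> 'w measure \<Rightarrow> ('w \<Rightarrow> 'b::real_normed_vector) \<Rightarrow> bool" where
  "bounded_rv M N f \<longleftrightarrow> f \<in> borel_measurable N \<and> (\<exists>C. AE w in M. norm (f w) \<le> C)"

lemma bounded_rv_const: "bounded_rv M N (\<lambda>_. c)"
  by (auto simp: bounded_rv_def)

lemma bounded_rv_linear:
  fixes T :: "'a::real_normed_vector \<Rightarrow> 'b::real_normed_vector"
  assumes T: "bounded_linear T" and f: "bounded_rv M N f"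
  shows "bounded_rv M N (\<lambda>w. T (f w))"
proof -
  obtain C where C: "AE w in M. norm (f w) \<le> C"
    using f by (auto simp: bounded_rv_def)
  obtain K where K: "0 \<le> K" "\<And>x. norm (T x) \<le> norm x * K"
    using bounded_linear.nonneg_bounded[OF T] by blast
  have "AE w in M. norm (T (f w)) \<le> C * K"
    using C by eventually_elim (meson K mult_right_mono order_trans)
  moreover have "(\<lambda>w. T (f w)) \<in> borel_measurable N"
    using f borel_measurable_continuous_onI[OF bounded_linear.continuous_on[OF T continuous_on_id]]
    by (auto simp: bounded_rv_def)
  ultimately show ?thesis by (auto simp: bounded_rv_def)
qed

lemma borel_measurable_bilinear:
  fixes H :: "'a::{real_normed_vector, second_countable_topology} \<Rightarrow>
    'b::{real_normed_vector, second_countable_topology} \<Rightarrow> 'c::real_normed_vector"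
  assumes "bounded_bilinear H" "f \<in> borel_measurable N" "g \<in> borel_measurable N"
  shows "(\<lambda>w. H (f w) (g w)) \<in> borel_measurable N"
  using assms(2,3)
  by (rule borel_measurable_continuous_Pair) (intro bounded_bilinear.continuous_on[OF assms(1)] continuous_intros)

lemma bounded_rv_bilinear:
  fixes H :: "'a::{real_normed_vector, second_countable_topology} \<Rightarrow>
    'b::{real_normed_vector, second_countable_topology} \<Rightarrow> 'c::real_normed_vector"
  assumes H: "bounded_bilinear H" and f: "bounded_rv M N f" and g: "bounded_rv M N g"
  shows "bounded_rv M N (\<lambda>w. H (f w) (g w))"
proof -
  obtain C where C: "AE w in M. norm (f w) \<le> C"
    using f by (auto simp: bounded_rv_def)
  obtain D where D: "AE w in M. norm (g w) \<le> D"
    using g by (auto simp: bounded_rv_def)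
  obtain K where K: "0 \<le> K" "\<And>x y. norm (H x y) \<le> norm x * norm y * K"
    using bounded_bilinear.nonneg_bounded[OF H] by blast
  have "AE w in M. norm (H (f w) (g w)) \<le> C * D * K"
    using C D
  proof eventually_elim
    case (elim w)
    have "norm (f w) * norm (g w) * K \<le> C * D * K"
      using elim K(1) by (intro mult_right_mono mult_mono) (auto intro: order_trans[OF norm_ge_zero])
    then show ?case using K(2) by (meson order_trans)
  qed
  moreover have "(\<lambda>w. H (f w) (g w)) \<in> borel_measurable N"
    using f g borel_measurable_bilinear[OF H] by (auto simp: bounded_rv_def)
  ultimately show ?thesis by (auto simp: bounded_rv_def)
qed

lemma bounded_rv_add:
  fixes f :: "'w \<Rightarrow> 'b::{real_normed_vector, second_countable_topology}"
  assumes f: "bounded_rv M N f" and g: "bounded_rv M N g"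
  shows "bounded_rv M N (\<lambda>w. f w + g w)"
proof -
  obtain C D where *: "AE w in M. norm (f w) \<le> C" "AE w in M. norm (g w) \<le> D"
    using f g by (auto simp: bounded_rv_def)
  have "AE w in M. norm (f w + g w) \<le> C + D"
    using * by eventually_elim (rule norm_triangle_mono)
  then show ?thesis using f g by (auto simp: bounded_rv_def)
qed

lemma bounded_rv_uminus: "bounded_rv M N f \<Longrightarrow> bounded_rv M N (\<lambda>w. - f w)"
  by (rule bounded_rv_linear[OF bounded_linear_minus[OF bounded_linear_ident]])

lemma bounded_rv_diff:
  fixes f :: "'w \<Rightarrow> 'b::{real_normed_vector, second_countable_topology}"
  assumes f: "bounded_rv M N f" and g: "bounded_rv M N g"
  shows "bounded_rv M N (\<lambda>w. f w - g w)"
  using bounded_rv_add[OF f bounded_rv_uminus[OF g]] by simp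

lemmas bounded_rv_scaleR = bounded_rv_bilinear[OF bounded_bilinear_scaleR]
lemmas bounded_rv_mult = bounded_rv_bilinear[OF bounded_bilinear_mult]
lemmas bounded_rv_outer = bounded_rv_bilinear[OF bounded_bilinear_outer]
lemmas bounded_rv_vm = bounded_rv_bilinear[OF bounded_bilinear_vector_matrix]
lemmas bounded_rv_mm = bounded_rv_bilinear[OF bounded_bilinear_matrix_matrix]
lemmas bounded_rv_nth = bounded_rv_linear[OF bounded_linear_vec_nth]
lemmas bounded_rv_diag = bounded_rv_linear[OF bounded_linear_diag]
lemmas bounded_rv_transpose = bounded_rv_linear[OF bounded_linear_transpose]

lemma bounded_rv_power2: "bounded_rv M N f \<Longrightarrow> bounded_rv M N (\<lambda>w. (f w :: real)\<^sup>2)"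
  unfolding power2_eq_square by (rule bounded_rv_mult)

lemmas bounded_rv_intros =
  bounded_rv_const bounded_rv_add bounded_rv_uminus bounded_rv_diff bounded_rv_scaleR bounded_rv_mult bounded_rv_power2
  bounded_rv_outer bounded_rv_vm bounded_rv_mm bounded_rv_nth bounded_rv_diag bounded_rv_transpose

lemma bounded_rv_measurable: "bounded_rv M M f \<Longrightarrow> f \<in> borel_measurable M"
  by (simp add: bounded_rv_def)

lemma bounded_rv_subalgebra:
  assumes "subalgebra M N" "bounded_rv M N f" shows "bounded_rv M M f"
  using assms measurable_from_subalg by (auto simp: bounded_rv_def)

lemma (in prob_space) bounded_rv_integrable:
  fixes f :: "'a \<Rightarrow> 'b::{banach, second_countable_topology}"
  shows "bounded_rv M M f \<Longrightarrow> integrable M f"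
  unfolding bounded_rv_def by (auto intro: integrable_const_bound)

section \<open>Independence\<close>

text \<open>Both sides are measures on a product space and need only be compared on rectangles,
  where independence is the claim.\<close>

lemma (in prob_space) indep_rv_distr_pair:
  assumes "indep_rv M S X T Y"
  shows "distr M (S \<Otimes>\<^sub>M T) (\<lambda>w. (X w, Y w)) = distr M S X \<Otimes>\<^sub>M distr M T Y"
proof -
  have [measurable]: "X \<in> measurable M S" "Y \<in> measurable M T"
    using assms by (auto simp: indep_rv_def)
  show ?thesis
  proof (rule sym, rule pair_measure_eqI)
    show "sigma_finite_measure (distr M S X)" "sigma_finite_measure (distr M T Y)"
      by (auto intro!: prob_space_imp_sigma_finite prob_space_distr)
    show "sets (distr M S X \<Otimes>\<^sub>M distr M T Y) = sets (distr M (S \<Otimes>\<^sub>M T) (\<lambda>w. (X w, Y w)))"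
      by simp
    fix A B assume "A \<in> sets (distr M S X)" "B \<in> sets (distr M T Y)"
    then have AB[measurable]: "A \<in> sets S" "B \<in> sets T" by auto
    have "prob ((X -` A \<inter> space M) \<inter> (Y -` B \<inter> space M)) = prob (X -` A \<inter> space M) * prob (Y -` B \<inter> space M)"
      using assms AB by (intro indep_setD) (auto simp: indep_rv_def)
    moreover have "(\<lambda>w. (X w, Y w)) -` (A \<times> B) \<inter> space M = (X -` A \<inter> space M) \<inter> (Y -` B \<inter> space M)"
      by auto
    ultimately show "emeasure (distr M S X) A * emeasure (distr M T Y) B =
        emeasure (distr M (S \<Otimes>\<^sub>M T) (\<lambda>w. (X w, Y w))) (A \<times> B)"
      by (simp add: emeasure_distr emeasure_eq_measure ennreal_mult'')
  qed
qed

text \<open>Fubini for the joint law, pulled back so that both integrals run over \<open>M\<close>.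
  The inner integral freezes \<open>X\<close> and averages over an independent copy of
  \<open>Y\<close>.\<close>

lemma (in prob_space) indep_rv_integral:
  fixes f :: "_ \<Rightarrow> 'c::{banach, second_countable_topology}"
  assumes XY: "indep_rv M S X T Y"
    and f[measurable]: "f \<in> borel_measurable (S \<Otimes>\<^sub>M T)"
    and int: "integrable M (\<lambda>w. f (X w, Y w))"
  shows "(\<integral>w. f (X w, Y w) \<partial>M) = (\<integral>w. (\<integral>w'. f (X w, Y w') \<partial>M) \<partial>M)"
proof -
  have [measurable]: "X \<in> measurable M S" "Y \<in> measurable M T"
    using XY by (auto simp: indep_rv_def)
  interpret X: prob_space "distr M S X" by (rule prob_space_distr) simp
  interpret Y: prob_space "distr M T Y" by (rule prob_space_distr) simp
  interpret XY: pair_prob_space "distr M S X" "distr M T Y" ..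
  have "(\<integral>w. f (X w, Y w) \<partial>M) = (\<integral>p. f p \<partial>distr M (S \<Otimes>\<^sub>M T) (\<lambda>w. (X w, Y w)))"
    by (subst integral_distr) auto
  also have "\<dots> = (\<integral>p. f p \<partial>(distr M S X \<Otimes>\<^sub>M distr M T Y))"
    by (simp only: indep_rv_distr_pair[OF XY])
  also have "\<dots> = (\<integral>x. (\<integral>y. f (x, y) \<partial>distr M T Y) \<partial>distr M S X)"
  proof (rule XY.integral_fst'[symmetric])
    have "integrable (distr M (S \<Otimes>\<^sub>M T) (\<lambda>w. (X w, Y w))) f"
      using int by (subst integrable_distr_eq) auto
    then show "integrable (distr M S X \<Otimes>\<^sub>M distr M T Y) f"
      by (simp only: indep_rv_distr_pair[OF XY])
  qed
  also have "\<dots> = (\<integral>w. (\<integral>y. f (X w, y) \<partial>distr M T Y) \<partial>M)"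
    by (subst integral_distr) (auto intro!: Y.borel_measurable_lebesgue_integral)
  also have "\<dots> = (\<integral>w. (\<integral>w'. f (X w, Y w') \<partial>M) \<partial>M)"
  proof (rule Bochner_Integration.integral_cong[OF refl])
    fix w assume "w \<in> space M"
    then have "X w \<in> space S" by (rule measurable_space[rotated]) simp
    then show "(\<integral>y. f (X w, y) \<partial>distr M T Y) = (\<integral>w'. f (X w, Y w') \<partial>M)"
      by (subst integral_distr) auto
  qed
  finally show ?thesis .
qed

text \<open>With the identity as a random variable into the \<open>\<sigma>\<close>-algebra of \<open>X\<close>, \<open>indep_rv_integral\<close> applies to
  integrands that depend on \<open>w\<close> through any function measurable with respect to \<open>X\<close>.\<close>

lemma (in prob_space) indep_rv_vimage_algebra:
  assumes "indep_rv M T Y S X"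
  shows "indep_rv M (vimage_algebra (space M) X S) (\<lambda>w. w) T Y"
proof -
  have [measurable]: "X \<in> measurable M S" "Y \<in> measurable M T"
    and ind: "indep_set {Y -` A \<inter> space M | A. A \<in> sets T} {X -` A \<inter> space M | A. A \<in> sets S}"
    using assms by (auto simp: indep_rv_def)
  have X: "X \<in> space M \<rightarrow> space S" using \<open>X \<in> measurable M S\<close> by (simp add: measurable_def)
  have eq: "{(\<lambda>w. w) -` A \<inter> space M | A. A \<in> sets (vimage_algebra (space M) X S)} =
      {X -` A \<inter> space M | A. A \<in> sets S}"
    by (auto simp: sets_vimage_algebra2[OF X] Int_assoc)
  have "indep_set {X -` A \<inter> space M | A. A \<in> sets S} {Y -` A \<inter> space M | A. A \<in> sets T}"
  proof (rule indep_setI)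
    fix a b assume "a \<in> {X -` A \<inter> space M | A. A \<in> sets S}" "b \<in> {Y -` A \<inter> space M | A. A \<in> sets T}"
    then show "prob (a \<inter> b) = prob a * prob b"
      using indep_setD[OF ind, of b a] by (simp add: Int_commute mult.commute)
  qed auto
  moreover have "(\<lambda>w. w) \<in> measurable M (vimage_algebra (space M) X S)"
    by (auto simp: measurable_def sets_vimage_algebra2[OF X] Int_assoc)
  ultimately show ?thesis
    unfolding indep_rv_def eq by simp
qed

section \<open>The update map\<close>

lemma sum_atMost_eq_lessThan:
  fixes j :: "'n::{finite, linorder}" and f :: "'n \<Rightarrow> real"
  shows "(\<Sum>k\<in>{..j}. f k) = (\<Sum>k\<in>{..<j}. f k) + f j"
proof -
  have "{..j} = insert j {..<j}" by auto
  then show ?thesis by simp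
qed

lemma borel_measurable_nth_nth:
  fixes f :: "'w \<Rightarrow> real ^ 'n ^ 'm"
  assumes "f \<in> borel_measurable N"
  shows "(\<lambda>w. f w $ i $ j) \<in> borel_measurable N"
proof -
  have "(\<lambda>Q :: real ^ 'n ^ 'm. Q $ i $ j) \<in> borel_measurable borel"
    by (intro borel_measurable_continuous_onI continuous_intros)
  then show ?thesis using assms by measurable
qed

lemma borel_measurable_Gmat:
  assumes P: "P \<in> borel_measurable borel"
    and [measurable]: "a \<in> borel_measurable N" "b \<in> borel_measurable N"
  shows "(\<lambda>w. Gmat P (a w) (b w) $ i $ j) \<in> borel_measurable N"
proof -
  have [measurable]: "(\<lambda>w. P (a w) $ i $ k) \<in> borel_measurable N" for k
    by (rule borel_measurable_nth_nth) (rule measurable_compose[OF assms(2) P])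
  show ?thesis unfolding Gmat_def by simp measurable
qed

text \<open>Inverse transform sampling: as a function of \<open>s\<close> the entry is the indicator
  of a half-open interval between two consecutive partial sums of row \<open>i\<close>. The row sum
  1 keeps this interval inside the unit interval, and its length is the entry of
  \<open>P z\<close>.\<close>

lemma integral_Gmat_uniform:
  assumes Q: "stochastic (P z)"
  shows "(\<integral>s. Gmat P z s $ i $ j \<partial>uniform_measure lborel {0..1}) = P z $ i $ j"
proof -
  define a where "a = (\<Sum>k\<in>{..<j}. P z $ i $ k)"
  define b where "b = a + P z $ i $ j"
  have a: "0 \<le> a" "a \<le> b"
    using Q by (auto simp: a_def b_def stochastic_def intro!: sum_nonneg)
  have "b = (\<Sum>k\<in>{..j}. P z $ i $ k)"
    by (simp add: b_def a_def sum_atMost_eq_lessThan)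
  also have "\<dots> \<le> (\<Sum>k\<in>UNIV. P z $ i $ k)"
    using Q by (intro sum_mono2) (auto simp: stochastic_def)
  finally have b: "b \<le> 1" using Q by (simp add: stochastic_def)
  have "Gmat P z s $ i $ j = indicator {a..<b} s" for s
    by (simp add: Gmat_def a_def b_def sum_atMost_eq_lessThan indicator_def)
  then have "(\<integral>s. Gmat P z s $ i $ j \<partial>uniform_measure lborel {0..1}) =
      measure (uniform_measure lborel {0..1}) {a..<b}"
    by simp
  also have "\<dots> = measure lborel ({0..1} \<inter> {a..<b}) / measure lborel {0..1::real}"
    by (rule measure_uniform_measure) auto
  also have "{0..1} \<inter> {a..<b} = {a..<b}" using a b by auto
  finally show ?thesis using a by (simp add: b_def)
qed

section \<open>Chains in a random environment\<close>

text \<open>The environment \<open>z\<close> is known in advance: all of it is measurable with respect to every \<open>F t\<close>.\<close>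

locale environment_chain = prob_space M
  for M :: "'w measure" +
  fixes P :: "real \<Rightarrow> real ^ 'n ^ 'n" and F :: "int \<Rightarrow> 'w measure"
    and z :: "int \<Rightarrow> 'w \<Rightarrow> real" and X :: "int \<Rightarrow> 'w \<Rightarrow> real ^ 'n"
  assumes family: "transition_family P"
    and subalgebra_F: "subalgebra M (F t)"
    and bounded_z: "bounded_rv M (F t) (z s)"
    and measurable_X: "s \<le> t \<Longrightarrow> X s \<in> borel_measurable (F t)"
    and basis: "AE w in M. \<exists>i. X t w = axis i 1"
    and step: "bounded_rv M (F t) h \<Longrightarrow>
      (\<integral>w. h w * X (t + 1) w $ j \<partial>M) = (\<integral>w. h w * (X t w v* P (z t w)) $ j \<partial>M)"
begin

definition Y :: "int \<Rightarrow> 'w \<Rightarrow> real ^ 'n" where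
  "Y t w = X t w - X (t - 1) w v* P (z (t - 1) w)"

lemma bounded_X: "s \<le> t \<Longrightarrow> bounded_rv M (F t) (X s)"
  unfolding bounded_rv_def
proof
  have "AE w in M. norm (X s w) \<le> 1"
    using basis[of s] by eventually_elim (auto simp: norm_axis_1)
  then show "\<exists>C. AE w in M. norm (X s w) \<le> C" ..
qed (rule measurable_X)

lemma bounded_P: "bounded_rv M (F t) (\<lambda>w. P (z s w))"
proof -
  have "P \<in> borel_measurable borel" "z s \<in> borel_measurable (F t)"
    using family bounded_z[of t s] by (auto simp: transition_family_def bounded_rv_def)
  then have "(\<lambda>w. P (z s w)) \<in> borel_measurable (F t)" by measurable
  moreover have "norm (P x) \<le> real (CARD('n) * CARD('n))" for x
    using family norm_stochastic_le[of "P x"] by (simp add: transition_family_def)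
  ultimately show ?thesis by (auto simp: bounded_rv_def)
qed

lemma bounded_Y: "s \<le> t \<Longrightarrow> bounded_rv M (F t) (Y s)"
  unfolding Y_def by (intro bounded_rv_intros bounded_X bounded_P) auto

lemmas bounded_M =
  bounded_rv_subalgebra[OF subalgebra_F bounded_z]
  bounded_rv_subalgebra[OF subalgebra_F bounded_X[OF order_refl]]
  bounded_rv_subalgebra[OF subalgebra_F bounded_P]
  bounded_rv_subalgebra[OF subalgebra_F bounded_Y[OF order_refl]]

text \<open>Entry by entry this is \<open>step\<close> with the test function
  \<open>g w $ i\<close>. So \<open>g\<close> may involve the whole environment, but the chain only
  up to time \<open>t\<close>.\<close>

lemma integral_outer_Y:
  fixes g :: "'w \<Rightarrow> real ^ 'm"
  assumes g: "bounded_rv M (F t) g"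
  shows "(\<integral>w. outer (g w) (Y (t + 1) w) \<partial>M) = 0"
proof -
  have gM: "bounded_rv M M g" by (rule bounded_rv_subalgebra[OF subalgebra_F g])
  have "(\<integral>w. outer (g w) (Y (t + 1) w) \<partial>M) $ i $ j = 0" for i j
  proof -
    have gi: "bounded_rv M (F t) (\<lambda>w. g w $ i)"
      by (intro bounded_rv_intros g)
    have "(\<integral>w. outer (g w) (Y (t + 1) w) \<partial>M) $ i $ j = (\<integral>w. outer (g w) (Y (t + 1) w) $ i $ j \<partial>M)"
      using gM
      by (intro integral_bounded_linear[symmetric] bounded_linear_compose[OF bounded_linear_vec_nth bounded_linear_vec_nth, unfolded o_def]
           bounded_rv_integrable bounded_rv_intros bounded_M)
    also have "\<dots> = (\<integral>w. g w $ i * X (t + 1) w $ j - g w $ i * (X t w v* P (z t w)) $ j \<partial>M)"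
      by (simp add: outer_def Y_def algebra_simps)
    also have "\<dots> = (\<integral>w. g w $ i * X (t + 1) w $ j \<partial>M) - (\<integral>w. g w $ i * (X t w v* P (z t w)) $ j \<partial>M)"
      using gM by (intro Bochner_Integration.integral_diff bounded_rv_integrable bounded_rv_intros bounded_M)
    also have "\<dots> = 0" by (simp add: step[OF gi])
    finally show ?thesis .
  qed
  then show ?thesis by (simp add: vec_eq_iff)
qed

lemma integral_outer_Y':
  fixes g :: "'w \<Rightarrow> real ^ 'm"
  assumes g: "bounded_rv M (F t) g"
  shows "(\<integral>w. outer (Y (t + 1) w) (g w) \<partial>M) = 0"
proof -
  have gM: "bounded_rv M M g" by (rule bounded_rv_subalgebra[OF subalgebra_F g])
  have "(\<integral>w. outer (Y (t + 1) w) (g w) \<partial>M) = (\<integral>w. transpose (outer (g w) (Y (t + 1) w)) \<partial>M)"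
    by (simp add: transpose_outer)
  also have "\<dots> = transpose (\<integral>w. outer (g w) (Y (t + 1) w) \<partial>M)"
    using gM by (intro integral_bounded_linear bounded_linear_transpose bounded_rv_integrable bounded_rv_intros bounded_M)
  also have "\<dots> = 0" by (simp add: integral_outer_Y[OF g] transpose_def vec_eq_iff)
  finally show ?thesis .
qed

text \<open>The scalar \<open>h\<close> is read as a vector of length one, so that the matrix
  version applies.\<close>

lemma integral_scaleR_Y:
  assumes h: "bounded_rv M (F t) h"
  shows "(\<integral>w. h w *\<^sub>R Y (t + 1) w \<partial>M) = 0"
proof -
  have hM: "bounded_rv M M h" by (rule bounded_rv_subalgebra[OF subalgebra_F h])
  have bl: "bounded_linear (\<lambda>Q :: real ^ 'n ^ 1. Q $ 1)" by (rule bounded_linear_vec_nth)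
  have g: "bounded_rv M (F t) (\<lambda>w. h w *\<^sub>R (1 :: real ^ 1))"
    by (intro bounded_rv_intros h)
  have gM: "bounded_rv M M (\<lambda>w. h w *\<^sub>R (1 :: real ^ 1))"
    by (intro bounded_rv_intros hM)
  have "(\<integral>w. h w *\<^sub>R Y (t + 1) w \<partial>M) = (\<integral>w. outer (h w *\<^sub>R (1 :: real ^ 1)) (Y (t + 1) w) $ 1 \<partial>M)"
    by (intro Bochner_Integration.integral_cong refl) (simp add: outer_def vec_eq_iff)
  also have "\<dots> = (\<integral>w. outer (h w *\<^sub>R (1 :: real ^ 1)) (Y (t + 1) w) \<partial>M) $ 1"
    using gM by (intro integral_bounded_linear[OF bl] bounded_rv_integrable bounded_rv_outer bounded_M)
  finally show ?thesis by (simp add: integral_outer_Y[OF g])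
qed

text \<open>\<open>outer Y Y = diag X' - outer p p - outer p Y - outer Y p\<close> where \<open>X' = p + Y\<close> is a basis vector;
  all terms linear in \<open>Y\<close> integrate to zero.\<close>

lemma integral_outer_Y_Y:
  assumes h: "bounded_rv M (F t) h"
  shows "(\<integral>w. h w *\<^sub>R outer (Y (t + 1) w) (Y (t + 1) w) \<partial>M) =
    (\<integral>w. h w *\<^sub>R (diag (X t w v* P (z t w)) -
        transpose (P (z t w)) ** diag (X t w) ** P (z t w)) \<partial>M)"
proof -
  have hM: "bounded_rv M M h" by (rule bounded_rv_subalgebra[OF subalgebra_F h])
  define p where "p w = X t w v* P (z t w)" for w
  define y where "y = Y (t + 1)"
  have p: "bounded_rv M (F t) p" unfolding p_def by (intro bounded_rv_intros bounded_X bounded_P order_refl)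
  have pM: "bounded_rv M M p" by (rule bounded_rv_subalgebra[OF subalgebra_F p])
  have yM: "bounded_rv M M y" unfolding y_def by (intro bounded_M)
  note M = hM pM yM
  have hp: "bounded_rv M (F t) (\<lambda>w. h w *\<^sub>R p w)" by (intro bounded_rv_intros p h)
  have scale: "outer (c *\<^sub>R u) v = c *\<^sub>R outer u v" "outer u (c *\<^sub>R v) = c *\<^sub>R outer u v"
    for c and u v :: "real ^ 'n"
    by (simp_all add: outer_def vec_eq_iff)
  have 1: "AE w in M. h w *\<^sub>R outer (y w) (y w) =
      h w *\<^sub>R (diag (p w) - transpose (P (z t w)) ** diag (X t w) ** P (z t w)) +
      (diag (h w *\<^sub>R y w) - outer (h w *\<^sub>R p w) (y w) - outer (y w) (h w *\<^sub>R p w))"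
    using basis[of t] basis[of "t + 1"]
  proof eventually_elim
    case (elim w)
    then obtain i k where ik: "X t w = axis i 1" "X (t + 1) w = axis k 1" by blast
    have X': "p w + y w = X (t + 1) w" by (simp add: p_def y_def Y_def)
    have d: "outer (p w + y w) (p w + y w) = diag (p w + y w)"
      by (simp add: X' ik outer_axis)
    have T: "transpose (P (z t w)) ** diag (X t w) ** P (z t w) = outer (p w) (p w)"
      by (simp add: p_def outer_vector_matrix_left outer_vector_matrix_right matrix_mul_assoc ik outer_axis)
    have yy: "outer (y w) (y w) =
        diag (p w) + diag (y w) - outer (p w) (p w) - outer (p w) (y w) - outer (y w) (p w)"
      using d by (simp add: bounded_bilinear.add_left[OF bounded_bilinear_outer]
          bounded_bilinear.add_right[OF bounded_bilinear_outer]
          linear_add[OF bounded_linear.linear[OF bounded_linear_diag]] algebra_simps)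
    show ?case
      unfolding T yy
      by (simp add: scale linear_scale[OF bounded_linear.linear[OF bounded_linear_diag]] algebra_simps)
  qed
  have "(\<integral>w. h w *\<^sub>R outer (y w) (y w) \<partial>M) =
      (\<integral>w. h w *\<^sub>R (diag (p w) - transpose (P (z t w)) ** diag (X t w) ** P (z t w)) +
      (diag (h w *\<^sub>R y w) - outer (h w *\<^sub>R p w) (y w) - outer (y w) (h w *\<^sub>R p w)) \<partial>M)"
    by (intro integral_cong_AE 1 bounded_rv_measurable bounded_rv_intros M bounded_M)
  also have "\<dots> = (\<integral>w. h w *\<^sub>R (diag (p w) - transpose (P (z t w)) ** diag (X t w) ** P (z t w)) \<partial>M) +
      ((\<integral>w. diag (h w *\<^sub>R y w) \<partial>M) - (\<integral>w. outer (h w *\<^sub>R p w) (y w) \<partial>M) - (\<integral>w. outer (y w) (h w *\<^sub>R p w) \<partial>M))"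
    by (simp add: Bochner_Integration.integral_add Bochner_Integration.integral_diff
        bounded_rv_integrable bounded_rv_intros M bounded_M)
  also have "(\<integral>w. diag (h w *\<^sub>R y w) \<partial>M) = diag (\<integral>w. h w *\<^sub>R y w \<partial>M)"
    by (intro integral_bounded_linear bounded_linear_diag bounded_rv_integrable bounded_rv_intros M)
  also have "\<dots> = 0"
    unfolding y_def integral_scaleR_Y[OF h] by (simp add: diag_def vec_eq_iff)
  also have "(\<integral>w. outer (h w *\<^sub>R p w) (y w) \<partial>M) = 0"
    unfolding y_def by (rule integral_outer_Y[OF hp])
  also have "(\<integral>w. outer (y w) (h w *\<^sub>R p w) \<partial>M) = 0"
    unfolding y_def by (rule integral_outer_Y'[OF hp])
  finally show ?thesis by (simp add: y_def p_def)
qed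

text \<open>Write \<open>X (t + 1)\<close> as its one-step prediction plus \<open>Y (t + 1)\<close>;
  the second part is orthogonal to \<open>Y s\<close>, which is already known at time
  \<open>t\<close>. The factor \<open>P (z t w)\<close> has to stay under the integral, because
  \<open>h\<close> and \<open>Y s\<close> may depend on the same environment.\<close>

lemma integral_outer_X_Y_Suc:
  assumes h: "bounded_rv M (F t) h" and st: "s \<le> t"
  shows "(\<integral>w. h w *\<^sub>R outer (X (t + 1) w) (Y s w) \<partial>M) =
    (\<integral>w. h w *\<^sub>R (transpose (P (z t w)) ** outer (X t w) (Y s w)) \<partial>M)"
proof -
  have hM: "bounded_rv M M h" by (rule bounded_rv_subalgebra[OF subalgebra_F h])
  have hY: "bounded_rv M (F t) (\<lambda>w. h w *\<^sub>R Y s w)" by (intro bounded_rv_intros h bounded_Y st)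
  have "h w *\<^sub>R outer (X (t + 1) w) (Y s w) =
      h w *\<^sub>R (transpose (P (z t w)) ** outer (X t w) (Y s w)) + outer (Y (t + 1) w) (h w *\<^sub>R Y s w)" for w
    by (simp add: Y_def[of "t + 1"] flip: outer_vector_matrix_left)
       (simp add: outer_def vec_eq_iff algebra_simps)
  then have "(\<integral>w. h w *\<^sub>R outer (X (t + 1) w) (Y s w) \<partial>M) =
      (\<integral>w. h w *\<^sub>R (transpose (P (z t w)) ** outer (X t w) (Y s w)) \<partial>M) +
      (\<integral>w. outer (Y (t + 1) w) (h w *\<^sub>R Y s w) \<partial>M)"
    by (simp add: Bochner_Integration.integral_add bounded_rv_integrable bounded_rv_intros hM bounded_M)
  then show ?thesis by (simp add: integral_outer_Y'[OF hY])
qed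

text \<open>The prediction part of \<open>X (t + 1)\<close> is known at time \<open>t\<close> and
  hence orthogonal to \<open>Y (t + 1)\<close>. This gives the starting value of the recursions in
  the time of the state.\<close>

lemma integral_outer_X_Y_same:
  assumes h: "bounded_rv M (F t) h"
  shows "(\<integral>w. h w *\<^sub>R outer (X (t + 1) w) (Y (t + 1) w) \<partial>M) =
    (\<integral>w. h w *\<^sub>R outer (Y (t + 1) w) (Y (t + 1) w) \<partial>M)"
proof -
  have hM: "bounded_rv M M h" by (rule bounded_rv_subalgebra[OF subalgebra_F h])
  define g where "g w = h w *\<^sub>R (X t w v* P (z t w))" for w
  have g: "bounded_rv M (F t) g"
    unfolding g_def by (intro bounded_rv_intros h bounded_X bounded_P order_refl)
  have gM: "bounded_rv M M g" by (rule bounded_rv_subalgebra[OF subalgebra_F g])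
  have "h w *\<^sub>R outer (X (t + 1) w) (Y (t + 1) w) =
      h w *\<^sub>R outer (Y (t + 1) w) (Y (t + 1) w) + outer (g w) (Y (t + 1) w)" for w
    by (simp add: Y_def g_def outer_def vec_eq_iff algebra_simps)
  then have "(\<integral>w. h w *\<^sub>R outer (X (t + 1) w) (Y (t + 1) w) \<partial>M) =
      (\<integral>w. h w *\<^sub>R outer (Y (t + 1) w) (Y (t + 1) w) \<partial>M) + (\<integral>w. outer (g w) (Y (t + 1) w) \<partial>M)"
    by (simp add: Bochner_Integration.integral_add bounded_rv_integrable bounded_rv_intros hM gM bounded_M)
  then show ?thesis by (simp add: integral_outer_Y[OF g])
qed

text \<open>The same decomposition with an arbitrary vector of the past. For the unperturbed chain,
  whose matrix is constant, iterating it produces powers of \<open>P 0\<close>.\<close>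

lemma integral_outer_X_X_Suc:
  fixes g :: "'w \<Rightarrow> real ^ 'm"
  assumes g: "bounded_rv M (F t) g"
  shows "(\<integral>w. outer (X (t + 1) w) (g w) \<partial>M) = (\<integral>w. transpose (P (z t w)) ** outer (X t w) (g w) \<partial>M)"
proof -
  have gM: "bounded_rv M M g" by (rule bounded_rv_subalgebra[OF subalgebra_F g])
  have "outer (X (t + 1) w) (g w) =
      transpose (P (z t w)) ** outer (X t w) (g w) + outer (Y (t + 1) w) (g w)" for w
    by (simp add: Y_def[of "t + 1"] flip: outer_vector_matrix_left)
       (simp add: outer_def vec_eq_iff algebra_simps)
  then have "(\<integral>w. outer (X (t + 1) w) (g w) \<partial>M) =
      (\<integral>w. transpose (P (z t w)) ** outer (X t w) (g w) \<partial>M) + (\<integral>w. outer (Y (t + 1) w) (g w) \<partial>M)"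
    by (simp add: Bochner_Integration.integral_add bounded_rv_integrable bounded_rv_intros gM bounded_M)
  then show ?thesis by (simp add: integral_outer_Y'[OF g])
qed

end

section \<open>The coupled process\<close>

text \<open>A single value of the perturbation size. Only exact identities are proved here, so any
  almost sure bound on \<open>\<zeta>\<close> will do; orders enter later.\<close>

locale coupled_chains = prob_space M
  for M :: "'w measure" +
  fixes P :: "real \<Rightarrow> 'n::{finite, linorder} rmat" and \<pi>\<^sub>0 :: "'n rvec"
    and \<zeta> :: "int \<Rightarrow> 'w \<Rightarrow> real" and \<Gamma> \<Gamma>b :: "int \<Rightarrow> 'w \<Rightarrow> 'n rvec"
    and No Nb :: "int \<Rightarrow> 'w \<Rightarrow> real"
  assumes transition: "transition_family P"
    and irreducible: "irreducible_matrix (P 0)"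
    and invariant: "invariant_probability (P 0) \<pi>\<^sub>0"
    and process: "coupled_process P M \<zeta> \<Gamma> \<Gamma>b No Nb"
    and bounded_env: "\<exists>c. AE w in M. \<bar>\<zeta> t w\<bar> \<le> c"
begin

lemma stationary: "stationary_process M (\<lambda>t w. (\<Gamma> t w, \<Gamma>b t w, \<zeta> t w))"
  using process by (simp add: coupled_process_def)

lemma state_axis: "AE w in M. (\<exists>i. \<Gamma> t w = axis i 1) \<and> (\<exists>i. \<Gamma>b t w = axis i 1)"
  using process by (simp add: coupled_process_def)

lemma noise_uniform:
  "distr M borel (No t) = uniform_measure lborel {0..1}"
  "distr M borel (Nb t) = uniform_measure lborel {0..1}"
  using process by (simp_all add: coupled_process_def iid_uniform_def)

lemma recursion_base: "AE w in M. \<Gamma>b (t + 1) w = \<Gamma>b t w v* Gmat P 0 (Nb (t + 1) w)"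
  using process by (simp add: coupled_process_def)

lemma recursion: "AE w in M. \<Gamma> (t + 1) w =
    \<Gamma> t w v* Gmat P (\<zeta> t w) (if \<Gamma> t w = \<Gamma>b t w then Nb (t + 1) w else No (t + 1) w)"
  using process by (simp add: coupled_process_def driving_noise_def)

section \<open>The filtration generated by the environment and the past of both chains\<close>

definition past :: "int \<Rightarrow> 'w \<Rightarrow> (int \<Rightarrow> real) \<times> (int \<Rightarrow> 'n rvec \<times> 'n rvec)" where
  "past t w = (\<lambda>u. \<zeta> u w, \<lambda>u\<in>{..t}. (\<Gamma> u w, \<Gamma>b u w))"

abbreviation past_space :: "int \<Rightarrow> ((int \<Rightarrow> real) \<times> (int \<Rightarrow> 'n rvec \<times> 'n rvec)) measure" where
  "past_space t \<equiv> path_space UNIV \<Otimes>\<^sub>M path_space {..t}"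

definition F :: "int \<Rightarrow> 'w measure" where
  "F t = vimage_algebra (space M) (past t) (past_space t)"

lemma indep_noise:
  "indep_rv M borel (\<lambda>w. (No (t + 1) w, Nb (t + 1) w)) (past_space t) (past t)"
  using process by (simp add: coupled_process_def past_def[abs_def])

lemma measurable_past: "past t \<in> measurable M (past_space t)"
  using indep_noise by (simp add: indep_rv_def)

lemma measurable_past_F: "past t \<in> measurable (F t) (past_space t)"
  unfolding F_def using measurable_space[OF measurable_past] by (intro measurable_vimage_algebra1) auto

lemma subalgebra_F: "subalgebra M (F t)"
proof -
  have "past t \<in> space M \<rightarrow> space (past_space t)"
    using measurable_past[of t] by (simp add: measurable_def)
  then show ?thesis
    using measurable_sets[OF measurable_past]
    by (auto simp: subalgebra_def F_def sets_vimage_algebra2)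
qed

lemma measurable_env_F: "\<zeta> s \<in> borel_measurable (F t)"
proof -
  have "(\<lambda>w. fst (past t w) s) \<in> borel_measurable (F t)"
    using measurable_past_F[of t] by measurable
  then show ?thesis by (simp add: past_def)
qed

lemma measurable_state_F:
  assumes "s \<le> t"
  shows "\<Gamma> s \<in> borel_measurable (F t)" "\<Gamma>b s \<in> borel_measurable (F t)"
proof -
  have [measurable]: "s \<in> {..t}" using assms by simp
  have "(\<lambda>w. snd (past t w) s) \<in> borel_measurable (F t)"
    using measurable_past_F[of t] by measurable
  then have *: "(\<lambda>w. (\<Gamma> s w, \<Gamma>b s w)) \<in> borel_measurable (F t)"
    using assms by (simp add: past_def)
  have [measurable]: "fst \<in> borel_measurable (borel :: ('n rvec \<times> 'n rvec) measure)"
    "snd \<in> borel_measurable (borel :: ('n rvec \<times> 'n rvec) measure)"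
    by (auto intro!: borel_measurable_continuous_onI continuous_intros)
  show "\<Gamma> s \<in> borel_measurable (F t)" "\<Gamma>b s \<in> borel_measurable (F t)"
    using measurable_compose[OF *, of fst borel] measurable_compose[OF *, of snd borel] by simp_all
qed

lemma bounded_states:
  assumes "s \<le> t"
  shows "bounded_rv M (F t) (\<Gamma> s)" "bounded_rv M (F t) (\<Gamma>b s)"
proof -
  have "AE w in M. norm (\<Gamma> s w) \<le> 1" "AE w in M. norm (\<Gamma>b s w) \<le> 1"
    using state_axis[of s] by (eventually_elim; auto simp: norm_axis_1)+
  then show "bounded_rv M (F t) (\<Gamma> s)" "bounded_rv M (F t) (\<Gamma>b s)"
    using measurable_state_F[OF assms] by (auto simp: bounded_rv_def)
qed

section \<open>Averaging over the driving noise\<close>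

lemma integral_Gmat_noise:
  "(\<integral>w. Gmat P x (No t w) $ i $ j \<partial>M) = P x $ i $ j"
  "(\<integral>w. Gmat P x (Nb t w) $ i $ j \<partial>M) = P x $ i $ j"
proof -
  have st: "stochastic (P x)" and [measurable]: "P \<in> borel_measurable borel"
    using transition by (simp_all add: transition_family_def)
  have G[measurable]: "(\<lambda>s. Gmat P x s $ i $ j) \<in> borel_measurable borel"
    by (rule borel_measurable_Gmat) auto
  \<comment> \<open>The independence statement at time \<open>t - 1\<close> concerns the noise at
    time \<open>t\<close> and includes its measurability.\<close>
  have [measurable]: "(\<lambda>w. (No (t - 1 + 1) w, Nb (t - 1 + 1) w)) \<in> borel_measurable M"
    using indep_noise[of "t - 1"] unfolding indep_rv_def by blast
  then have "(\<lambda>w. fst (No t w, Nb t w)) \<in> borel_measurable M" "(\<lambda>w. snd (No t w, Nb t w)) \<in> borel_measurable M"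
    unfolding borel_prod[symmetric] by simp_all
  then have [measurable]: "No t \<in> borel_measurable M" "Nb t \<in> borel_measurable M" by simp_all
  show "(\<integral>w. Gmat P x (No t w) $ i $ j \<partial>M) = P x $ i $ j"
    using integral_Gmat_uniform[where P = P and z = x and i = i and j = j, OF st] by (simp add: noise_uniform(1)[of t, symmetric] integral_distr)
  show "(\<integral>w. Gmat P x (Nb t w) $ i $ j \<partial>M) = P x $ i $ j"
    using integral_Gmat_uniform[where P = P and z = x and i = i and j = j, OF st] by (simp add: noise_uniform(2)[of t, symmetric] integral_distr)
qed

text \<open>Given the past, the parameter \<open>a\<close> and the choice \<open>c\<close> between
  the two noises are constants. Both noises are uniform, so either choice yields the same mean:
  switching noises couples the chains without disturbing the transition law of
  \<open>\<Gamma>\<close>.\<close>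

lemma integral_Gmat_past:
  assumes k: "bounded_rv M (F t) k" and c: "Measurable.pred (F t) c" and a: "a \<in> borel_measurable (F t)"
  defines "G \<equiv> \<lambda>i j w. Gmat P (a w) (if c w then Nb (t + 1) w else No (t + 1) w) $ i $ j"
  shows "bounded_rv M M (G i j)" "(\<integral>w. k w * G i j w \<partial>M) = (\<integral>w. k w * P (a w) $ i $ j \<partial>M)"
proof -
  define U where "U w = (No (t + 1) w, Nb (t + 1) w)" for w
  define g where "g p = Gmat P (a (fst p)) (if c (fst p) then snd (snd p) else fst (snd p)) $ i $ j" for p
  have Pm: "P \<in> borel_measurable borel" using transition by (simp add: transition_family_def)
  have ind: "indep_rv M (F t) (\<lambda>w. w) borel U"
    unfolding F_def U_def by (rule indep_rv_vimage_algebra) (rule indep_noise)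
  have [measurable]: "k \<in> borel_measurable (F t)" "c \<in> measurable (F t) (count_space UNIV)" "a \<in> borel_measurable (F t)"
    using k c a by (simp_all add: bounded_rv_def)
  have [measurable]: "(\<lambda>w. w) \<in> measurable M (F t)" "U \<in> borel_measurable M"
    using ind by (simp_all add: indep_rv_def)
  have [measurable]: "fst \<in> borel_measurable (borel :: (real \<times> real) measure)"
    "snd \<in> borel_measurable (borel :: (real \<times> real) measure)"
    by (auto intro!: borel_measurable_continuous_onI continuous_intros)
  have g[measurable]: "g \<in> borel_measurable (F t \<Otimes>\<^sub>M borel)"
    unfolding g_def by (rule borel_measurable_Gmat[OF Pm]) measurable
  have G: "G i j w = g (w, U w)" for w by (simp add: G_def g_def U_def)
  have "(\<lambda>w. g (w, U w)) \<in> borel_measurable M" by measurable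
  moreover have "\<bar>g p\<bar> \<le> 1" for p by (simp add: g_def Gmat_def)
  ultimately show bG: "bounded_rv M M (G i j)"
    unfolding bounded_rv_def by (intro conjI exI[of _ 1] AE_I2) (simp_all add: G[abs_def])
  have "(\<integral>w. k w * G i j w \<partial>M) = (\<integral>w. (\<lambda>p. k (fst p) * g p) (w, U w) \<partial>M)"
    by (simp add: G)
  also have "\<dots> = (\<integral>w. (\<integral>w'. (\<lambda>p. k (fst p) * g p) (w, U w') \<partial>M) \<partial>M)"
  proof (rule indep_rv_integral[OF ind])
    show "(\<lambda>p. k (fst p) * g p) \<in> borel_measurable (F t \<Otimes>\<^sub>M borel)" by measurable
    have "bounded_rv M M (\<lambda>w. k w * G i j w)"
      by (intro bounded_rv_mult bG bounded_rv_subalgebra[OF subalgebra_F k])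
    then show "integrable M (\<lambda>w. (\<lambda>p. k (fst p) * g p) (w, U w))"
      using bounded_rv_integrable by (simp add: G)
  qed
  also have "\<dots> = (\<integral>w. k w * P (a w) $ i $ j \<partial>M)"
  proof (rule Bochner_Integration.integral_cong[OF refl])
    show "(\<integral>w'. (\<lambda>p. k (fst p) * g p) (w, U w') \<partial>M) = k w * P (a w) $ i $ j" for w
      by (cases "c w") (simp_all add: g_def U_def integral_Gmat_noise)
  qed
  finally show "(\<integral>w. k w * G i j w \<partial>M) = (\<integral>w. k w * P (a w) $ i $ j \<partial>M)" .
qed

text \<open>One argument for both chains: \<open>\<Gamma>\<close> is the case where \<open>c\<close>
  compares the two states and \<open>a\<close> is the current environment, \<open>\<Gamma>b\<close>
  the case where \<open>c\<close> is always true and \<open>a\<close> is 0.\<close>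

lemma one_step:
  fixes X :: "int \<Rightarrow> 'w \<Rightarrow> 'n rvec"
  assumes h: "bounded_rv M (F t) h" and X: "bounded_rv M (F t) (X t)" "bounded_rv M M (X (t + 1))"
    and c: "Measurable.pred (F t) c" and a: "a \<in> borel_measurable (F t)"
    and rec: "AE w in M. X (t + 1) w = X t w v* Gmat P (a w) (if c w then Nb (t + 1) w else No (t + 1) w)"
  shows "(\<integral>w. h w * X (t + 1) w $ j \<partial>M) = (\<integral>w. h w * (X t w v* P (a w)) $ j \<partial>M)"
proof -
  define G where "G i j w = Gmat P (a w) (if c w then Nb (t + 1) w else No (t + 1) w) $ i $ j" for i j w
  have k: "bounded_rv M (F t) (\<lambda>w. h w * X t w $ i)" for i
    by (intro bounded_rv_intros h X)
  note kM = bounded_rv_subalgebra[OF subalgebra_F k]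
  note hM = bounded_rv_subalgebra[OF subalgebra_F h]
  have Gb: "bounded_rv M M (G i j)" for i j
    unfolding G_def by (rule integral_Gmat_past(1)[OF h c a])
  have "P \<in> borel_measurable borel" using transition by (simp add: transition_family_def)
  then have "(\<lambda>w. P (a w)) \<in> borel_measurable (F t)" using a by measurable
  moreover have "norm (P x) \<le> real (CARD('n) * CARD('n))" for x
    using transition norm_stochastic_le[of "P x"] by (simp add: transition_family_def)
  ultimately have Pa: "bounded_rv M (F t) (\<lambda>w. P (a w))" by (auto simp: bounded_rv_def)
  have "(\<integral>w. h w * X (t + 1) w $ j \<partial>M) = (\<integral>w. (\<Sum>i\<in>UNIV. (h w * X t w $ i) * G i j w) \<partial>M)"
  proof (rule integral_cong_AE)
    show "(\<lambda>w. h w * X (t + 1) w $ j) \<in> borel_measurable M"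
      by (intro bounded_rv_measurable bounded_rv_intros hM X)
    show "(\<lambda>w. \<Sum>i\<in>UNIV. (h w * X t w $ i) * G i j w) \<in> borel_measurable M"
      by (intro borel_measurable_sum bounded_rv_measurable bounded_rv_mult kM Gb)
    show "AE w in M. h w * X (t + 1) w $ j = (\<Sum>i\<in>UNIV. (h w * X t w $ i) * G i j w)"
      using rec by eventually_elim (simp add: vector_matrix_mult_def G_def sum_distrib_left mult_ac)
  qed
  also have "\<dots> = (\<Sum>i\<in>UNIV. \<integral>w. (h w * X t w $ i) * G i j w \<partial>M)"
    by (intro Bochner_Integration.integral_sum bounded_rv_integrable bounded_rv_mult kM Gb)
  also have "\<dots> = (\<Sum>i\<in>UNIV. \<integral>w. (h w * X t w $ i) * P (a w) $ i $ j \<partial>M)"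
    unfolding G_def by (intro sum.cong refl integral_Gmat_past(2)[OF k c a])
  also have "\<dots> = (\<integral>w. (\<Sum>i\<in>UNIV. (h w * X t w $ i) * P (a w) $ i $ j) \<partial>M)"
    by (intro Bochner_Integration.integral_sum[symmetric] bounded_rv_integrable bounded_rv_intros kM
        bounded_rv_subalgebra[OF subalgebra_F Pa])
  also have "\<dots> = (\<integral>w. h w * (X t w v* P (a w)) $ j \<partial>M)"
    by (simp add: vector_matrix_mult_def sum_distrib_left mult_ac)
  finally show ?thesis .
qed

lemma bounded_env_F: "bounded_rv M (F t) (\<zeta> s)"
  using bounded_env[of s] measurable_env_F by (simp add: bounded_rv_def)

lemma pred_states_eq: "Measurable.pred (F t) (\<lambda>w. \<Gamma> t w = \<Gamma>b t w)"
  using measurable_state_F[of t t] by measurable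

sublocale chain: environment_chain M P F \<zeta> \<Gamma>
proof
  show "(\<integral>w. h w * \<Gamma> (t + 1) w $ j \<partial>M) = (\<integral>w. h w * (\<Gamma> t w v* P (\<zeta> t w)) $ j \<partial>M)"
    if "bounded_rv M (F t) h" for h t j
    using bounded_states(1)[of t t] bounded_states(1)[of "t + 1" "t + 1"]
    by (intro one_step[OF that _ _ pred_states_eq measurable_env_F recursion])
       (auto intro: bounded_rv_subalgebra[OF subalgebra_F])
  show "AE w in M. \<exists>i. \<Gamma> t w = axis i 1" for t
    using state_axis[of t] by eventually_elim simp
qed (auto intro: transition subalgebra_F bounded_env_F measurable_state_F)

text \<open>The unperturbed chain is a chain in the environment 0 for the same filtration, so every
  moment identity is available for it as well.\<close>

sublocale base: environment_chain M P F "\<lambda>_ _. 0" \<Gamma>b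
proof
  show "(\<integral>w. h w * \<Gamma>b (t + 1) w $ j \<partial>M) = (\<integral>w. h w * (\<Gamma>b t w v* P 0) $ j \<partial>M)"
    if "bounded_rv M (F t) h" for h t j
    using bounded_states(2)[of t t] bounded_states(2)[of "t + 1" "t + 1"] recursion_base[of t]
    by (intro one_step[OF that, where c = "\<lambda>_. True"])
       (auto intro: bounded_rv_subalgebra[OF subalgebra_F])
  show "AE w in M. \<exists>i. \<Gamma>b t w = axis i 1" for t
    using state_axis[of t] by eventually_elim simp
qed (auto intro: transition subalgebra_F measurable_state_F bounded_rv_const)

text \<open>Distributing the product leaves the state times the update matrix, which the recursion
  identifies with the next state; the noise disappears from the formula.\<close>

lemma innovation_AE:
  "AE w in M. innovation P \<zeta> \<Gamma> (driving_noise \<Gamma> \<Gamma>b No Nb) t w = chain.Y t w"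
  using recursion[of "t - 1"]
  by eventually_elim (simp add: innovation_def driving_noise_def chain.Y_def vector_matrix_mult_diff_rdistrib)

lemma innovation_base_AE: "AE w in M. innovation P (\<lambda>_ _. 0) \<Gamma>b Nb t w = base.Y t w"
  using recursion_base[of "t - 1"]
  by eventually_elim (simp add: innovation_def base.Y_def vector_matrix_mult_diff_rdistrib)

lemma measurable_Gmat_noise:
  assumes a: "a \<in> borel_measurable (F t)" and c: "Measurable.pred (F t) c"
  shows "(\<lambda>w. Gmat P (a w) (if c w then Nb (t + 1) w else No (t + 1) w)) \<in> borel_measurable M"
proof -
  have "(\<lambda>w. (Gmat P (a w) (if c w then Nb (t + 1) w else No (t + 1) w)) $ i $ j) \<in> borel_measurable M" for i j
    \<comment> \<open>The zero test function is a dummy: only the measurability contained in the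
      first conclusion is wanted.\<close>
    using integral_Gmat_past(1)[OF bounded_rv_const[of _ _ "0::real"] c a] by (rule bounded_rv_measurable)
  then show ?thesis
    by (subst borel_measurable_euclidean_space) (auto simp: Basis_vec_def inner_axis)
qed

lemma measurable_innovation:
  "innovation P \<zeta> \<Gamma> (driving_noise \<Gamma> \<Gamma>b No Nb) t \<in> borel_measurable M"
  "innovation P (\<lambda>_ _. 0) \<Gamma>b Nb t \<in> borel_measurable M"
proof -
  note Q = measurable_Gmat_noise[OF measurable_env_F pred_states_eq, of "t - 1" "t - 1", unfolded diff_add_cancel]
    measurable_Gmat_noise[of "\<lambda>_. 0" "t - 1" "\<lambda>_. True", unfolded diff_add_cancel]
  show "innovation P \<zeta> \<Gamma> (driving_noise \<Gamma> \<Gamma>b No Nb) t \<in> borel_measurable M"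
    unfolding innovation_def[abs_def] driving_noise_def
    using Q(1) chain.bounded_M(2,3)[THEN bounded_rv_measurable]
    by (intro borel_measurable_bilinear[OF bounded_bilinear_vector_matrix] borel_measurable_diff) simp_all
  show "innovation P (\<lambda>_ _. 0) \<Gamma>b Nb t \<in> borel_measurable M"
    unfolding innovation_def[abs_def]
    using Q(2) base.bounded_M(2)[THEN bounded_rv_measurable]
    by (intro borel_measurable_bilinear[OF bounded_bilinear_vector_matrix] borel_measurable_diff
        borel_measurable_const) simp_all
qed

text \<open>The premise asks for measurability of \<open>f\<close> along all measurable processes, not on the path space,
  so that the measurability rules for random variables prove it.\<close>

lemma integral_shift:
  fixes f :: "(int \<Rightarrow> 'n rvec) \<Rightarrow> (int \<Rightarrow> 'n rvec) \<Rightarrow> (int \<Rightarrow> real) \<Rightarrow> 'b::{banach, second_countable_topology}"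
  assumes f: "\<And>(N :: (int \<Rightarrow> 'n rvec \<times> 'n rvec \<times> real) measure) X Xb z.
    (\<And>t. X t \<in> borel_measurable N) \<Longrightarrow> (\<And>t. Xb t \<in> borel_measurable N) \<Longrightarrow> (\<And>t. z t \<in> borel_measurable N) \<Longrightarrow>
    (\<lambda>w. f (\<lambda>t. X t w) (\<lambda>t. Xb t w) (\<lambda>t. z t w)) \<in> borel_measurable N"
  shows "(\<integral>w. f (\<lambda>t. \<Gamma> (t + h) w) (\<lambda>t. \<Gamma>b (t + h) w) (\<lambda>t. \<zeta> (t + h) w) \<partial>M) =
    (\<integral>w. f (\<lambda>t. \<Gamma> t w) (\<lambda>t. \<Gamma>b t w) (\<lambda>t. \<zeta> t w) \<partial>M)"
proof -
  define W where "W t w = (\<Gamma> t w, \<Gamma>b t w, \<zeta> t w)" for t w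
  define g where "g w = f (\<lambda>t. fst (w t)) (\<lambda>t. fst (snd (w t))) (\<lambda>t. snd (snd (w t)))"
    for w :: "int \<Rightarrow> 'n rvec \<times> 'n rvec \<times> real"
  have W: "W t \<in> borel_measurable M" and
    law: "process_law M (\<lambda>t. W (t + h)) = process_law M W" for t
    using stationary by (simp_all add: stationary_process_def W_def[abs_def])
  have Wm: "(\<lambda>w t. W (t + k) w) \<in> measurable M (path_space UNIV)" for k
    by (rule measurable_PiM_single') (auto simp: W)
  have comp: "(\<lambda>w. w t) \<in> borel_measurable (path_space UNIV :: (int \<Rightarrow> 'n rvec \<times> 'n rvec \<times> real) measure)" for t
    by (rule measurable_component_singleton) simp
  have "fst \<in> borel_measurable (borel :: ('n rvec \<times> 'n rvec \<times> real) measure)"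
    "(\<lambda>p. fst (snd p)) \<in> borel_measurable (borel :: ('n rvec \<times> 'n rvec \<times> real) measure)"
    "(\<lambda>p. snd (snd p)) \<in> borel_measurable (borel :: ('n rvec \<times> 'n rvec \<times> real) measure)"
    by (auto intro!: borel_measurable_continuous_onI continuous_intros)
  note this[THEN measurable_compose[OF comp]]
  \<comment> \<open>The premise is used with the path space itself as \<open>N\<close>; its
    coordinates are the required measurable processes.\<close>
  then have g: "g \<in> borel_measurable (path_space UNIV)"
    unfolding g_def[abs_def] by (intro f)
  have "(\<integral>w. g (\<lambda>t. W (t + k) w) \<partial>M) = (\<integral>w. g w \<partial>process_law M (\<lambda>t. W (t + k)))" for k
    unfolding process_law_def by (rule integral_distr[symmetric, OF Wm g])
  from this[of h] this[of 0] have "(\<integral>w. g (\<lambda>t. W (t + h) w) \<partial>M) = (\<integral>w. g (\<lambda>t. W t w) \<partial>M)"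
    by (simp add: law)
  then show ?thesis by (simp add: g_def W_def)
qed

section \<open>Time shifts of mixed moments\<close>

lemma integral_shift_env: "(\<integral>w. \<zeta> a w * \<zeta> b w \<partial>M) = corr_ss M \<zeta> \<zeta> (a - b)"
  using integral_shift[of "\<lambda>X Xb z. z (a - b) * z 0" b] by (simp add: corr_ss_def)

lemma borel_measurable_bilinear_intros:
  fixes N :: "'v measure" and u :: "'v \<Rightarrow> real ^ 'k" and v :: "'v \<Rightarrow> real ^ 'm"
  shows "u \<in> borel_measurable N \<Longrightarrow> v \<in> borel_measurable N \<Longrightarrow> (\<lambda>w. outer (u w) (v w)) \<in> borel_measurable N"
    and "u \<in> borel_measurable N \<Longrightarrow> Q \<in> borel_measurable N \<Longrightarrow> (\<lambda>w. u w v* Q w) \<in> borel_measurable N"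
  by (rule borel_measurable_bilinear[OF bounded_bilinear_outer]; assumption)
     (rule borel_measurable_bilinear[OF bounded_bilinear_vector_matrix]; assumption)

lemma borel_measurable_P: "z \<in> borel_measurable N \<Longrightarrow> (\<lambda>w. P (z w)) \<in> borel_measurable N"
  by (rule measurable_compose[of z N borel]) (use transition in \<open>simp_all add: transition_family_def\<close>)

lemmas shift_intros = borel_measurable_bilinear_intros borel_measurable_P borel_measurable_scaleR
  borel_measurable_diff borel_measurable_const borel_measurable_power borel_measurable_times

text \<open>The function \<open>f\<close> lets one statement serve two weights: the identity with
  \<open>E\<close>, and half the square with \<open>W\<close>.\<close>

lemma integral_shift_Y:
  fixes f :: "real \<Rightarrow> real"
  assumes f: "f \<in> borel_measurable borel"
  shows "(\<integral>w. outer (f (\<zeta> a w) *\<^sub>R (\<Gamma> a w v* Q)) (chain.Y b w) \<partial>M) =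
    (\<integral>w. outer (f (\<zeta> (a - b) w) *\<^sub>R (\<Gamma> (a - b) w v* Q)) (chain.Y 0 w) \<partial>M)"
  using integral_shift[of "\<lambda>X Xb z. outer (f (z (a - b)) *\<^sub>R (X (a - b) v* Q)) (X 0 - X (- 1) v* P (z (- 1)))" b,
      OF shift_intros(1)[OF borel_measurable_scaleR[OF measurable_compose[OF _ f]]]]
  by (simp add: chain.Y_def shift_intros)

lemma integral_shift_X_X:
  "(\<integral>w. outer (\<zeta> a w *\<^sub>R (\<Gamma> a w v* Q)) (\<zeta> b w *\<^sub>R (\<Gamma> b w v* Q)) \<partial>M) =
    (\<integral>w. outer (\<zeta> (a - b) w *\<^sub>R (\<Gamma> (a - b) w v* Q)) (\<zeta> 0 w *\<^sub>R (\<Gamma> 0 w v* Q)) \<partial>M)"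
  using integral_shift[of "\<lambda>X Xb z. outer (z (a - b) *\<^sub>R (X (a - b) v* Q)) (z 0 *\<^sub>R (X 0 v* Q))" b]
  by (simp add: shift_intros)

lemma integral_shift_Y_Y:
  "(\<integral>w. outer (chain.Y a w) (chain.Y a w) \<partial>M) = (\<integral>w. outer (chain.Y b w) (chain.Y b w) \<partial>M)"
proof -
  have "(\<integral>w. outer (chain.Y c w) (chain.Y c w) \<partial>M) = (\<integral>w. outer (chain.Y 0 w) (chain.Y 0 w) \<partial>M)" for c
    using integral_shift[of "\<lambda>X Xb z. outer (X 0 - X (- 1) v* P (z (- 1))) (X 0 - X (- 1) v* P (z (- 1)))" c]
    by (simp add: chain.Y_def shift_intros)
  from this[of a] this[of b] show ?thesis by simp
qed

lemma integral_shift_env_Y_Y: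
  "(\<integral>w. \<zeta> a w *\<^sub>R outer (chain.Y b w) (chain.Y b w) \<partial>M) =
    (\<integral>w. \<zeta> 0 w *\<^sub>R outer (chain.Y (b - a) w) (chain.Y (b - a) w) \<partial>M)"
  using integral_shift[of "\<lambda>X Xb z. z 0 *\<^sub>R outer (X (b - a) - X (b - a - 1) v* P (z (b - a - 1)))
      (X (b - a) - X (b - a - 1) v* P (z (b - a - 1)))" a]
  by (simp add: chain.Y_def shift_intros)

lemma integral_shift_X: "(\<integral>w. \<Gamma> a w \<partial>M) = (\<integral>w. \<Gamma> b w \<partial>M)"
proof -
  have "(\<integral>w. \<Gamma> c w \<partial>M) = (\<integral>w. \<Gamma> 0 w \<partial>M)" for c
    using integral_shift[of "\<lambda>X Xb z. X 0" c] by simp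
  from this[of a] this[of b] show ?thesis by simp
qed

lemma integral_shift_env_X: "(\<integral>w. \<zeta> a w *\<^sub>R \<Gamma> a w \<partial>M) = (\<integral>w. \<zeta> 0 w *\<^sub>R \<Gamma> 0 w \<partial>M)"
  using integral_shift[of "\<lambda>X Xb z. z 0 *\<^sub>R X 0" a] by (simp add: shift_intros)

text \<open>By stationarity the mean does not depend on time, and the one-step identity with test
  function 1 makes it invariant under \<open>P 0\<close>. Basis vectors give nonnegative entries of
  sum one, so uniqueness identifies it with \<open>\<pi>\<^sub>0\<close>.\<close>

lemma integral_base: "(\<integral>w. \<Gamma>b t w \<partial>M) = \<pi>\<^sub>0"
proof -
  define q where "q = (\<integral>w. \<Gamma>b 0 w \<partial>M)"
  have int: "integrable M (\<Gamma>b s)" for s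
    by (intro bounded_rv_integrable base.bounded_M)
  have q: "(\<integral>w. \<Gamma>b s w \<partial>M) = q" for s
    using integral_shift[of "\<lambda>X Xb z. Xb 0" s] by (simp add: q_def)
  have comp: "q $ i = (\<integral>w. \<Gamma>b s w $ i \<partial>M)" for i s
    unfolding q[of s, symmetric] by (rule integral_bounded_linear[symmetric, OF bounded_linear_vec_nth int])
  have "invariant_probability (P 0) q"
    unfolding invariant_probability_def
  proof (intro conjI allI)
    show "0 \<le> q $ i" for i
      unfolding comp[of i 0]
    proof (rule integral_nonneg_AE)
      show "AE w in M. 0 \<le> \<Gamma>b 0 w $ i"
        using base.basis[of 0] by eventually_elim (auto simp: axis_def)
    qed
    have "(\<Sum>i\<in>UNIV. q $ i) = (\<integral>w. (\<Sum>i\<in>UNIV. \<Gamma>b 0 w $ i) \<partial>M)"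
      unfolding comp[of _ 0]
      by (intro Bochner_Integration.integral_sum[symmetric] bounded_rv_integrable bounded_rv_intros base.bounded_M)
    also have "\<dots> = (\<integral>w. 1 \<partial>M)"
    proof (rule integral_cong_AE)
      show "(\<lambda>w. \<Sum>i\<in>UNIV. \<Gamma>b 0 w $ i) \<in> borel_measurable M"
        by (intro borel_measurable_sum bounded_rv_measurable bounded_rv_intros base.bounded_M)
      show "AE w in M. (\<Sum>i\<in>UNIV. \<Gamma>b 0 w $ i) = 1"
        using base.basis[of 0] by eventually_elim (auto simp: axis_def)
    qed simp
    finally show "(\<Sum>i\<in>UNIV. q $ i) = 1" by (simp add: prob_space)
    have "(q v* P 0) $ j = q $ j" for j
    proof -
      have "q $ j = (\<integral>w. \<Gamma>b 1 w $ j \<partial>M)"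
        by (rule comp)
      also have "\<dots> = (\<integral>w. (\<Gamma>b 0 w v* P 0) $ j \<partial>M)"
        using base.step[OF bounded_rv_const[of _ _ 1], where t = 0 and j = j] by simp
      also have "\<dots> = (q v* P 0) $ j"
        unfolding q_def
        by (rule integral_bounded_linear[OF bounded_linear_compose[OF bounded_linear_vec_nth bounded_linear_vector_matrix_left] int])
      finally show ?thesis by simp
    qed
    then show "q v* P 0 = q" by (simp add: vec_eq_iff)
  qed
  moreover have "stochastic (P 0)" using transition by (simp add: transition_family_def)
  ultimately have "q = \<pi>\<^sub>0" using invariant_probability_unique irreducible invariant by blast
  then show ?thesis by (simp add: q)
qed

text \<open>At lag zero the outer square of a basis vector is its diagonal matrix. Each further step
  contributes the constant factor \<open>transpose (P 0)\<close>, which can leave the integral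
  because the matrix is not random.\<close>

lemma integral_outer_base:
  "(\<integral>w. outer (\<Gamma>b (s + int n) w) (\<Gamma>b s w) \<partial>M) = transpose (mpow (P 0) n) ** diag \<pi>\<^sub>0"
proof (induction n)
  case 0
  have "(\<integral>w. outer (\<Gamma>b s w) (\<Gamma>b s w) \<partial>M) = (\<integral>w. diag (\<Gamma>b s w) \<partial>M)"
  proof (rule integral_cong_AE)
    show "AE w in M. outer (\<Gamma>b s w) (\<Gamma>b s w) = diag (\<Gamma>b s w)"
      using base.basis[of s] by eventually_elim (auto simp: outer_axis)
  qed (intro bounded_rv_measurable bounded_rv_intros base.bounded_M)+
  also have "\<dots> = diag \<pi>\<^sub>0"
    unfolding integral_base[of s, symmetric]
    by (intro integral_bounded_linear bounded_linear_diag bounded_rv_integrable base.bounded_M)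
  finally show ?case by simp
next
  case (Suc n)
  have "bounded_rv M (F (s + int n)) (\<Gamma>b s)" by (rule base.bounded_X) simp
  from base.integral_outer_X_X_Suc[OF this]
  have "(\<integral>w. outer (\<Gamma>b (s + int (Suc n)) w) (\<Gamma>b s w) \<partial>M) =
      (\<integral>w. transpose (P 0) ** outer (\<Gamma>b (s + int n) w) (\<Gamma>b s w) \<partial>M)"
    by (simp add: add_ac)
  also have "\<dots> = transpose (P 0) ** (\<integral>w. outer (\<Gamma>b (s + int n) w) (\<Gamma>b s w) \<partial>M)"
    by (intro integral_bounded_linear bounded_linear_matrix_matrix_right bounded_rv_integrable
        bounded_rv_intros base.bounded_M)
  finally show ?case
    by (simp add: Suc mpow_Suc_right matrix_transpose_mul matrix_mul_assoc del: mpow.simps)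
qed

lemma integral_outer_base_Y:
  "(\<integral>w. outer (base.Y t w) (base.Y t w) \<partial>M) = diag \<pi>\<^sub>0 - transpose (P 0) ** diag \<pi>\<^sub>0 ** P 0"
proof -
  have "(\<integral>w. outer (base.Y t w) (base.Y t w) \<partial>M) =
      (\<integral>w. diag (\<Gamma>b (t - 1) w v* P 0) - transpose (P 0) ** diag (\<Gamma>b (t - 1) w) ** P 0 \<partial>M)"
    using base.integral_outer_Y_Y[OF bounded_rv_const[of _ _ 1], of "t - 1"] by simp
  also have "\<dots> = diag (\<pi>\<^sub>0 v* P 0) - transpose (P 0) ** diag \<pi>\<^sub>0 ** P 0"
    unfolding integral_base[of "t - 1", symmetric]
    by (intro integral_bounded_linear[OF bounded_linear_innovation_covariance] bounded_rv_integrable base.bounded_M)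
  also have "\<pi>\<^sub>0 v* P 0 = \<pi>\<^sub>0" using invariant by (simp add: invariant_probability_def)
  finally show ?thesis .
qed

text \<open>\<open>f\<close> and \<open>g\<close> act on whole paths, so that products at several
  times, such as lagged second moments, factorize in the same way.\<close>

lemma integral_env_base:
  fixes g :: "(int \<Rightarrow> 'n rvec) \<Rightarrow> 'b::{banach, second_countable_topology}"
  assumes f: "f \<in> borel_measurable (path_space UNIV)" "bounded_rv M M (\<lambda>w. f (\<lambda>t. \<zeta> t w))"
    and g: "g \<in> borel_measurable (path_space UNIV)" "bounded_rv M M (\<lambda>w. g (\<lambda>t. \<Gamma>b t w))"
  shows "(\<integral>w. f (\<lambda>t. \<zeta> t w) *\<^sub>R g (\<lambda>t. \<Gamma>b t w) \<partial>M) =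
    (\<integral>w. f (\<lambda>t. \<zeta> t w) \<partial>M) *\<^sub>R (\<integral>w. g (\<lambda>t. \<Gamma>b t w) \<partial>M)"
proof -
  have [measurable]: "f \<in> borel_measurable (path_space UNIV)" "g \<in> borel_measurable (path_space UNIV)"
    by (rule f g)+
  have "indep_rv M (path_space UNIV) (\<lambda>w t. \<Gamma>b t w) (path_space UNIV) (\<lambda>w t. \<zeta> t w)"
    using process by (simp add: coupled_process_def)
  from indep_rv_integral[OF this, of "\<lambda>(x, y). f y *\<^sub>R g x"]
  have "(\<integral>w. f (\<lambda>t. \<zeta> t w) *\<^sub>R g (\<lambda>t. \<Gamma>b t w) \<partial>M) =
      (\<integral>w. (\<integral>w'. f (\<lambda>t. \<zeta> t w') *\<^sub>R g (\<lambda>t. \<Gamma>b t w) \<partial>M) \<partial>M)"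
    using bounded_rv_integrable[OF bounded_rv_scaleR[OF f(2) g(2)]] by simp
  also have "\<dots> = (\<integral>w. (\<integral>w'. f (\<lambda>t. \<zeta> t w') \<partial>M) *\<^sub>R g (\<lambda>t. \<Gamma>b t w) \<partial>M)"
    by (simp add: bounded_rv_integrable[OF f(2)])
  finally show ?thesis by simp
qed

end

section \<open>Equality up to third order\<close>

lemma eq_O3_refl: "(\<And>e. e \<in> {0<..\<epsilon>\<^sub>0} \<Longrightarrow> f e = g e) \<Longrightarrow> eq_O3 \<epsilon>\<^sub>0 f g"
  unfolding eq_O3_def by (rule exI[of _ 0]) simp

lemma eq_O3_trans:
  assumes "eq_O3 \<epsilon>\<^sub>0 f g" "eq_O3 \<epsilon>\<^sub>0 g h"
  shows "eq_O3 \<epsilon>\<^sub>0 f h"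
proof -
  obtain C D where C: "\<forall>e\<in>{0<..\<epsilon>\<^sub>0}. norm (f e - g e) \<le> C * e ^ 3"
    and D: "\<forall>e\<in>{0<..\<epsilon>\<^sub>0}. norm (g e - h e) \<le> D * e ^ 3"
    using assms by (auto simp: eq_O3_def)
  have "norm (f e - h e) \<le> (C + D) * e ^ 3" if "e \<in> {0<..\<epsilon>\<^sub>0}" for e
    using norm_triangle_ineq[of "f e - g e" "g e - h e"] bspec[OF C that] bspec[OF D that]
    by (simp add: distrib_right)
  then show ?thesis unfolding eq_O3_def by blast
qed

lemma eq_O3_cong_left:
  "(\<And>e. e \<in> {0<..\<epsilon>\<^sub>0} \<Longrightarrow> f e = f' e) \<Longrightarrow> eq_O3 \<epsilon>\<^sub>0 f' g \<Longrightarrow> eq_O3 \<epsilon>\<^sub>0 f g"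
  by (rule eq_O3_trans[OF eq_O3_refl])

lemma eq_O3_cong_right:
  "eq_O3 \<epsilon>\<^sub>0 f g \<Longrightarrow> (\<And>e. e \<in> {0<..\<epsilon>\<^sub>0} \<Longrightarrow> g e = g' e) \<Longrightarrow> eq_O3 \<epsilon>\<^sub>0 f g'"
  by (rule eq_O3_trans[OF _ eq_O3_refl])

lemma eq_O3_add:
  assumes "eq_O3 \<epsilon>\<^sub>0 f g" "eq_O3 \<epsilon>\<^sub>0 f' g'"
  shows "eq_O3 \<epsilon>\<^sub>0 (\<lambda>e. f e + f' e) (\<lambda>e. g e + g' e)"
proof -
  obtain C D where C: "\<forall>e\<in>{0<..\<epsilon>\<^sub>0}. norm (f e - g e) \<le> C * e ^ 3"
    and D: "\<forall>e\<in>{0<..\<epsilon>\<^sub>0}. norm (f' e - g' e) \<le> D * e ^ 3"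
    using assms by (auto simp: eq_O3_def)
  have "norm (f e + f' e - (g e + g' e)) \<le> (C + D) * e ^ 3" if "e \<in> {0<..\<epsilon>\<^sub>0}" for e
    using norm_triangle_ineq[of "f e - g e" "f' e - g' e"] bspec[OF C that] bspec[OF D that]
    by (simp add: distrib_right add_diff_add)
  then show ?thesis unfolding eq_O3_def by blast
qed

lemma eq_O3_linear:
  assumes T: "bounded_linear T" and fg: "eq_O3 \<epsilon>\<^sub>0 f g"
  shows "eq_O3 \<epsilon>\<^sub>0 (\<lambda>e. T (f e)) (\<lambda>e. T (g e))"
proof -
  obtain C where C: "\<forall>e\<in>{0<..\<epsilon>\<^sub>0}. norm (f e - g e) \<le> C * e ^ 3"
    using fg by (auto simp: eq_O3_def)
  obtain K where K: "0 \<le> K" "\<And>x. norm (T x) \<le> norm x * K"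
    using bounded_linear.nonneg_bounded[OF T] by blast
  have "norm (T (f e) - T (g e)) \<le> (C * K) * e ^ 3" if "e \<in> {0<..\<epsilon>\<^sub>0}" for e
  proof -
    have "norm (T (f e) - T (g e)) \<le> norm (f e - g e) * K"
      using K(2) by (simp flip: linear_diff[OF bounded_linear.linear[OF T]])
    also have "\<dots> \<le> (C * e ^ 3) * K" by (rule mult_right_mono[OF bspec[OF C that] K(1)])
    finally show ?thesis by (simp add: mult_ac)
  qed
  then show ?thesis unfolding eq_O3_def by blast
qed

lemma eq_O3_diff:
  assumes "eq_O3 \<epsilon>\<^sub>0 f g" "eq_O3 \<epsilon>\<^sub>0 f' g'"
  shows "eq_O3 \<epsilon>\<^sub>0 (\<lambda>e. f e - f' e) (\<lambda>e. g e - g' e)"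
  using eq_O3_add[OF assms(1) eq_O3_linear[OF bounded_linear_minus[OF bounded_linear_ident] assms(2)]] by simp

locale prob_family =
  fixes \<epsilon>\<^sub>0 :: real and M :: "real \<Rightarrow> 'w measure"
  assumes prob: "e \<in> {0<..\<epsilon>\<^sub>0} \<Longrightarrow> prob_space (M e)"
begin

abbreviation "I \<equiv> {0<..\<epsilon>\<^sub>0}"

definition rv_O :: "nat \<Rightarrow> (real \<Rightarrow> 'w \<Rightarrow> 'b::real_normed_vector) \<Rightarrow> bool" where
  "rv_O n f \<longleftrightarrow> (\<exists>C\<ge>0. \<forall>e\<in>I. f e \<in> borel_measurable (M e) \<and> (AE w in M e. norm (f e w) \<le> C * e ^ n))"

text \<open>The coupling difference is either 0 or of fixed size, hence small in mean but not almost
  surely. Orders in mean combine with almost sure orders, see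
  \<open>mean_O_bilinear\<close>.\<close>

definition mean_O :: "nat \<Rightarrow> (real \<Rightarrow> 'w \<Rightarrow> 'b::{banach, second_countable_topology}) \<Rightarrow> bool" where
  "mean_O n f \<longleftrightarrow> (\<exists>C\<ge>0. \<forall>e\<in>I. integrable (M e) (f e) \<and> (\<integral>w. norm (f e w) \<partial>M e) \<le> C * e ^ n)"

lemma rv_O_cong: "rv_O n f \<Longrightarrow> (\<And>e. e \<in> I \<Longrightarrow> f e = g e) \<Longrightarrow> rv_O n g"
  unfolding rv_O_def by simp

text \<open>Lowering an order costs a power of \<open>\<epsilon>\<^sub>0\<close>, which is absorbed
  in the constant because \<open>e\<close> ranges over a bounded interval.\<close>

lemma power_mono_exponent:
  assumes "e \<in> I" "m \<le> n"
  shows "e ^ n \<le> \<epsilon>\<^sub>0 ^ (n - m) * e ^ m"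
proof -
  have "e ^ n = e ^ (n - m) * e ^ m" using assms(2) by (simp flip: power_add)
  also have "\<dots> \<le> \<epsilon>\<^sub>0 ^ (n - m) * e ^ m" using assms(1) by (intro mult_right_mono power_mono) auto
  finally show ?thesis .
qed

section \<open>Calculus of almost sure orders\<close>

lemma rv_O_const: "rv_O 0 (\<lambda>_ _. c)"
  unfolding rv_O_def by (intro exI[of _ "norm c"]) simp

lemma rv_O_bounded: "rv_O n f \<Longrightarrow> e \<in> I \<Longrightarrow> bounded_rv (M e) (M e) (f e)"
  unfolding rv_O_def bounded_rv_def by blast

lemma rv_O_integrable:
  fixes f :: "real \<Rightarrow> 'w \<Rightarrow> 'b::{banach, second_countable_topology}"
  shows "rv_O n f \<Longrightarrow> e \<in> I \<Longrightarrow> integrable (M e) (f e)"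
  using prob_space.bounded_rv_integrable[OF prob] rv_O_bounded by blast

lemma rv_O_linear:
  fixes T :: "'a::real_normed_vector \<Rightarrow> 'b::real_normed_vector"
  assumes T: "bounded_linear T" and f: "rv_O n f"
  shows "rv_O n (\<lambda>e w. T (f e w))"
proof -
  obtain C where C: "0 \<le> C" "\<And>e. e \<in> I \<Longrightarrow> AE w in M e. norm (f e w) \<le> C * e ^ n"
    using f unfolding rv_O_def by blast
  obtain K where K: "0 \<le> K" "\<And>x. norm (T x) \<le> norm x * K"
    using bounded_linear.nonneg_bounded[OF T] by blast
  have "AE w in M e. norm (T (f e w)) \<le> (C * K) * e ^ n" if "e \<in> I" for e
    using C(2)[OF that]
  proof eventually_elim
    case (elim w)
    have "norm (T (f e w)) \<le> norm (f e w) * K" by (rule K)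
    also have "\<dots> \<le> (C * e ^ n) * K" by (rule mult_right_mono[OF elim K(1)])
    finally show ?case by (simp add: mult_ac)
  qed
  moreover have "bounded_rv (M e) (M e) (\<lambda>w. T (f e w))" if "e \<in> I" for e
    by (intro bounded_rv_linear[OF T] rv_O_bounded[OF f that])
  ultimately show ?thesis
    unfolding rv_O_def bounded_rv_def using C(1) K(1) by (intro exI[of _ "C * K"]) auto
qed

lemma rv_O_bilinear:
  fixes H :: "'a::{real_normed_vector, second_countable_topology} \<Rightarrow>
    'b::{real_normed_vector, second_countable_topology} \<Rightarrow> 'c::real_normed_vector"
  assumes H: "bounded_bilinear H" and f: "rv_O m f" and g: "rv_O n g"
  shows "rv_O (m + n) (\<lambda>e w. H (f e w) (g e w))"
proof -
  obtain C where C: "0 \<le> C" "\<And>e. e \<in> I \<Longrightarrow> AE w in M e. norm (f e w) \<le> C * e ^ m"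
    using f unfolding rv_O_def by blast
  obtain D where D: "0 \<le> D" "\<And>e. e \<in> I \<Longrightarrow> AE w in M e. norm (g e w) \<le> D * e ^ n"
    using g unfolding rv_O_def by blast
  obtain K where K: "0 \<le> K" "\<And>x y. norm (H x y) \<le> norm x * norm y * K"
    using bounded_bilinear.nonneg_bounded[OF H] by blast
  have "AE w in M e. norm (H (f e w) (g e w)) \<le> (C * D * K) * e ^ (m + n)"
    if e: "e \<in> I" for e
    using C(2)[OF e] D(2)[OF e]
  proof eventually_elim
    case (elim w)
    have "norm (H (f e w) (g e w)) \<le> norm (f e w) * norm (g e w) * K" by (rule K)
    also have "\<dots> \<le> (C * e ^ m) * (D * e ^ n) * K"
      using elim e C(1) K(1) by (intro mult_right_mono mult_mono) auto
    finally show ?case by (simp add: mult_ac power_add)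
  qed
  moreover have "bounded_rv (M e) (M e) (\<lambda>w. H (f e w) (g e w))" if "e \<in> I" for e
    by (intro bounded_rv_bilinear[OF H] rv_O_bounded[OF f that] rv_O_bounded[OF g that])
  ultimately show ?thesis
    unfolding rv_O_def bounded_rv_def using C(1) D(1) K(1) by (intro exI[of _ "C * D * K"]) auto
qed

lemma rv_O_add:
  fixes f :: "real \<Rightarrow> 'w \<Rightarrow> 'b::{real_normed_vector, second_countable_topology}"
  assumes f: "rv_O n f" and g: "rv_O n g"
  shows "rv_O n (\<lambda>e w. f e w + g e w)"
proof -
  obtain C where C: "0 \<le> C" "\<And>e. e \<in> I \<Longrightarrow> AE w in M e. norm (f e w) \<le> C * e ^ n"
    using f unfolding rv_O_def by blast
  obtain D where D: "0 \<le> D" "\<And>e. e \<in> I \<Longrightarrow> AE w in M e. norm (g e w) \<le> D * e ^ n"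
    using g unfolding rv_O_def by blast
  have "AE w in M e. norm (f e w + g e w) \<le> (C + D) * e ^ n" if "e \<in> I" for e
    using C(2)[OF that] D(2)[OF that]
    by eventually_elim (simp add: distrib_right norm_triangle_mono)
  moreover have "bounded_rv (M e) (M e) (\<lambda>w. f e w + g e w)" if "e \<in> I" for e
    by (intro bounded_rv_add rv_O_bounded[OF f that] rv_O_bounded[OF g that])
  ultimately show ?thesis
    unfolding rv_O_def bounded_rv_def using C(1) D(1) by (intro exI[of _ "C + D"]) auto
qed

lemma rv_O_diff:
  fixes f :: "real \<Rightarrow> 'w \<Rightarrow> 'b::{real_normed_vector, second_countable_topology}"
  assumes "rv_O n f" "rv_O n g"
  shows "rv_O n (\<lambda>e w. f e w - g e w)"
  using rv_O_add[OF assms(1) rv_O_linear[OF bounded_linear_minus[OF bounded_linear_ident] assms(2)]] by simp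

lemma rv_O_mono:
  assumes f: "rv_O n f" and mn: "m \<le> n" and pos: "0 < \<epsilon>\<^sub>0"
  shows "rv_O m f"
proof -
  obtain C where C: "0 \<le> C" "\<And>e. e \<in> I \<Longrightarrow> f e \<in> borel_measurable (M e)"
    "\<And>e. e \<in> I \<Longrightarrow> AE w in M e. norm (f e w) \<le> C * e ^ n"
    using f unfolding rv_O_def by blast
  have "AE w in M e. norm (f e w) \<le> (C * \<epsilon>\<^sub>0 ^ (n - m)) * e ^ m" if e: "e \<in> I" for e
    using C(3)[OF e]
  proof eventually_elim
    case (elim w)
    also have "C * e ^ n \<le> C * (\<epsilon>\<^sub>0 ^ (n - m) * e ^ m)"
      by (rule mult_left_mono[OF power_mono_exponent[OF e mn] C(1)])
    finally show ?case by (simp add: mult_ac)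
  qed
  then show ?thesis
    unfolding rv_O_def using C(1,2) pos by (intro exI[of _ "C * \<epsilon>\<^sub>0 ^ (n - m)"]) auto
qed

section \<open>Orders in mean\<close>

lemma mean_O_of_rv_O:
  fixes f :: "real \<Rightarrow> 'w \<Rightarrow> 'b::{banach, second_countable_topology}"
  assumes f: "rv_O n f"
  shows "mean_O n f"
proof -
  obtain C where C: "0 \<le> C" "\<And>e. e \<in> I \<Longrightarrow> AE w in M e. norm (f e w) \<le> C * e ^ n"
    using f unfolding rv_O_def by blast
  have "(\<integral>w. norm (f e w) \<partial>M e) \<le> C * e ^ n" if "e \<in> I" for e
  proof -
    interpret prob_space "M e" by (rule prob[OF that])
    have "(\<integral>w. norm (f e w) \<partial>M e) \<le> (\<integral>w. C * e ^ n \<partial>M e)"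
      using C(2)[OF that] rv_O_integrable[OF f that] by (intro integral_mono_AE) auto
    then show ?thesis by (simp add: prob_space)
  qed
  then show ?thesis
    unfolding mean_O_def using C(1) rv_O_integrable[OF f] by blast
qed

text \<open>Hoelder with exponents infinity and one. Of the two factors only \<open>g\<close> may be
  small merely in mean.\<close>

lemma mean_O_bilinear:
  fixes H :: "'a::{banach, second_countable_topology} \<Rightarrow>
    'b::{banach, second_countable_topology} \<Rightarrow> 'c::{banach, second_countable_topology}"
  assumes H: "bounded_bilinear H" and f: "rv_O m f" and g: "mean_O n g"
  shows "mean_O (m + n) (\<lambda>e w. H (f e w) (g e w))"
proof -
  obtain C where C: "0 \<le> C" "\<And>e. e \<in> I \<Longrightarrow> AE w in M e. norm (f e w) \<le> C * e ^ m"
    using f unfolding rv_O_def by blast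
  obtain D where D: "0 \<le> D" "\<And>e. e \<in> I \<Longrightarrow> integrable (M e) (g e)"
    "\<And>e. e \<in> I \<Longrightarrow> (\<integral>w. norm (g e w) \<partial>M e) \<le> D * e ^ n"
    using g unfolding mean_O_def by blast
  obtain K where K: "0 \<le> K" "\<And>x y. norm (H x y) \<le> norm x * norm y * K"
    using bounded_bilinear.nonneg_bounded[OF H] by blast
  have "integrable (M e) (\<lambda>w. H (f e w) (g e w)) \<and>
      (\<integral>w. norm (H (f e w) (g e w)) \<partial>M e) \<le> (C * D * K) * e ^ (m + n)"
    if e: "e \<in> I" for e
  proof -
    interpret prob_space "M e" by (rule prob[OF e])
    have ae: "AE w in M e. norm (H (f e w) (g e w)) \<le> (C * e ^ m * K) * norm (g e w)"
      using C(2)[OF e]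
    proof eventually_elim
      case (elim w)
      have "norm (H (f e w) (g e w)) \<le> norm (f e w) * norm (g e w) * K" by (rule K)
      also have "\<dots> \<le> (C * e ^ m) * norm (g e w) * K"
        using elim K(1) by (intro mult_right_mono) auto
      finally show ?case by (simp add: mult_ac)
    qed
    have meas: "(\<lambda>w. H (f e w) (g e w)) \<in> borel_measurable (M e)"
      by (rule borel_measurable_bilinear[OF H])
         (use rv_O_integrable[OF f e] D(2)[OF e] in auto)
    have dom: "integrable (M e) (\<lambda>w. (C * e ^ m * K) * norm (g e w))"
      using D(2)[OF e] by auto
    have int: "integrable (M e) (\<lambda>w. H (f e w) (g e w))"
      by (rule Bochner_Integration.integrable_bound[OF dom meas]) (use ae in eventually_elim, auto)
    have "(\<integral>w. norm (H (f e w) (g e w)) \<partial>M e) \<le> (\<integral>w. (C * e ^ m * K) * norm (g e w) \<partial>M e)"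
      by (intro integral_mono_AE integrable_norm int dom ae)
    also have "\<dots> = (C * e ^ m * K) * (\<integral>w. norm (g e w) \<partial>M e)" by simp
    also have "\<dots> \<le> (C * e ^ m * K) * (D * e ^ n)"
      using C(1) K(1) e by (intro mult_left_mono D(3)[OF e]) auto
    finally show ?thesis using int by (simp add: power_add mult_ac)
  qed
  then show ?thesis
    unfolding mean_O_def using C(1) D(1) K(1) by (intro exI[of _ "C * D * K"]) auto
qed

lemma mean_O_add:
  assumes f: "mean_O n f" and g: "mean_O n g"
  shows "mean_O n (\<lambda>e w. f e w + g e w)"
proof -
  obtain C where C: "0 \<le> C" "\<And>e. e \<in> I \<Longrightarrow> integrable (M e) (f e)"
    "\<And>e. e \<in> I \<Longrightarrow> (\<integral>w. norm (f e w) \<partial>M e) \<le> C * e ^ n"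
    using f unfolding mean_O_def by blast
  obtain D where D: "0 \<le> D" "\<And>e. e \<in> I \<Longrightarrow> integrable (M e) (g e)"
    "\<And>e. e \<in> I \<Longrightarrow> (\<integral>w. norm (g e w) \<partial>M e) \<le> D * e ^ n"
    using g unfolding mean_O_def by blast
  have "(\<integral>w. norm (f e w + g e w) \<partial>M e) \<le> (C + D) * e ^ n" if e: "e \<in> I" for e
  proof -
    have "(\<integral>w. norm (f e w + g e w) \<partial>M e) \<le> (\<integral>w. norm (f e w) + norm (g e w) \<partial>M e)"
      using C(2)[OF e] D(2)[OF e] by (intro integral_mono norm_triangle_ineq) auto
    also have "\<dots> = (\<integral>w. norm (f e w) \<partial>M e) + (\<integral>w. norm (g e w) \<partial>M e)"
      using C(2)[OF e] D(2)[OF e] by simp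
    finally show ?thesis using C(3)[OF e] D(3)[OF e] by (simp add: distrib_right)
  qed
  then show ?thesis
    unfolding mean_O_def using C(1,2) D(1,2) by (intro exI[of _ "C + D"]) auto
qed

lemma eq_O3_integral_mean:
  assumes f: "\<And>e. e \<in> I \<Longrightarrow> integrable (M e) (f e)"
    and g: "\<And>e. e \<in> I \<Longrightarrow> integrable (M e) (g e)"
    and fg: "mean_O 3 (\<lambda>e w. f e w - g e w)"
  shows "eq_O3 \<epsilon>\<^sub>0 (\<lambda>e. \<integral>w. f e w \<partial>M e) (\<lambda>e. \<integral>w. g e w \<partial>M e)"
proof -
  obtain C where C: "\<And>e. e \<in> I \<Longrightarrow> (\<integral>w. norm (f e w - g e w) \<partial>M e) \<le> C * e ^ 3"
    using fg unfolding mean_O_def by blast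
  have "norm ((\<integral>w. f e w \<partial>M e) - (\<integral>w. g e w \<partial>M e)) \<le> C * e ^ 3" if e: "e \<in> I" for e
    using C[OF e] integral_norm_bound[of "M e" "\<lambda>w. f e w - g e w"] f[OF e] g[OF e] by simp
  then show ?thesis unfolding eq_O3_def by blast
qed

lemma eq_O3_integral:
  fixes f g :: "real \<Rightarrow> 'w \<Rightarrow> 'b::{banach, second_countable_topology}"
  assumes "rv_O m f" "rv_O n g" "rv_O 3 (\<lambda>e w. f e w - g e w)"
  shows "eq_O3 \<epsilon>\<^sub>0 (\<lambda>e. \<integral>w. f e w \<partial>M e) (\<lambda>e. \<integral>w. g e w \<partial>M e)"
  by (intro eq_O3_integral_mean rv_O_integrable[OF assms(1)] rv_O_integrable[OF assms(2)]
      mean_O_of_rv_O[OF assms(3)])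

lemmas rv_O_scaleR = rv_O_bilinear[OF bounded_bilinear_scaleR]
lemmas rv_O_mult = rv_O_bilinear[OF bounded_bilinear_mult]
lemmas rv_O_outer = rv_O_bilinear[OF bounded_bilinear_outer]
lemmas rv_O_vm = rv_O_bilinear[OF bounded_bilinear_vector_matrix]
lemmas rv_O_mm = rv_O_bilinear[OF bounded_bilinear_matrix_matrix]
lemmas rv_O_diag = rv_O_linear[OF bounded_linear_diag]
lemmas rv_O_transpose = rv_O_linear[OF bounded_linear_transpose]

end

section \<open>Moments of the perturbed chain\<close>

lemma (in coupled_chains) integral_env2_base:
  fixes g :: "(int \<Rightarrow> 'n rvec) \<Rightarrow> 'b::{banach, second_countable_topology}"
  assumes g: "g \<in> borel_measurable (path_space UNIV)" "bounded_rv M M (\<lambda>w. g (\<lambda>t. \<Gamma>b t w))"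
  shows "(\<integral>w. (\<zeta> a w * \<zeta> b w) *\<^sub>R g (\<lambda>t. \<Gamma>b t w) \<partial>M) =
    corr_ss M \<zeta> \<zeta> (a - b) *\<^sub>R (\<integral>w. g (\<lambda>t. \<Gamma>b t w) \<partial>M)"
proof -
  have "(\<lambda>z. z a * z b) \<in> borel_measurable (path_space UNIV :: (int \<Rightarrow> real) measure)"
    by (intro borel_measurable_times measurable_component_singleton) auto
  moreover have "bounded_rv M M (\<lambda>w. \<zeta> a w * \<zeta> b w)"
    by (intro bounded_rv_intros chain.bounded_M)
  ultimately show ?thesis
    using integral_env_base[of "\<lambda>z. z a * z b" g] g by (simp add: integral_shift_env)
qed

text \<open>All values of the perturbation size together: constants must be uniform over
  \<open>I\<close>, so the coupling constant is chosen before \<open>\<epsilon>\<close>, and the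
  environment is bounded by \<open>\<epsilon>\<close> itself.\<close>

locale coupled_family = prob_family \<epsilon>\<^sub>0 M
  for \<epsilon>\<^sub>0 :: real and M :: "real \<Rightarrow> 'w measure" +
  fixes P :: "real \<Rightarrow> 'n::{finite, linorder} rmat" and \<pi>\<^sub>0 :: "'n rvec"
    and \<zeta> :: "real \<Rightarrow> int \<Rightarrow> 'w \<Rightarrow> real" and \<Gamma> \<Gamma>b :: "real \<Rightarrow> int \<Rightarrow> 'w \<Rightarrow> 'n rvec"
    and No Nb :: "real \<Rightarrow> int \<Rightarrow> 'w \<Rightarrow> real"
  assumes pos: "0 < \<epsilon>\<^sub>0"
    and A1: "assumption_A1 P"
    and chains: "\<epsilon> \<in> I \<Longrightarrow> coupled_chains (M \<epsilon>) P \<pi>\<^sub>0 (\<zeta> \<epsilon>) (\<Gamma> \<epsilon>) (\<Gamma>b \<epsilon>) (No \<epsilon>) (Nb \<epsilon>)"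
    and env_le: "\<epsilon> \<in> I \<Longrightarrow> AE w in M \<epsilon>. \<bar>\<zeta> \<epsilon> t w\<bar> \<le> \<epsilon>"
    and coupling: "\<exists>K. \<forall>\<epsilon>\<in>I. \<forall>t. (\<integral>w. norm (\<Gamma> \<epsilon> t w - \<Gamma>b \<epsilon> t w) \<partial>M \<epsilon>) \<le> K * \<epsilon>"
begin

abbreviation "Y \<epsilon> \<equiv> environment_chain.Y P (\<zeta> \<epsilon>) (\<Gamma> \<epsilon>)"
abbreviation "\<zeta>\<zeta> a b \<epsilon> w \<equiv> \<zeta> \<epsilon> a w * \<zeta> \<epsilon> b w"
abbreviation "E \<equiv> deriv1 P 0"
abbreviation "W \<equiv> deriv2 P 0"
abbreviation "R\<zeta> \<epsilon> \<equiv> corr_ss (M \<epsilon>) (\<zeta> \<epsilon>) (\<zeta> \<epsilon>)"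
abbreviation "\<Sigma>b \<equiv> diag \<pi>\<^sub>0 - transpose (P 0) ** diag \<pi>\<^sub>0 ** P 0"

lemmas rv_O_weaken = rv_O_mono[OF _ _ pos]

lemma transition: "transition_family P"
proof -
  have "\<epsilon>\<^sub>0 \<in> I" using pos by simp
  from chains[OF this] show ?thesis by (rule coupled_chains.transition)
qed

lemma invariant: "invariant_probability (P 0) \<pi>\<^sub>0"
proof -
  have "\<epsilon>\<^sub>0 \<in> I" using pos by simp
  from chains[OF this] show ?thesis by (rule coupled_chains.invariant)
qed

section \<open>Orders of the environment, the states and the Taylor remainders\<close>

lemma rv_O_env: "rv_O 1 (\<lambda>\<epsilon>. \<zeta> \<epsilon> t)"
proof -
  have "\<zeta> \<epsilon> t \<in> borel_measurable (M \<epsilon>)" if "\<epsilon> \<in> I" for \<epsilon>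
  proof -
    interpret c: coupled_chains "M \<epsilon>" P \<pi>\<^sub>0 "\<zeta> \<epsilon>" "\<Gamma> \<epsilon>" "\<Gamma>b \<epsilon>" "No \<epsilon>" "Nb \<epsilon>" by (rule chains[OF that])
    show ?thesis by (rule bounded_rv_measurable[OF c.chain.bounded_M(1)])
  qed
  then show ?thesis
    unfolding rv_O_def using env_le by (intro exI[of _ 1]) simp
qed

lemma rv_O_basis:
  fixes f :: "real \<Rightarrow> 'w \<Rightarrow> 'n rvec"
  assumes "\<And>\<epsilon>. \<epsilon> \<in> I \<Longrightarrow> f \<epsilon> \<in> borel_measurable (M \<epsilon>)"
    "\<And>\<epsilon>. \<epsilon> \<in> I \<Longrightarrow> AE w in M \<epsilon>. \<exists>i. f \<epsilon> w = axis i 1"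
  shows "rv_O 0 f"
proof -
  have "AE w in M \<epsilon>. norm (f \<epsilon> w) \<le> 1" if "\<epsilon> \<in> I" for \<epsilon>
    using assms(2)[OF that] by eventually_elim (auto simp: norm_axis_1)
  then show ?thesis unfolding rv_O_def using assms(1) by (intro exI[of _ 1]) simp
qed

lemma rv_O_state: "rv_O 0 (\<lambda>\<epsilon>. \<Gamma> \<epsilon> t)" and rv_O_base: "rv_O 0 (\<lambda>\<epsilon>. \<Gamma>b \<epsilon> t)"
proof -
  show "rv_O 0 (\<lambda>\<epsilon>. \<Gamma> \<epsilon> t)"
  proof (rule rv_O_basis)
    fix \<epsilon> assume "\<epsilon> \<in> I"
    then interpret c: coupled_chains "M \<epsilon>" P \<pi>\<^sub>0 "\<zeta> \<epsilon>" "\<Gamma> \<epsilon>" "\<Gamma>b \<epsilon>" "No \<epsilon>" "Nb \<epsilon>" by (rule chains)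
    show "\<Gamma> \<epsilon> t \<in> borel_measurable (M \<epsilon>)" by (rule bounded_rv_measurable[OF c.chain.bounded_M(2)])
    show "AE w in M \<epsilon>. \<exists>i. \<Gamma> \<epsilon> t w = axis i 1" by (rule c.chain.basis)
  qed
  show "rv_O 0 (\<lambda>\<epsilon>. \<Gamma>b \<epsilon> t)"
  proof (rule rv_O_basis)
    fix \<epsilon> assume "\<epsilon> \<in> I"
    then interpret c: coupled_chains "M \<epsilon>" P \<pi>\<^sub>0 "\<zeta> \<epsilon>" "\<Gamma> \<epsilon>" "\<Gamma>b \<epsilon>" "No \<epsilon>" "Nb \<epsilon>" by (rule chains)
    show "\<Gamma>b \<epsilon> t \<in> borel_measurable (M \<epsilon>)" by (rule bounded_rv_measurable[OF c.base.bounded_M(2)])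
    show "AE w in M \<epsilon>. \<exists>i. \<Gamma>b \<epsilon> t w = axis i 1" by (rule c.base.basis)
  qed
qed

lemma rv_O_P3: "rv_O 3 (\<lambda>\<epsilon> w. P (\<zeta> \<epsilon> t w) - P 0 - \<zeta> \<epsilon> t w *\<^sub>R E - ((\<zeta> \<epsilon> t w)\<^sup>2 / 2) *\<^sub>R W)"
proof -
  obtain C where C: "\<And>z. \<bar>z\<bar> \<le> \<epsilon>\<^sub>0 \<Longrightarrow> norm (P z - P 0 - z *\<^sub>R E - (z\<^sup>2 / 2) *\<^sub>R W) \<le> C * \<bar>z\<bar> ^ 3"
    using Taylor_remainder_bounded[OF transition A1] by metis
  have "AE w in M \<epsilon>. norm (P (\<zeta> \<epsilon> t w) - P 0 - \<zeta> \<epsilon> t w *\<^sub>R E - ((\<zeta> \<epsilon> t w)\<^sup>2 / 2) *\<^sub>R W) \<le> \<bar>C\<bar> * \<epsilon> ^ 3"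
    if \<epsilon>: "\<epsilon> \<in> I" for \<epsilon>
    using env_le[OF \<epsilon>, of t]
  proof eventually_elim
    case (elim w)
    let ?z = "\<zeta> \<epsilon> t w"
    have "norm (P ?z - P 0 - ?z *\<^sub>R E - (?z\<^sup>2 / 2) *\<^sub>R W) \<le> C * \<bar>?z\<bar> ^ 3"
      using elim \<epsilon> by (intro C) auto
    also have "\<dots> \<le> \<bar>C\<bar> * \<epsilon> ^ 3"
      using elim by (intro mult_mono power_mono) auto
    finally show ?case .
  qed
  moreover have "(\<lambda>w. P (\<zeta> \<epsilon> t w) - P 0 - \<zeta> \<epsilon> t w *\<^sub>R E - ((\<zeta> \<epsilon> t w)\<^sup>2 / 2) *\<^sub>R W) \<in> borel_measurable (M \<epsilon>)"
    if "\<epsilon> \<in> I" for \<epsilon>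
  proof -
    have [measurable]: "P \<in> borel_measurable borel" "\<zeta> \<epsilon> t \<in> borel_measurable (M \<epsilon>)"
      using transition rv_O_env[of t] that by (auto simp: transition_family_def rv_O_def)
    show ?thesis by measurable
  qed
  ultimately show ?thesis unfolding rv_O_def by (intro exI[of _ "\<bar>C\<bar>"]) simp
qed

lemma rv_O_env_power2: "rv_O 2 (\<lambda>\<epsilon> w. (\<zeta> \<epsilon> t w)\<^sup>2)"
  unfolding power2_eq_square by (rule rv_O_weaken[OF rv_O_mult[OF rv_O_env rv_O_env]]) simp

lemma rv_O_env2: "rv_O 2 (\<lambda>\<epsilon> w. \<zeta>\<zeta> a b \<epsilon> w)"
  by (rule rv_O_weaken[OF rv_O_mult[OF rv_O_env rv_O_env]]) simp

text \<open>The remainder of higher order plus the Taylor term it had removed. The two following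
  bounds on \<open>P\<close> descend in the same way.\<close>

lemma rv_O_P2: "rv_O 2 (\<lambda>\<epsilon> w. P (\<zeta> \<epsilon> t w) - P 0 - \<zeta> \<epsilon> t w *\<^sub>R E)"
proof -
  have "rv_O 2 (\<lambda>\<epsilon> w. (P (\<zeta> \<epsilon> t w) - P 0 - \<zeta> \<epsilon> t w *\<^sub>R E - ((\<zeta> \<epsilon> t w)\<^sup>2 / 2) *\<^sub>R W) +
      (\<zeta> \<epsilon> t w)\<^sup>2 *\<^sub>R ((1/2) *\<^sub>R W))"
    by (intro rv_O_add rv_O_weaken[OF rv_O_P3] rv_O_weaken[OF rv_O_scaleR[OF rv_O_env_power2 rv_O_const]]) auto
  then show ?thesis by simp
qed

lemma rv_O_P1: "rv_O 1 (\<lambda>\<epsilon> w. P (\<zeta> \<epsilon> t w) - P 0)"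
proof -
  have "rv_O 1 (\<lambda>\<epsilon> w. (P (\<zeta> \<epsilon> t w) - P 0 - \<zeta> \<epsilon> t w *\<^sub>R E) + \<zeta> \<epsilon> t w *\<^sub>R E)"
    by (intro rv_O_add rv_O_weaken[OF rv_O_P2] rv_O_weaken[OF rv_O_scaleR[OF rv_O_env rv_O_const]]) auto
  then show ?thesis by simp
qed

lemma rv_O_P0: "rv_O 0 (\<lambda>\<epsilon> w. P (\<zeta> \<epsilon> t w))"
proof -
  have "rv_O 0 (\<lambda>\<epsilon> w. (P (\<zeta> \<epsilon> t w) - P 0) + P 0)"
    by (intro rv_O_add rv_O_weaken[OF rv_O_P1] rv_O_const) auto
  then show ?thesis by simp
qed

lemma rv_O_Y: "rv_O 0 (\<lambda>\<epsilon>. Y \<epsilon> t)"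
proof (rule rv_O_cong)
  show "rv_O 0 (\<lambda>\<epsilon> w. \<Gamma> \<epsilon> t w - \<Gamma> \<epsilon> (t - 1) w v* P (\<zeta> \<epsilon> (t - 1) w))"
    by (intro rv_O_diff rv_O_state rv_O_weaken[OF rv_O_vm[OF rv_O_state rv_O_P0]]) auto
  fix \<epsilon> assume "\<epsilon> \<in> I"
  then interpret c: coupled_chains "M \<epsilon>" P \<pi>\<^sub>0 "\<zeta> \<epsilon>" "\<Gamma> \<epsilon>" "\<Gamma>b \<epsilon>" "No \<epsilon>" "Nb \<epsilon>" by (rule chains)
  show "(\<lambda>w. \<Gamma> \<epsilon> t w - \<Gamma> \<epsilon> (t - 1) w v* P (\<zeta> \<epsilon> (t - 1) w)) = Y \<epsilon> t"
    by (simp add: fun_eq_iff c.chain.Y_def)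
qed

lemma mean_O_coupling: "mean_O 1 (\<lambda>\<epsilon> w. \<Gamma> \<epsilon> t w - \<Gamma>b \<epsilon> t w)"
proof -
  obtain K where K: "\<And>\<epsilon>. \<epsilon> \<in> I \<Longrightarrow> (\<integral>w. norm (\<Gamma> \<epsilon> t w - \<Gamma>b \<epsilon> t w) \<partial>M \<epsilon>) \<le> K * \<epsilon>"
    using coupling by blast
  have "(\<integral>w. norm (\<Gamma> \<epsilon> t w - \<Gamma>b \<epsilon> t w) \<partial>M \<epsilon>) \<le> \<bar>K\<bar> * \<epsilon> ^ 1" if "\<epsilon> \<in> I" for \<epsilon>
  proof -
    have "K * \<epsilon> \<le> \<bar>K\<bar> * \<epsilon>" using that by (intro mult_right_mono) auto
    then show ?thesis using K[OF that] by simp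
  qed
  then show ?thesis
    unfolding mean_O_def
    using rv_O_integrable[OF rv_O_diff[OF rv_O_state[of t] rv_O_base[of t]]]
    by (intro exI[of _ "\<bar>K\<bar>"]) simp
qed

text \<open>Two factors \<open>\<zeta>\<close> and one coupling difference make order three in mean.
  The map \<open>\<phi>\<close> is left arbitrary because the lemma is applied to multiplication by
  \<open>E\<close>, to the innovation covariance and to a second-order Taylor coefficient.\<close>

lemma integral_env2_state:
  fixes \<phi> :: "'n rvec \<Rightarrow> 'b::{banach, second_countable_topology}"
  assumes \<phi>: "bounded_linear \<phi>"
  shows "eq_O3 \<epsilon>\<^sub>0 (\<lambda>\<epsilon>. \<integral>w. \<zeta>\<zeta> a b \<epsilon> w *\<^sub>R \<phi> (\<Gamma> \<epsilon> t w) \<partial>M \<epsilon>) (\<lambda>\<epsilon>. R\<zeta> \<epsilon> (a - b) *\<^sub>R \<phi> \<pi>\<^sub>0)"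
proof (rule eq_O3_cong_right)
  have bil: "bounded_bilinear (\<lambda>c x. c *\<^sub>R \<phi> x)"
    by (rule bounded_bilinear.comp[OF bounded_bilinear_scaleR bounded_linear_ident \<phi>])
  have "mean_O 3 (\<lambda>\<epsilon> w. \<zeta>\<zeta> a b \<epsilon> w *\<^sub>R \<phi> (\<Gamma> \<epsilon> t w - \<Gamma>b \<epsilon> t w))"
    using mean_O_bilinear[OF bil rv_O_env2 mean_O_coupling] by simp
  then show "eq_O3 \<epsilon>\<^sub>0 (\<lambda>\<epsilon>. \<integral>w. \<zeta>\<zeta> a b \<epsilon> w *\<^sub>R \<phi> (\<Gamma> \<epsilon> t w) \<partial>M \<epsilon>)
      (\<lambda>\<epsilon>. \<integral>w. \<zeta>\<zeta> a b \<epsilon> w *\<^sub>R \<phi> (\<Gamma>b \<epsilon> t w) \<partial>M \<epsilon>)"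
    by (intro eq_O3_integral_mean rv_O_integrable[OF rv_O_bilinear[OF bil rv_O_env2 rv_O_state]]
        rv_O_integrable[OF rv_O_bilinear[OF bil rv_O_env2 rv_O_base]])
       (simp_all add: linear_diff[OF bounded_linear.linear[OF \<phi>]] algebra_simps)
  fix \<epsilon> assume "\<epsilon> \<in> I"
  then interpret c: coupled_chains "M \<epsilon>" P \<pi>\<^sub>0 "\<zeta> \<epsilon>" "\<Gamma> \<epsilon>" "\<Gamma>b \<epsilon>" "No \<epsilon>" "Nb \<epsilon>" by (rule chains)
  have "\<phi> \<in> borel_measurable borel"
    by (intro borel_measurable_continuous_onI bounded_linear.continuous_on[OF \<phi>] continuous_on_id)
  then have "(\<lambda>x. \<phi> (x t)) \<in> borel_measurable (path_space UNIV)"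
    by (rule measurable_compose[rotated]) (rule measurable_component_singleton, simp)
  then have "(\<integral>w. \<zeta>\<zeta> a b \<epsilon> w *\<^sub>R \<phi> (\<Gamma>b \<epsilon> t w) \<partial>M \<epsilon>) =
      R\<zeta> \<epsilon> (a - b) *\<^sub>R (\<integral>w. \<phi> (\<Gamma>b \<epsilon> t w) \<partial>M \<epsilon>)"
    by (rule c.integral_env2_base) (intro bounded_rv_linear[OF \<phi>] c.base.bounded_M)
  also have "(\<integral>w. \<phi> (\<Gamma>b \<epsilon> t w) \<partial>M \<epsilon>) = \<phi> \<pi>\<^sub>0"
    unfolding c.integral_base[of t, symmetric]
    by (intro integral_bounded_linear \<phi> c.bounded_rv_integrable c.base.bounded_M)
  finally show "(\<integral>w. \<zeta>\<zeta> a b \<epsilon> w *\<^sub>R \<phi> (\<Gamma>b \<epsilon> t w) \<partial>M \<epsilon>) = R\<zeta> \<epsilon> (a - b) *\<^sub>R \<phi> \<pi>\<^sub>0" .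
qed

lemma integral_env2_outer_state:
  "eq_O3 \<epsilon>\<^sub>0 (\<lambda>\<epsilon>. \<integral>w. \<zeta>\<zeta> a b \<epsilon> w *\<^sub>R outer (\<Gamma> \<epsilon> (int n) w) (\<Gamma> \<epsilon> 0 w) \<partial>M \<epsilon>)
    (\<lambda>\<epsilon>. R\<zeta> \<epsilon> (a - b) *\<^sub>R (transpose (mpow (P 0) n) ** diag \<pi>\<^sub>0))"
proof (rule eq_O3_cong_right)
  \<comment> \<open>The two states are exchanged one at a time, so that each error contains one
    coupling difference and one bounded state. \<open>mean_O_bilinear\<close> expects the difference
    as its second argument; the flipped product serves the case where it comes first.\<close>
  note flip = bounded_bilinear.flip[OF bounded_bilinear_outer]
  have 1: "mean_O 3 (\<lambda>\<epsilon> w. \<zeta>\<zeta> a b \<epsilon> w *\<^sub>R outer (\<Gamma> \<epsilon> (int n) w - \<Gamma>b \<epsilon> (int n) w) (\<Gamma> \<epsilon> 0 w))"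
    using mean_O_bilinear[OF bounded_bilinear_scaleR rv_O_env2 mean_O_bilinear[OF flip rv_O_state mean_O_coupling]] by simp
  have 2: "mean_O 3 (\<lambda>\<epsilon> w. \<zeta>\<zeta> a b \<epsilon> w *\<^sub>R outer (\<Gamma>b \<epsilon> (int n) w) (\<Gamma> \<epsilon> 0 w - \<Gamma>b \<epsilon> 0 w))"
    using mean_O_bilinear[OF bounded_bilinear_scaleR rv_O_env2 mean_O_bilinear[OF bounded_bilinear_outer rv_O_base mean_O_coupling]] by simp
  have "mean_O 3 (\<lambda>\<epsilon> w. \<zeta>\<zeta> a b \<epsilon> w *\<^sub>R outer (\<Gamma> \<epsilon> (int n) w) (\<Gamma> \<epsilon> 0 w) -
      \<zeta>\<zeta> a b \<epsilon> w *\<^sub>R outer (\<Gamma>b \<epsilon> (int n) w) (\<Gamma>b \<epsilon> 0 w))"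
    using mean_O_add[OF 1 2]
    by (simp add: bounded_bilinear.diff_left[OF bounded_bilinear_outer]
        bounded_bilinear.diff_right[OF bounded_bilinear_outer] algebra_simps)
  then show "eq_O3 \<epsilon>\<^sub>0 (\<lambda>\<epsilon>. \<integral>w. \<zeta>\<zeta> a b \<epsilon> w *\<^sub>R outer (\<Gamma> \<epsilon> (int n) w) (\<Gamma> \<epsilon> 0 w) \<partial>M \<epsilon>)
      (\<lambda>\<epsilon>. \<integral>w. \<zeta>\<zeta> a b \<epsilon> w *\<^sub>R outer (\<Gamma>b \<epsilon> (int n) w) (\<Gamma>b \<epsilon> 0 w) \<partial>M \<epsilon>)"
    by (intro eq_O3_integral_mean rv_O_integrable[OF rv_O_scaleR[OF rv_O_env2 rv_O_outer[OF rv_O_state rv_O_state]]]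
        rv_O_integrable[OF rv_O_scaleR[OF rv_O_env2 rv_O_outer[OF rv_O_base rv_O_base]]])
  fix \<epsilon> assume "\<epsilon> \<in> I"
  then interpret c: coupled_chains "M \<epsilon>" P \<pi>\<^sub>0 "\<zeta> \<epsilon>" "\<Gamma> \<epsilon>" "\<Gamma>b \<epsilon>" "No \<epsilon>" "Nb \<epsilon>" by (rule chains)
  have "(\<lambda>x. outer (x (int n)) (x 0)) \<in> borel_measurable (path_space UNIV :: (int \<Rightarrow> 'n rvec) measure)"
    by (intro borel_measurable_bilinear[OF bounded_bilinear_outer] measurable_component_singleton) auto
  then have "(\<integral>w. \<zeta>\<zeta> a b \<epsilon> w *\<^sub>R outer (\<Gamma>b \<epsilon> (int n) w) (\<Gamma>b \<epsilon> 0 w) \<partial>M \<epsilon>) =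
      R\<zeta> \<epsilon> (a - b) *\<^sub>R (\<integral>w. outer (\<Gamma>b \<epsilon> (int n) w) (\<Gamma>b \<epsilon> 0 w) \<partial>M \<epsilon>)"
    by (rule c.integral_env2_base) (intro bounded_rv_intros c.base.bounded_M)
  then show "(\<integral>w. \<zeta>\<zeta> a b \<epsilon> w *\<^sub>R outer (\<Gamma>b \<epsilon> (int n) w) (\<Gamma>b \<epsilon> 0 w) \<partial>M \<epsilon>) =
      R\<zeta> \<epsilon> (a - b) *\<^sub>R (transpose (mpow (P 0) n) ** diag \<pi>\<^sub>0)"
    using c.integral_outer_base[of 0 n] by simp
qed

text \<open>The covariance of the innovation given the past is a function of the state and of
  \<open>P\<close> at time -1. Behind a weight of order two, replacing that matrix by
  \<open>P 0\<close> costs only order three. What remains is linear in the state and is evaluated by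
  \<open>integral_env2_state\<close>; invariance of \<open>\<pi>\<^sub>0\<close> gives
  \<open>\<Sigma>b\<close>.\<close>

lemma integral_env2_Y_Y:
  "eq_O3 \<epsilon>\<^sub>0 (\<lambda>\<epsilon>. \<integral>w. \<zeta>\<zeta> a b \<epsilon> w *\<^sub>R outer (Y \<epsilon> 0 w) (Y \<epsilon> 0 w) \<partial>M \<epsilon>) (\<lambda>\<epsilon>. R\<zeta> \<epsilon> (a - b) *\<^sub>R \<Sigma>b)"
proof -
  define X where "X \<epsilon> = \<Gamma> \<epsilon> (- 1)" for \<epsilon>
  define Q where "Q \<epsilon> w = P (\<zeta> \<epsilon> (- 1) w)" for \<epsilon> w
  define \<phi> where "\<phi> x = diag (x v* P 0) - transpose (P 0) ** diag x ** P 0" for x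
  have \<phi>: "bounded_linear \<phi>"
    unfolding \<phi>_def by (rule bounded_linear_innovation_covariance)
  have X: "rv_O 0 X" unfolding X_def by (rule rv_O_state)
  have Q: "rv_O 0 Q" unfolding Q_def by (rule rv_O_P0)
  have Q1: "rv_O 1 (\<lambda>\<epsilon> w. Q \<epsilon> w - P 0)" unfolding Q_def by (rule rv_O_P1)
  \<comment> \<open>The difference of the covariances at \<open>Q\<close> and at \<open>P 0\<close>,
    arranged so that every term carries a factor \<open>Q \<epsilon> w - P 0\<close>.\<close>
  have "rv_O 1 (\<lambda>\<epsilon> w. diag (X \<epsilon> w v* (Q \<epsilon> w - P 0)) -
      (transpose (Q \<epsilon> w - P 0) ** (diag (X \<epsilon> w) ** Q \<epsilon> w) +
       transpose (P 0) ** (diag (X \<epsilon> w) ** (Q \<epsilon> w - P 0))))"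
    by (intro rv_O_diff rv_O_add rv_O_diag rv_O_weaken[OF rv_O_vm[OF X Q1]]
        rv_O_weaken[OF rv_O_mm[OF rv_O_transpose[OF Q1] rv_O_mm[OF rv_O_diag[OF X] Q]]]
        rv_O_weaken[OF rv_O_mm[OF rv_O_transpose[OF rv_O_const] rv_O_mm[OF rv_O_diag[OF X] Q1]]]) simp_all
  moreover have "diag (x v* (q - r)) - (transpose (q - r) ** (diag x ** q) + transpose r ** (diag x ** (q - r))) =
      (diag (x v* q) - transpose q ** diag x ** q) - (diag (x v* r) - transpose r ** diag x ** r)"
    for x :: "'n rvec" and q r :: "'n rmat"
    by (simp add: vector_matrix_mult_diff_rdistrib linear_diff[OF bounded_linear.linear[OF bounded_linear_diag]]
        transpose_diff bounded_bilinear.diff_left[OF bounded_bilinear_matrix_matrix]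
        bounded_bilinear.diff_right[OF bounded_bilinear_matrix_matrix] matrix_mul_assoc)
  ultimately have diff: "rv_O 1 (\<lambda>\<epsilon> w. (diag (X \<epsilon> w v* Q \<epsilon> w) - transpose (Q \<epsilon> w) ** diag (X \<epsilon> w) ** Q \<epsilon> w) - \<phi> (X \<epsilon> w))"
    by (simp add: \<phi>_def)
  have "rv_O 3 (\<lambda>\<epsilon> w. \<zeta>\<zeta> a b \<epsilon> w *\<^sub>R
      (diag (X \<epsilon> w v* Q \<epsilon> w) - transpose (Q \<epsilon> w) ** diag (X \<epsilon> w) ** Q \<epsilon> w) -
      \<zeta>\<zeta> a b \<epsilon> w *\<^sub>R \<phi> (X \<epsilon> w))"
    unfolding scaleR_right_diff_distrib[symmetric]
    by (rule rv_O_weaken[OF rv_O_scaleR[OF rv_O_env2 diff]]) simp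
  moreover have cov: "rv_O 0 (\<lambda>\<epsilon> w. diag (X \<epsilon> w v* Q \<epsilon> w) - transpose (Q \<epsilon> w) ** diag (X \<epsilon> w) ** Q \<epsilon> w)"
    by (intro rv_O_diff rv_O_diag rv_O_weaken[OF rv_O_vm[OF X Q]]
        rv_O_weaken[OF rv_O_mm[OF rv_O_mm[OF rv_O_transpose[OF Q] rv_O_diag[OF X]] Q]]) simp_all
  ultimately have 1: "eq_O3 \<epsilon>\<^sub>0 (\<lambda>\<epsilon>. \<integral>w. \<zeta>\<zeta> a b \<epsilon> w *\<^sub>R
      (diag (X \<epsilon> w v* Q \<epsilon> w) - transpose (Q \<epsilon> w) ** diag (X \<epsilon> w) ** Q \<epsilon> w) \<partial>M \<epsilon>)
      (\<lambda>\<epsilon>. \<integral>w. \<zeta>\<zeta> a b \<epsilon> w *\<^sub>R \<phi> (X \<epsilon> w) \<partial>M \<epsilon>)"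
    by (intro eq_O3_integral[OF rv_O_scaleR[OF rv_O_env2 cov] rv_O_scaleR[OF rv_O_env2 rv_O_linear[OF \<phi> X]]])
  have 2: "eq_O3 \<epsilon>\<^sub>0 (\<lambda>\<epsilon>. \<integral>w. \<zeta>\<zeta> a b \<epsilon> w *\<^sub>R \<phi> (X \<epsilon> w) \<partial>M \<epsilon>) (\<lambda>\<epsilon>. R\<zeta> \<epsilon> (a - b) *\<^sub>R \<phi> \<pi>\<^sub>0)"
    unfolding X_def by (rule integral_env2_state[OF \<phi>])
  have 3: "\<phi> \<pi>\<^sub>0 = \<Sigma>b" using invariant by (simp add: \<phi>_def invariant_probability_def)
  show ?thesis
    unfolding 3[symmetric]
  proof (rule eq_O3_cong_left[OF _ eq_O3_trans[OF 1 2]])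
    fix \<epsilon> assume "\<epsilon> \<in> I"
    then interpret c: coupled_chains "M \<epsilon>" P \<pi>\<^sub>0 "\<zeta> \<epsilon>" "\<Gamma> \<epsilon>" "\<Gamma>b \<epsilon>" "No \<epsilon>" "Nb \<epsilon>" by (rule chains)
    have "bounded_rv (M \<epsilon>) (c.F (- 1)) (\<lambda>w. \<zeta>\<zeta> a b \<epsilon> w)"
      by (intro bounded_rv_intros c.bounded_env_F)
    from c.chain.integral_outer_Y_Y[OF this]
    show "(\<integral>w. \<zeta>\<zeta> a b \<epsilon> w *\<^sub>R outer (Y \<epsilon> 0 w) (Y \<epsilon> 0 w) \<partial>M \<epsilon>) =
      (\<integral>w. \<zeta>\<zeta> a b \<epsilon> w *\<^sub>R
        (diag (X \<epsilon> w v* Q \<epsilon> w) - transpose (Q \<epsilon> w) ** diag (X \<epsilon> w) ** Q \<epsilon> w) \<partial>M \<epsilon>)"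
      by (simp add: X_def Q_def)
  qed
qed

text \<open>The weight \<open>h\<close> has to be known at every time, as a function of the
  environment is; the recursion can then be run over all steps with the same weight. Time 0 of the
  innovation corresponds to the filtration at time -1.\<close>

lemma integral_outer_state_Y_Suc:
  assumes \<epsilon>: "\<epsilon> \<in> I" and h: "\<And>t. bounded_rv (M \<epsilon>) (coupled_chains.F (M \<epsilon>) (\<zeta> \<epsilon>) (\<Gamma> \<epsilon>) (\<Gamma>b \<epsilon>) t) h"
  shows "(\<integral>w. h w *\<^sub>R outer (\<Gamma> \<epsilon> 0 w) (Y \<epsilon> 0 w) \<partial>M \<epsilon>) = (\<integral>w. h w *\<^sub>R outer (Y \<epsilon> 0 w) (Y \<epsilon> 0 w) \<partial>M \<epsilon>)"
    and "(\<integral>w. h w *\<^sub>R outer (\<Gamma> \<epsilon> (int (Suc k)) w) (Y \<epsilon> 0 w) \<partial>M \<epsilon>) =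
      (\<integral>w. h w *\<^sub>R (transpose (P (\<zeta> \<epsilon> (int k) w)) ** outer (\<Gamma> \<epsilon> (int k) w) (Y \<epsilon> 0 w)) \<partial>M \<epsilon>)"
proof -
  interpret c: coupled_chains "M \<epsilon>" P \<pi>\<^sub>0 "\<zeta> \<epsilon>" "\<Gamma> \<epsilon>" "\<Gamma>b \<epsilon>" "No \<epsilon>" "Nb \<epsilon>" by (rule chains[OF \<epsilon>])
  show "(\<integral>w. h w *\<^sub>R outer (\<Gamma> \<epsilon> 0 w) (Y \<epsilon> 0 w) \<partial>M \<epsilon>) = (\<integral>w. h w *\<^sub>R outer (Y \<epsilon> 0 w) (Y \<epsilon> 0 w) \<partial>M \<epsilon>)"
    using c.chain.integral_outer_X_Y_same[OF h, of "- 1"] by simp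
  show "(\<integral>w. h w *\<^sub>R outer (\<Gamma> \<epsilon> (int (Suc k)) w) (Y \<epsilon> 0 w) \<partial>M \<epsilon>) =
      (\<integral>w. h w *\<^sub>R (transpose (P (\<zeta> \<epsilon> (int k) w)) ** outer (\<Gamma> \<epsilon> (int k) w) (Y \<epsilon> 0 w)) \<partial>M \<epsilon>)"
    using c.chain.integral_outer_X_Y_Suc[OF h, of 0 "int k"] by (simp add: add.commute)
qed

text \<open>With a weight of order two, each random matrix may be replaced by \<open>P 0\<close> at
  the price of order three, so the recursion has the constant coefficient
  \<open>transpose (P 0)\<close>. The errors of the \<open>k\<close> steps accumulate; the constant
  may depend on \<open>k\<close> but not on \<open>\<epsilon>\<close>.\<close>

lemma integral_env2_outer_state_Y:
  "eq_O3 \<epsilon>\<^sub>0 (\<lambda>\<epsilon>. \<integral>w. \<zeta>\<zeta> a b \<epsilon> w *\<^sub>R outer (\<Gamma> \<epsilon> (int k) w) (Y \<epsilon> 0 w) \<partial>M \<epsilon>)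
    (\<lambda>\<epsilon>. R\<zeta> \<epsilon> (a - b) *\<^sub>R (mpow (transpose (P 0)) k ** \<Sigma>b))"
proof (induction k)
  case 0
  show ?case
  proof (rule eq_O3_cong_left)
    fix \<epsilon> assume \<epsilon>: "\<epsilon> \<in> I"
    then interpret c: coupled_chains "M \<epsilon>" P \<pi>\<^sub>0 "\<zeta> \<epsilon>" "\<Gamma> \<epsilon>" "\<Gamma>b \<epsilon>" "No \<epsilon>" "Nb \<epsilon>" by (rule chains)
    have "bounded_rv (M \<epsilon>) (c.F t) (\<lambda>w. \<zeta>\<zeta> a b \<epsilon> w)" for t
      by (intro bounded_rv_intros c.bounded_env_F)
    from integral_outer_state_Y_Suc(1)[OF \<epsilon> this]
    show "(\<integral>w. \<zeta>\<zeta> a b \<epsilon> w *\<^sub>R outer (\<Gamma> \<epsilon> (int 0) w) (Y \<epsilon> 0 w) \<partial>M \<epsilon>) =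
        (\<integral>w. \<zeta>\<zeta> a b \<epsilon> w *\<^sub>R outer (Y \<epsilon> 0 w) (Y \<epsilon> 0 w) \<partial>M \<epsilon>)" by simp
  qed (use integral_env2_Y_Y in simp)
next
  case (Suc k)
  note bl = bounded_linear_matrix_matrix_right[of "transpose (P 0)"]
  define U where "U \<epsilon> w = outer (\<Gamma> \<epsilon> (int k) w) (Y \<epsilon> 0 w)" for \<epsilon> w
  have U: "rv_O 0 U"
    using rv_O_outer[OF rv_O_state rv_O_Y] unfolding U_def by simp
  have PU: "rv_O 0 (\<lambda>\<epsilon> w. transpose (P (\<zeta> \<epsilon> (int k) w)) ** U \<epsilon> w)"
    using rv_O_mm[OF rv_O_transpose[OF rv_O_P0] U] by simp
  have dU: "rv_O 1 (\<lambda>\<epsilon> w. transpose (P (\<zeta> \<epsilon> (int k) w) - P 0) ** U \<epsilon> w)"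
    using rv_O_mm[OF rv_O_transpose[OF rv_O_P1] U] by simp
  have 1: "eq_O3 \<epsilon>\<^sub>0 (\<lambda>\<epsilon>. \<integral>w. \<zeta>\<zeta> a b \<epsilon> w *\<^sub>R (transpose (P (\<zeta> \<epsilon> (int k) w)) ** U \<epsilon> w) \<partial>M \<epsilon>)
      (\<lambda>\<epsilon>. \<integral>w. transpose (P 0) ** (\<zeta>\<zeta> a b \<epsilon> w *\<^sub>R U \<epsilon> w) \<partial>M \<epsilon>)"
  proof (rule eq_O3_integral[OF rv_O_scaleR[OF rv_O_env2 PU] rv_O_linear[OF bl rv_O_scaleR[OF rv_O_env2 U]]])
    show "rv_O 3 (\<lambda>\<epsilon> w. \<zeta>\<zeta> a b \<epsilon> w *\<^sub>R (transpose (P (\<zeta> \<epsilon> (int k) w)) ** U \<epsilon> w) -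
        transpose (P 0) ** (\<zeta>\<zeta> a b \<epsilon> w *\<^sub>R U \<epsilon> w))"
      using rv_O_scaleR[OF rv_O_env2[of a b] dU]
      by (simp add: transpose_diff bounded_bilinear.diff_left[OF bounded_bilinear_matrix_matrix]
          linear_scale[OF bounded_linear.linear[OF bl]] scaleR_right_diff_distrib)
  qed
  have 2: "eq_O3 \<epsilon>\<^sub>0 (\<lambda>\<epsilon>. transpose (P 0) ** (\<integral>w. \<zeta>\<zeta> a b \<epsilon> w *\<^sub>R U \<epsilon> w \<partial>M \<epsilon>))
      (\<lambda>\<epsilon>. transpose (P 0) ** (R\<zeta> \<epsilon> (a - b) *\<^sub>R (mpow (transpose (P 0)) k ** \<Sigma>b)))"
    unfolding U_def by (rule eq_O3_linear[OF bl Suc])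
  show ?case
  proof (rule eq_O3_cong_left[OF _ eq_O3_trans[OF 1 eq_O3_cong_left[OF _ eq_O3_cong_right[OF 2]]]])
    fix \<epsilon> assume \<epsilon>: "\<epsilon> \<in> I"
    then interpret c: coupled_chains "M \<epsilon>" P \<pi>\<^sub>0 "\<zeta> \<epsilon>" "\<Gamma> \<epsilon>" "\<Gamma>b \<epsilon>" "No \<epsilon>" "Nb \<epsilon>" by (rule chains)
    have "bounded_rv (M \<epsilon>) (c.F t) (\<lambda>w. \<zeta>\<zeta> a b \<epsilon> w)" for t
      by (intro bounded_rv_intros c.bounded_env_F)
    from integral_outer_state_Y_Suc(2)[OF \<epsilon> this]
    show "(\<integral>w. \<zeta>\<zeta> a b \<epsilon> w *\<^sub>R outer (\<Gamma> \<epsilon> (int (Suc k)) w) (Y \<epsilon> 0 w) \<partial>M \<epsilon>) =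
        (\<integral>w. \<zeta>\<zeta> a b \<epsilon> w *\<^sub>R (transpose (P (\<zeta> \<epsilon> (int k) w)) ** U \<epsilon> w) \<partial>M \<epsilon>)"
      unfolding U_def .
    show "(\<integral>w. transpose (P 0) ** (\<zeta>\<zeta> a b \<epsilon> w *\<^sub>R U \<epsilon> w) \<partial>M \<epsilon>) =
        transpose (P 0) ** (\<integral>w. \<zeta>\<zeta> a b \<epsilon> w *\<^sub>R U \<epsilon> w \<partial>M \<epsilon>)"
      by (intro integral_bounded_linear bl rv_O_integrable[OF rv_O_scaleR[OF rv_O_env2 U] \<epsilon>])
    show "transpose (P 0) ** (R\<zeta> \<epsilon> (a - b) *\<^sub>R (mpow (transpose (P 0)) k ** \<Sigma>b)) =
        R\<zeta> \<epsilon> (a - b) *\<^sub>R (mpow (transpose (P 0)) (Suc k) ** \<Sigma>b)"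
      by (simp add: linear_scale[OF bounded_linear.linear[OF bl]] matrix_mul_assoc)
  qed
qed

text \<open>A discrete variation of constants formula. With one factor \<open>\<zeta>\<close> in
  front, the linear Taylor term of the matrix at time \<open>i\<close> must be kept. It creates a
  weight with two factors, known from \<open>integral_env2_outer_state_Y\<close>, and this source is
  carried by powers of \<open>transpose (P 0)\<close> over the remaining \<open>k - 1 - i\<close>
  steps. The initial moment has only one factor \<open>\<zeta>\<close> and is left as it is.\<close>

lemma integral_env_outer_state_Y:
  "eq_O3 \<epsilon>\<^sub>0 (\<lambda>\<epsilon>. \<integral>w. \<zeta> \<epsilon> t w *\<^sub>R outer (\<Gamma> \<epsilon> (int k) w) (Y \<epsilon> 0 w) \<partial>M \<epsilon>)
    (\<lambda>\<epsilon>. mpow (transpose (P 0)) k ** (\<integral>w. \<zeta> \<epsilon> t w *\<^sub>R outer (Y \<epsilon> 0 w) (Y \<epsilon> 0 w) \<partial>M \<epsilon>) +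
      (\<Sum>i<k. R\<zeta> \<epsilon> (t - int i) *\<^sub>R
        (mpow (transpose (P 0)) (k - 1 - i) ** transpose E ** mpow (transpose (P 0)) i)) ** \<Sigma>b)"
proof (induction k)
  case 0
  show ?case
  proof (rule eq_O3_refl)
    fix \<epsilon> assume \<epsilon>: "\<epsilon> \<in> I"
    then interpret c: coupled_chains "M \<epsilon>" P \<pi>\<^sub>0 "\<zeta> \<epsilon>" "\<Gamma> \<epsilon>" "\<Gamma>b \<epsilon>" "No \<epsilon>" "Nb \<epsilon>" by (rule chains)
    show "(\<integral>w. \<zeta> \<epsilon> t w *\<^sub>R outer (\<Gamma> \<epsilon> (int 0) w) (Y \<epsilon> 0 w) \<partial>M \<epsilon>) =
        mpow (transpose (P 0)) 0 ** (\<integral>w. \<zeta> \<epsilon> t w *\<^sub>R outer (Y \<epsilon> 0 w) (Y \<epsilon> 0 w) \<partial>M \<epsilon>) +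
      (\<Sum>i<0. R\<zeta> \<epsilon> (t - int i) *\<^sub>R
        (mpow (transpose (P 0)) (0 - 1 - i) ** transpose E ** mpow (transpose (P 0)) i)) ** \<Sigma>b"
      using integral_outer_state_Y_Suc(1)[OF \<epsilon> c.bounded_env_F]
      by (simp add: bounded_bilinear.zero_left[OF bounded_bilinear_matrix_matrix])
  qed
next
  case (Suc k)
  let ?A = "transpose (P 0)"
  note bl = bounded_linear_matrix_matrix_right[of ?A]
  note blE = bounded_linear_matrix_matrix_right[of "transpose E"]
  define U where "U \<epsilon> w = outer (\<Gamma> \<epsilon> (int k) w) (Y \<epsilon> 0 w)" for \<epsilon> w
  define z where "z \<epsilon> w = \<zeta> \<epsilon> (int k) w" for \<epsilon> w
  have U: "rv_O 0 U"
    using rv_O_outer[OF rv_O_state rv_O_Y] unfolding U_def by simp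
  have PU: "rv_O 0 (\<lambda>\<epsilon> w. transpose (P (z \<epsilon> w)) ** U \<epsilon> w)"
    using rv_O_mm[OF rv_O_transpose[OF rv_O_P0] U] by (simp add: z_def)
  have dU: "rv_O 2 (\<lambda>\<epsilon> w. transpose (P (z \<epsilon> w) - P 0 - z \<epsilon> w *\<^sub>R E) ** U \<epsilon> w)"
    using rv_O_mm[OF rv_O_transpose[OF rv_O_P2] U] by (simp add: z_def)
  have L1: "rv_O 1 (\<lambda>\<epsilon> w. ?A ** (\<zeta> \<epsilon> t w *\<^sub>R U \<epsilon> w))"
    using rv_O_linear[OF bl rv_O_scaleR[OF rv_O_env U]] by simp
  have L2: "rv_O 2 (\<lambda>\<epsilon> w. transpose E ** ((\<zeta> \<epsilon> t w * z \<epsilon> w) *\<^sub>R U \<epsilon> w))"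
    using rv_O_linear[OF blE rv_O_scaleR[OF rv_O_env2 U]] by (simp add: z_def)
  have 1: "eq_O3 \<epsilon>\<^sub>0 (\<lambda>\<epsilon>. \<integral>w. \<zeta> \<epsilon> t w *\<^sub>R (transpose (P (z \<epsilon> w)) ** U \<epsilon> w) \<partial>M \<epsilon>)
      (\<lambda>\<epsilon>. \<integral>w. ?A ** (\<zeta> \<epsilon> t w *\<^sub>R U \<epsilon> w) + transpose E ** ((\<zeta> \<epsilon> t w * z \<epsilon> w) *\<^sub>R U \<epsilon> w) \<partial>M \<epsilon>)"
  proof (rule eq_O3_integral[OF rv_O_scaleR[OF rv_O_env PU] rv_O_add[OF L1 rv_O_weaken[OF L2]]])
    have "c *\<^sub>R (transpose (p - p0 - x *\<^sub>R e) ** m) =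
        c *\<^sub>R (transpose p ** m) - (transpose p0 ** (c *\<^sub>R m) + transpose e ** ((c * x) *\<^sub>R m))"
      for c x :: real and p p0 e m :: "'n rmat"
      unfolding transpose_diff transpose_scaleR bounded_bilinear.diff_left[OF bounded_bilinear_matrix_matrix]
        bounded_bilinear.scaleR_left[OF bounded_bilinear_matrix_matrix]
        bounded_bilinear.scaleR_right[OF bounded_bilinear_matrix_matrix]
      by (simp add: algebra_simps)
    \<comment> \<open>One factor \<open>\<zeta>\<close> times the second-order Taylor
      remainder.\<close>
    moreover have "rv_O 3 (\<lambda>\<epsilon> w. \<zeta> \<epsilon> t w *\<^sub>R (transpose (P (z \<epsilon> w) - P 0 - z \<epsilon> w *\<^sub>R E) ** U \<epsilon> w))"
      by (rule rv_O_weaken[OF rv_O_scaleR[OF rv_O_env dU]]) simp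
    ultimately show "rv_O 3 (\<lambda>\<epsilon> w. \<zeta> \<epsilon> t w *\<^sub>R (transpose (P (z \<epsilon> w)) ** U \<epsilon> w) -
        (?A ** (\<zeta> \<epsilon> t w *\<^sub>R U \<epsilon> w) + transpose E ** ((\<zeta> \<epsilon> t w * z \<epsilon> w) *\<^sub>R U \<epsilon> w)))"
      by (simp only:)
  qed simp
  let ?I = "\<lambda>\<epsilon>. \<integral>w. \<zeta> \<epsilon> t w *\<^sub>R outer (Y \<epsilon> 0 w) (Y \<epsilon> 0 w) \<partial>M \<epsilon>"
  let ?S = "\<lambda>\<epsilon>. \<Sum>i<k. R\<zeta> \<epsilon> (t - int i) *\<^sub>R (mpow ?A (k - 1 - i) ** transpose E ** mpow ?A i)"
  \<comment> \<open>The first summand propagates the induction hypothesis; the second is the new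
    source at time \<open>k\<close>.\<close>
  have 2: "eq_O3 \<epsilon>\<^sub>0 (\<lambda>\<epsilon>. ?A ** (\<integral>w. \<zeta> \<epsilon> t w *\<^sub>R U \<epsilon> w \<partial>M \<epsilon>) +
        transpose E ** (\<integral>w. (\<zeta> \<epsilon> t w * z \<epsilon> w) *\<^sub>R U \<epsilon> w \<partial>M \<epsilon>))
      (\<lambda>\<epsilon>. ?A ** (mpow ?A k ** ?I \<epsilon> + ?S \<epsilon> ** \<Sigma>b) +
        transpose E ** (R\<zeta> \<epsilon> (t - int k) *\<^sub>R (mpow ?A k ** \<Sigma>b)))"
    unfolding U_def z_def
    by (intro eq_O3_add eq_O3_linear[OF bl Suc] eq_O3_linear[OF blE integral_env2_outer_state_Y])
  show ?case
  proof (rule eq_O3_cong_left[OF _ eq_O3_trans[OF 1 eq_O3_cong_left[OF _ eq_O3_cong_right[OF 2]]]])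
    fix \<epsilon> assume \<epsilon>: "\<epsilon> \<in> I"
    then interpret c: coupled_chains "M \<epsilon>" P \<pi>\<^sub>0 "\<zeta> \<epsilon>" "\<Gamma> \<epsilon>" "\<Gamma>b \<epsilon>" "No \<epsilon>" "Nb \<epsilon>" by (rule chains)
    show "(\<integral>w. \<zeta> \<epsilon> t w *\<^sub>R outer (\<Gamma> \<epsilon> (int (Suc k)) w) (Y \<epsilon> 0 w) \<partial>M \<epsilon>) =
        (\<integral>w. \<zeta> \<epsilon> t w *\<^sub>R (transpose (P (z \<epsilon> w)) ** U \<epsilon> w) \<partial>M \<epsilon>)"
      unfolding U_def z_def by (rule integral_outer_state_Y_Suc(2)[OF \<epsilon> c.bounded_env_F])
    have "(\<integral>w. ?A ** (\<zeta> \<epsilon> t w *\<^sub>R U \<epsilon> w) + transpose E ** ((\<zeta> \<epsilon> t w * z \<epsilon> w) *\<^sub>R U \<epsilon> w) \<partial>M \<epsilon>) =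
        (\<integral>w. ?A ** (\<zeta> \<epsilon> t w *\<^sub>R U \<epsilon> w) \<partial>M \<epsilon>) + (\<integral>w. transpose E ** ((\<zeta> \<epsilon> t w * z \<epsilon> w) *\<^sub>R U \<epsilon> w) \<partial>M \<epsilon>)"
      by (intro Bochner_Integration.integral_add rv_O_integrable[OF L1 \<epsilon>] rv_O_integrable[OF L2 \<epsilon>])
    also have "(\<integral>w. ?A ** (\<zeta> \<epsilon> t w *\<^sub>R U \<epsilon> w) \<partial>M \<epsilon>) = ?A ** (\<integral>w. \<zeta> \<epsilon> t w *\<^sub>R U \<epsilon> w \<partial>M \<epsilon>)"
      by (intro integral_bounded_linear bl rv_O_integrable[OF rv_O_scaleR[OF rv_O_env U] \<epsilon>])
    also have "(\<integral>w. transpose E ** ((\<zeta> \<epsilon> t w * z \<epsilon> w) *\<^sub>R U \<epsilon> w) \<partial>M \<epsilon>) =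
        transpose E ** (\<integral>w. (\<zeta> \<epsilon> t w * z \<epsilon> w) *\<^sub>R U \<epsilon> w \<partial>M \<epsilon>)"
      unfolding z_def
      by (intro integral_bounded_linear blE rv_O_integrable[OF rv_O_scaleR[OF rv_O_env2 U] \<epsilon>])
    finally show "(\<integral>w. ?A ** (\<zeta> \<epsilon> t w *\<^sub>R U \<epsilon> w) + transpose E ** ((\<zeta> \<epsilon> t w * z \<epsilon> w) *\<^sub>R U \<epsilon> w) \<partial>M \<epsilon>) =
        ?A ** (\<integral>w. \<zeta> \<epsilon> t w *\<^sub>R U \<epsilon> w \<partial>M \<epsilon>) + transpose E ** (\<integral>w. (\<zeta> \<epsilon> t w * z \<epsilon> w) *\<^sub>R U \<epsilon> w \<partial>M \<epsilon>)" .
    \<comment> \<open>For \<open>i < k\<close> no subtraction is truncated, so one more factor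
      raises the exponent by exactly one. The additional index \<open>i = k\<close> has exponent 0
      and is the new source.\<close>
    have "?A ** ?S \<epsilon> = (\<Sum>i<k. R\<zeta> \<epsilon> (t - int i) *\<^sub>R (mpow ?A (Suc k - 1 - i) ** transpose E ** mpow ?A i))"
      unfolding linear_sum[OF bounded_linear.linear[OF bl]]
    proof (rule sum.cong[OF refl])
      fix i assume "i \<in> {..<k}"
      then have "Suc k - 1 - i = Suc (k - 1 - i)" by auto
      then show "?A ** (R\<zeta> \<epsilon> (t - int i) *\<^sub>R (mpow ?A (k - 1 - i) ** transpose E ** mpow ?A i)) =
          R\<zeta> \<epsilon> (t - int i) *\<^sub>R (mpow ?A (Suc k - 1 - i) ** transpose E ** mpow ?A i)"
        by (simp only: linear_scale[OF bounded_linear.linear[OF bl]] matrix_mul_assoc mpow.simps)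
    qed
    then have S: "(\<Sum>i<Suc k. R\<zeta> \<epsilon> (t - int i) *\<^sub>R (mpow ?A (Suc k - 1 - i) ** transpose E ** mpow ?A i)) =
        ?A ** ?S \<epsilon> + R\<zeta> \<epsilon> (t - int k) *\<^sub>R (transpose E ** mpow ?A k)"
      by simp
    show "?A ** (mpow ?A k ** ?I \<epsilon> + ?S \<epsilon> ** \<Sigma>b) + transpose E ** (R\<zeta> \<epsilon> (t - int k) *\<^sub>R (mpow ?A k ** \<Sigma>b)) =
        mpow ?A (Suc k) ** ?I \<epsilon> +
        (\<Sum>i<Suc k. R\<zeta> \<epsilon> (t - int i) *\<^sub>R (mpow ?A (Suc k - 1 - i) ** transpose E ** mpow ?A i)) ** \<Sigma>b"
      unfolding S
      by (simp only: linear_scale[OF bounded_linear.linear[OF blE]] linear_add[OF bounded_linear.linear[OF bl]]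
          bounded_bilinear.add_left[OF bounded_bilinear_matrix_matrix]
          bounded_bilinear.scaleR_left[OF bounded_bilinear_matrix_matrix] matrix_mul_assoc mpow.simps add.assoc)
  qed
qed

text \<open>The covariance of the innovation is exactly the diagonal of the mean state minus the
  mean of \<open>transpose Q ** diag X ** Q\<close>, with \<open>Q\<close> the random matrix at time
  \<open>s - 1\<close>. Inserting the second-order Taylor polynomial twice and sorting by powers of
  \<open>\<zeta>\<close> gives three linear functions of the state. The coefficients of degree zero
  and one act on exact moments; only that of degree two is evaluated through the coupling.\<close>

lemma integral_Y_Y:
  "eq_O3 \<epsilon>\<^sub>0 (\<lambda>\<epsilon>. \<integral>w. outer (Y \<epsilon> s w) (Y \<epsilon> s w) \<partial>M \<epsilon>)
    (\<lambda>\<epsilon>. diag (\<integral>w. \<Gamma> \<epsilon> s w \<partial>M \<epsilon>) - transpose (P 0) ** diag (\<integral>w. \<Gamma> \<epsilon> s w \<partial>M \<epsilon>) ** P 0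
       - (transpose (P 0) ** diag (\<integral>w. \<zeta> \<epsilon> 0 w *\<^sub>R \<Gamma> \<epsilon> 0 w \<partial>M \<epsilon>) ** E
          + transpose E ** diag (\<integral>w. \<zeta> \<epsilon> 0 w *\<^sub>R \<Gamma> \<epsilon> 0 w \<partial>M \<epsilon>) ** P 0)
       - (1/2 * R\<zeta> \<epsilon> 0) *\<^sub>R
           (transpose (P 0) ** diag \<pi>\<^sub>0 ** W + 2 *\<^sub>R (transpose E ** diag \<pi>\<^sub>0 ** E)
            + transpose W ** diag \<pi>\<^sub>0 ** P 0))"
proof -
  define X where "X \<epsilon> = \<Gamma> \<epsilon> (s - 1)" for \<epsilon>
  define z where "z \<epsilon> = \<zeta> \<epsilon> (s - 1)" for \<epsilon>
  define Q where "Q \<epsilon> w = P (z \<epsilon> w)" for \<epsilon> w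
  define T where "T \<epsilon> w = P 0 + z \<epsilon> w *\<^sub>R E + ((z \<epsilon> w)\<^sup>2 / 2) *\<^sub>R W" for \<epsilon> w
  \<comment> \<open>\<open>\<kappa>\<close> is linear in each of its three arguments, so that
    \<open>\<kappa>\<close> at the Taylor polynomial expands like a square.\<close>
  define \<kappa> where "\<kappa> = (\<lambda>(L :: 'n rmat) N (x :: 'n rvec). transpose L ** (diag x ** (N :: 'n rmat)))"
  define \<alpha> where "\<alpha> = \<kappa> (P 0) (P 0)"
  define \<beta> where "\<beta> x = \<kappa> (P 0) E x + \<kappa> E (P 0) x" for x
  \<comment> \<open>The coefficient of degree two: each product of \<open>P 0\<close> with
    \<open>W\<close> carries the Taylor factor one half, while the product of \<open>E\<close> with
    itself has weight one, whence the 2 inside.\<close>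
  define \<gamma> where "\<gamma> x = (1/2) *\<^sub>R (\<kappa> (P 0) W x + 2 *\<^sub>R \<kappa> E E x + \<kappa> W (P 0) x)" for x
  have \<kappa>: "bounded_linear (\<kappa> L N)" for L N
    unfolding \<kappa>_def
    by (intro bounded_linear_compose[OF bounded_linear_matrix_matrix_right]
        bounded_linear_compose[OF bounded_linear_matrix_matrix_left] bounded_linear_diag)
  have \<alpha>: "bounded_linear \<alpha>" unfolding \<alpha>_def by (rule \<kappa>)
  have \<beta>: "bounded_linear \<beta>" unfolding \<beta>_def by (intro bounded_linear_add \<kappa>)
  have \<gamma>: "bounded_linear \<gamma>"
    unfolding \<gamma>_def
    by (intro bounded_linear_add bounded_linear_compose[OF bounded_linear_scaleR_right] \<kappa>)
  have X: "rv_O 0 X" unfolding X_def by (rule rv_O_state)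
  have z: "rv_O 1 z" unfolding z_def by (rule rv_O_env)
  have z2: "rv_O 2 (\<lambda>\<epsilon> w. (z \<epsilon> w)\<^sup>2)" unfolding z_def by (rule rv_O_env_power2)
  have zz: "rv_O 2 (\<lambda>\<epsilon> w. z \<epsilon> w * z \<epsilon> w)" unfolding z_def by (rule rv_O_env2)
  have Q: "rv_O 0 Q" unfolding Q_def z_def by (rule rv_O_P0)
  have QT: "rv_O 3 (\<lambda>\<epsilon> w. Q \<epsilon> w - T \<epsilon> w)"
    using rv_O_P3[of "s - 1"] by (simp add: Q_def T_def z_def algebra_simps)
  have T: "rv_O 0 T"
  proof -
    have "rv_O 0 (\<lambda>\<epsilon> w. Q \<epsilon> w - (Q \<epsilon> w - T \<epsilon> w))"
      by (intro rv_O_diff Q rv_O_weaken[OF QT]) simp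
    then show ?thesis by simp
  qed
  have \<kappa>O: "rv_O (l + n) (\<lambda>\<epsilon> w. \<kappa> (L \<epsilon> w) (N \<epsilon> w) (X \<epsilon> w))" if "rv_O l L" "rv_O n N" for L N l n
    using rv_O_mm[OF rv_O_transpose[OF that(1)] rv_O_mm[OF rv_O_diag[OF X] that(2)]] by (simp add: \<kappa>_def)
  have \<kappa>_add: "\<kappa> (L + L') N x = \<kappa> L N x + \<kappa> L' N x" "\<kappa> L (N + N') x = \<kappa> L N x + \<kappa> L N' x"
    "\<kappa> (L - L') N x = \<kappa> L N x - \<kappa> L' N x" "\<kappa> L (N - N') x = \<kappa> L N x - \<kappa> L N' x"
    "\<kappa> (c *\<^sub>R L) N x = c *\<^sub>R \<kappa> L N x" "\<kappa> L (c *\<^sub>R N) x = c *\<^sub>R \<kappa> L N x" for L L' N N' x c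
    by (simp_all add: \<kappa>_def transpose_add transpose_diff transpose_scaleR
        bounded_bilinear.add_left[OF bounded_bilinear_matrix_matrix]
        bounded_bilinear.add_right[OF bounded_bilinear_matrix_matrix]
        bounded_bilinear.diff_left[OF bounded_bilinear_matrix_matrix]
        bounded_bilinear.diff_right[OF bounded_bilinear_matrix_matrix]
        bounded_bilinear.scaleR_left[OF bounded_bilinear_matrix_matrix]
        bounded_bilinear.scaleR_right[OF bounded_bilinear_matrix_matrix])
  let ?G = "\<lambda>\<epsilon> w. \<alpha> (X \<epsilon> w) + z \<epsilon> w *\<^sub>R \<beta> (X \<epsilon> w) + (z \<epsilon> w * z \<epsilon> w) *\<^sub>R \<gamma> (X \<epsilon> w)"
  have \<alpha>O: "rv_O 0 (\<lambda>\<epsilon> w. \<alpha> (X \<epsilon> w))" by (rule rv_O_linear[OF \<alpha> X])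
  have \<beta>O: "rv_O 1 (\<lambda>\<epsilon> w. z \<epsilon> w *\<^sub>R \<beta> (X \<epsilon> w))"
    using rv_O_scaleR[OF z rv_O_linear[OF \<beta> X]] by simp
  have \<gamma>O: "rv_O 2 (\<lambda>\<epsilon> w. (z \<epsilon> w * z \<epsilon> w) *\<^sub>R \<gamma> (X \<epsilon> w))"
    using rv_O_scaleR[OF zz rv_O_linear[OF \<gamma> X]] by simp
  have GO: "rv_O 0 ?G"
    by (intro rv_O_add \<alpha>O rv_O_weaken[OF \<beta>O] rv_O_weaken[OF \<gamma>O]) simp_all
  have QQ: "rv_O 0 (\<lambda>\<epsilon> w. \<kappa> (Q \<epsilon> w) (Q \<epsilon> w) (X \<epsilon> w))"
    using \<kappa>O[OF Q Q] by simp
  \<comment> \<open>Everything dropped: the error from replacing \<open>Q\<close> by its Taylor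
    polynomial \<open>T\<close>, one factor at a time, and the terms of degree three and four in the
    expanded square.\<close>
  have "rv_O 3 (\<lambda>\<epsilon> w. (\<kappa> (Q \<epsilon> w - T \<epsilon> w) (Q \<epsilon> w) (X \<epsilon> w) + \<kappa> (T \<epsilon> w) (Q \<epsilon> w - T \<epsilon> w) (X \<epsilon> w)) +
      (z \<epsilon> w)\<^sup>2 *\<^sub>R (z \<epsilon> w *\<^sub>R ((1/2) *\<^sub>R (\<kappa> E W (X \<epsilon> w) + \<kappa> W E (X \<epsilon> w))) +
        (z \<epsilon> w)\<^sup>2 *\<^sub>R ((1/4) *\<^sub>R \<kappa> W W (X \<epsilon> w))))"
  proof (intro rv_O_add)
    show "rv_O 3 (\<lambda>\<epsilon> w. \<kappa> (Q \<epsilon> w - T \<epsilon> w) (Q \<epsilon> w) (X \<epsilon> w))" using \<kappa>O[OF QT Q] by simp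
    show "rv_O 3 (\<lambda>\<epsilon> w. \<kappa> (T \<epsilon> w) (Q \<epsilon> w - T \<epsilon> w) (X \<epsilon> w))" using \<kappa>O[OF T QT] by simp
    have h: "bounded_linear (\<lambda>x. (1/2) *\<^sub>R (\<kappa> E W x + \<kappa> W E x))" "bounded_linear (\<lambda>x. (1/4) *\<^sub>R \<kappa> W W x)"
      by (intro bounded_linear_compose[OF bounded_linear_scaleR_right] bounded_linear_add \<kappa>)+
    have "rv_O 1 (\<lambda>\<epsilon> w. z \<epsilon> w *\<^sub>R ((1/2) *\<^sub>R (\<kappa> E W (X \<epsilon> w) + \<kappa> W E (X \<epsilon> w))) +
        (z \<epsilon> w)\<^sup>2 *\<^sub>R ((1/4) *\<^sub>R \<kappa> W W (X \<epsilon> w)))"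
      by (intro rv_O_add rv_O_weaken[OF rv_O_scaleR[OF z rv_O_linear[OF h(1) X]]]
          rv_O_weaken[OF rv_O_scaleR[OF z2 rv_O_linear[OF h(2) X]]]) simp_all
    from rv_O_scaleR[OF z2 this]
    show "rv_O 3 (\<lambda>\<epsilon> w. (z \<epsilon> w)\<^sup>2 *\<^sub>R (z \<epsilon> w *\<^sub>R ((1/2) *\<^sub>R (\<kappa> E W (X \<epsilon> w) + \<kappa> W E (X \<epsilon> w))) +
        (z \<epsilon> w)\<^sup>2 *\<^sub>R ((1/4) *\<^sub>R \<kappa> W W (X \<epsilon> w))))"
      by (rule rv_O_weaken) simp
  qed
  moreover have "(\<kappa> (Q \<epsilon> w - T \<epsilon> w) (Q \<epsilon> w) (X \<epsilon> w) + \<kappa> (T \<epsilon> w) (Q \<epsilon> w - T \<epsilon> w) (X \<epsilon> w)) +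
      (z \<epsilon> w)\<^sup>2 *\<^sub>R (z \<epsilon> w *\<^sub>R ((1/2) *\<^sub>R (\<kappa> E W (X \<epsilon> w) + \<kappa> W E (X \<epsilon> w))) +
        (z \<epsilon> w)\<^sup>2 *\<^sub>R ((1/4) *\<^sub>R \<kappa> W W (X \<epsilon> w))) = \<kappa> (Q \<epsilon> w) (Q \<epsilon> w) (X \<epsilon> w) - ?G \<epsilon> w" for \<epsilon> w
  proof -
    have 1: "\<kappa> (Q \<epsilon> w - T \<epsilon> w) (Q \<epsilon> w) (X \<epsilon> w) + \<kappa> (T \<epsilon> w) (Q \<epsilon> w - T \<epsilon> w) (X \<epsilon> w) =
        \<kappa> (Q \<epsilon> w) (Q \<epsilon> w) (X \<epsilon> w) - \<kappa> (T \<epsilon> w) (T \<epsilon> w) (X \<epsilon> w)"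
      by (simp add: \<kappa>_add)
    have 2: "\<kappa> (T \<epsilon> w) (T \<epsilon> w) (X \<epsilon> w) = ?G \<epsilon> w +
      (z \<epsilon> w)\<^sup>2 *\<^sub>R (z \<epsilon> w *\<^sub>R ((1/2) *\<^sub>R (\<kappa> E W (X \<epsilon> w) + \<kappa> W E (X \<epsilon> w))) +
        (z \<epsilon> w)\<^sup>2 *\<^sub>R ((1/4) *\<^sub>R \<kappa> W W (X \<epsilon> w)))"
      unfolding T_def \<kappa>_add \<alpha>_def \<beta>_def \<gamma>_def
      by (simp add: scaleR_right_distrib power2_eq_square mult_ac add_ac)
    show ?thesis unfolding 1 2 by simp
  qed
  ultimately have 1: "eq_O3 \<epsilon>\<^sub>0 (\<lambda>\<epsilon>. \<integral>w. \<kappa> (Q \<epsilon> w) (Q \<epsilon> w) (X \<epsilon> w) \<partial>M \<epsilon>) (\<lambda>\<epsilon>. \<integral>w. ?G \<epsilon> w \<partial>M \<epsilon>)"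
    by (intro eq_O3_integral[OF QQ GO]) (simp only:)
  let ?p = "\<lambda>\<epsilon>. \<integral>w. \<Gamma> \<epsilon> s w \<partial>M \<epsilon>" and ?r = "\<lambda>\<epsilon>. \<integral>w. \<zeta> \<epsilon> 0 w *\<^sub>R \<Gamma> \<epsilon> 0 w \<partial>M \<epsilon>"
  have 2: "eq_O3 \<epsilon>\<^sub>0 (\<lambda>\<epsilon>. \<integral>w. (z \<epsilon> w * z \<epsilon> w) *\<^sub>R \<gamma> (X \<epsilon> w) \<partial>M \<epsilon>) (\<lambda>\<epsilon>. R\<zeta> \<epsilon> (s - 1 - (s - 1)) *\<^sub>R \<gamma> \<pi>\<^sub>0)"
    unfolding z_def X_def by (rule integral_env2_state[OF \<gamma>])
  have 3: "(\<integral>w. ?G \<epsilon> w \<partial>M \<epsilon>) = \<alpha> (?p \<epsilon>) + \<beta> (?r \<epsilon>) + (\<integral>w. (z \<epsilon> w * z \<epsilon> w) *\<^sub>R \<gamma> (X \<epsilon> w) \<partial>M \<epsilon>)"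
    if \<epsilon>: "\<epsilon> \<in> I" for \<epsilon>
  proof -
    interpret c: coupled_chains "M \<epsilon>" P \<pi>\<^sub>0 "\<zeta> \<epsilon>" "\<Gamma> \<epsilon>" "\<Gamma>b \<epsilon>" "No \<epsilon>" "Nb \<epsilon>" by (rule chains[OF \<epsilon>])
    have "(\<integral>w. ?G \<epsilon> w \<partial>M \<epsilon>) = (\<integral>w. \<alpha> (X \<epsilon> w) \<partial>M \<epsilon>) + (\<integral>w. z \<epsilon> w *\<^sub>R \<beta> (X \<epsilon> w) \<partial>M \<epsilon>) +
        (\<integral>w. (z \<epsilon> w * z \<epsilon> w) *\<^sub>R \<gamma> (X \<epsilon> w) \<partial>M \<epsilon>)"
      using rv_O_integrable[OF \<alpha>O \<epsilon>] rv_O_integrable[OF \<beta>O \<epsilon>] rv_O_integrable[OF \<gamma>O \<epsilon>] by simp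
    also have "(\<integral>w. \<alpha> (X \<epsilon> w) \<partial>M \<epsilon>) = \<alpha> (\<integral>w. X \<epsilon> w \<partial>M \<epsilon>)"
      by (rule integral_bounded_linear[OF \<alpha> rv_O_integrable[OF X \<epsilon>]])
    also have "(\<integral>w. X \<epsilon> w \<partial>M \<epsilon>) = ?p \<epsilon>"
      unfolding X_def by (rule c.integral_shift_X)
    also have "(\<integral>w. z \<epsilon> w *\<^sub>R \<beta> (X \<epsilon> w) \<partial>M \<epsilon>) = (\<integral>w. \<beta> (z \<epsilon> w *\<^sub>R X \<epsilon> w) \<partial>M \<epsilon>)"
      by (simp add: linear_scale[OF bounded_linear.linear[OF \<beta>]])
    also have "\<dots> = \<beta> (\<integral>w. z \<epsilon> w *\<^sub>R X \<epsilon> w \<partial>M \<epsilon>)"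
      by (rule integral_bounded_linear[OF \<beta> rv_O_integrable[OF rv_O_scaleR[OF z X] \<epsilon>]])
    also have "(\<integral>w. z \<epsilon> w *\<^sub>R X \<epsilon> w \<partial>M \<epsilon>) = ?r \<epsilon>"
      unfolding X_def z_def by (rule c.integral_shift_env_X)
    finally show ?thesis .
  qed
  have 4: "eq_O3 \<epsilon>\<^sub>0 (\<lambda>\<epsilon>. \<integral>w. \<kappa> (Q \<epsilon> w) (Q \<epsilon> w) (X \<epsilon> w) \<partial>M \<epsilon>)
      (\<lambda>\<epsilon>. \<alpha> (?p \<epsilon>) + \<beta> (?r \<epsilon>) + R\<zeta> \<epsilon> (s - 1 - (s - 1)) *\<^sub>R \<gamma> \<pi>\<^sub>0)"
    by (rule eq_O3_trans[OF 1 eq_O3_cong_left[OF 3 eq_O3_add[OF eq_O3_refl 2]]]) auto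
  show ?thesis
  proof (rule eq_O3_cong_left[OF _ eq_O3_cong_right[OF eq_O3_diff[OF eq_O3_refl 4]]])
    fix \<epsilon> assume \<epsilon>: "\<epsilon> \<in> I"
    then interpret c: coupled_chains "M \<epsilon>" P \<pi>\<^sub>0 "\<zeta> \<epsilon>" "\<Gamma> \<epsilon>" "\<Gamma>b \<epsilon>" "No \<epsilon>" "Nb \<epsilon>" by (rule chains)
    have XQ: "rv_O 0 (\<lambda>\<epsilon> w. X \<epsilon> w v* Q \<epsilon> w)" using rv_O_vm[OF X Q] by simp
    \<comment> \<open>A centred innovation makes the predicted state have the same mean as the state
      itself, which yields the leading diagonal term.\<close>
    have "(\<integral>w. Y \<epsilon> s w \<partial>M \<epsilon>) = 0"
      using c.chain.integral_scaleR_Y[OF bounded_rv_const[of _ _ 1], of "s - 1"] by simp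
    then have p: "(\<integral>w. X \<epsilon> w v* Q \<epsilon> w \<partial>M \<epsilon>) = ?p \<epsilon>"
      using rv_O_integrable[OF XQ \<epsilon>] rv_O_integrable[OF rv_O_state \<epsilon>]
      by (simp add: c.chain.Y_def X_def Q_def z_def)
    have "(\<integral>w. outer (Y \<epsilon> s w) (Y \<epsilon> s w) \<partial>M \<epsilon>) =
        (\<integral>w. diag (X \<epsilon> w v* Q \<epsilon> w) - \<kappa> (Q \<epsilon> w) (Q \<epsilon> w) (X \<epsilon> w) \<partial>M \<epsilon>)"
      using c.chain.integral_outer_Y_Y[OF bounded_rv_const[of _ _ 1], of "s - 1"]
      by (simp add: X_def Q_def z_def \<kappa>_def matrix_mul_assoc)
    also have "\<dots> = (\<integral>w. diag (X \<epsilon> w v* Q \<epsilon> w) \<partial>M \<epsilon>) - (\<integral>w. \<kappa> (Q \<epsilon> w) (Q \<epsilon> w) (X \<epsilon> w) \<partial>M \<epsilon>)"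
      by (intro Bochner_Integration.integral_diff rv_O_integrable[OF QQ \<epsilon>] rv_O_integrable[OF rv_O_diag[OF XQ] \<epsilon>])
    also have "(\<integral>w. diag (X \<epsilon> w v* Q \<epsilon> w) \<partial>M \<epsilon>) = diag (?p \<epsilon>)"
      unfolding p[symmetric] by (rule integral_bounded_linear[OF bounded_linear_diag rv_O_integrable[OF XQ \<epsilon>]])
    finally show "(\<integral>w. outer (Y \<epsilon> s w) (Y \<epsilon> s w) \<partial>M \<epsilon>) =
        diag (?p \<epsilon>) - (\<integral>w. \<kappa> (Q \<epsilon> w) (Q \<epsilon> w) (X \<epsilon> w) \<partial>M \<epsilon>)" .
    show "diag (?p \<epsilon>) - (\<alpha> (?p \<epsilon>) + \<beta> (?r \<epsilon>) + R\<zeta> \<epsilon> (s - 1 - (s - 1)) *\<^sub>R \<gamma> \<pi>\<^sub>0) =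
        diag (?p \<epsilon>) - transpose (P 0) ** diag (?p \<epsilon>) ** P 0
       - (transpose (P 0) ** diag (?r \<epsilon>) ** E + transpose E ** diag (?r \<epsilon>) ** P 0)
       - (1/2 * R\<zeta> \<epsilon> 0) *\<^sub>R
           (transpose (P 0) ** diag \<pi>\<^sub>0 ** W + 2 *\<^sub>R (transpose E ** diag \<pi>\<^sub>0 ** E)
            + transpose W ** diag \<pi>\<^sub>0 ** P 0)"
      by (simp add: \<alpha>_def \<beta>_def \<gamma>_def \<kappa>_def matrix_mul_assoc)
  qed simp
qed

section \<open>The disturbance process\<close>

abbreviation "\<Delta> \<epsilon> \<equiv> innovation P (\<zeta> \<epsilon>) (\<Gamma> \<epsilon>) (driving_noise (\<Gamma> \<epsilon>) (\<Gamma>b \<epsilon>) (No \<epsilon>) (Nb \<epsilon>))"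
abbreviation "Bz \<epsilon> t w \<equiv> \<zeta> \<epsilon> t w *\<^sub>R (\<Gamma> \<epsilon> t w v* E)"
abbreviation "Vz \<epsilon> t w \<equiv> (\<zeta> \<epsilon> t w)\<^sup>2 *\<^sub>R ((1/2) *\<^sub>R (\<Gamma> \<epsilon> t w v* W))"

lemma rv_O_Bz: "rv_O 1 (\<lambda>\<epsilon>. Bz \<epsilon> t)"
  by (rule rv_O_weaken[OF rv_O_scaleR[OF rv_O_env rv_O_vm[OF rv_O_state rv_O_const]]]) simp

lemma rv_O_Vz: "rv_O 2 (\<lambda>\<epsilon>. Vz \<epsilon> t)"
  by (rule rv_O_weaken[OF rv_O_scaleR[OF rv_O_env_power2
        rv_O_scaleR[OF rv_O_const rv_O_vm[OF rv_O_state rv_O_const]]]]) simp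

text \<open>The almost sure identity of innovation and \<open>Y\<close>, stated once for all
  correlations: \<open>f\<close> collects every other random factor.\<close>

lemma integral_innovation:
  fixes f :: "'w \<Rightarrow> 'n rvec \<Rightarrow> 'n rvec \<Rightarrow> 'b::{banach, second_countable_topology}"
  assumes \<epsilon>: "\<epsilon> \<in> I"
    and f: "\<And>u v. u \<in> borel_measurable (M \<epsilon>) \<Longrightarrow> v \<in> borel_measurable (M \<epsilon>) \<Longrightarrow>
      (\<lambda>w. f w (u w) (v w)) \<in> borel_measurable (M \<epsilon>)"
  shows "(\<integral>w. f w (\<Delta> \<epsilon> s w) (\<Delta> \<epsilon> t w) \<partial>M \<epsilon>) = (\<integral>w. f w (Y \<epsilon> s w) (Y \<epsilon> t w) \<partial>M \<epsilon>)"
proof -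
  interpret c: coupled_chains "M \<epsilon>" P \<pi>\<^sub>0 "\<zeta> \<epsilon>" "\<Gamma> \<epsilon>" "\<Gamma>b \<epsilon>" "No \<epsilon>" "Nb \<epsilon>" by (rule chains[OF \<epsilon>])
  show ?thesis
  proof (rule integral_cong_AE)
    show "AE w in M \<epsilon>. f w (\<Delta> \<epsilon> s w) (\<Delta> \<epsilon> t w) = f w (Y \<epsilon> s w) (Y \<epsilon> t w)"
      using c.innovation_AE[of s] c.innovation_AE[of t] by eventually_elim simp
  qed (intro f c.measurable_innovation bounded_rv_measurable[OF c.chain.bounded_M(4)])+
qed

section \<open>Correlations in terms of martingale differences\<close>

lemma measurable_Bz: "\<epsilon> \<in> I \<Longrightarrow> Bz \<epsilon> t \<in> borel_measurable (M \<epsilon>)"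
  and measurable_Vz: "\<epsilon> \<in> I \<Longrightarrow> Vz \<epsilon> t \<in> borel_measurable (M \<epsilon>)"
  and measurable_env: "\<epsilon> \<in> I \<Longrightarrow> \<zeta> \<epsilon> t \<in> borel_measurable (M \<epsilon>)"
  using rv_O_Bz rv_O_Vz rv_O_env unfolding rv_O_def by blast+

lemmas measurable_outer = borel_measurable_bilinear[OF bounded_bilinear_outer]

lemma correlations:
  assumes \<epsilon>: "\<epsilon> \<in> I"
  shows "corr_vv (M \<epsilon>) (Bz \<epsilon>) (\<Delta> \<epsilon>) t = (\<integral>w. outer (Bz \<epsilon> t w) (Y \<epsilon> 0 w) \<partial>M \<epsilon>)"
    and "corr_vv (M \<epsilon>) (Vz \<epsilon>) (\<Delta> \<epsilon>) t = (\<integral>w. outer (Vz \<epsilon> t w) (Y \<epsilon> 0 w) \<partial>M \<epsilon>)"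
    and "corr_vv (M \<epsilon>) (\<Delta> \<epsilon>) (\<Delta> \<epsilon>) t = (\<integral>w. outer (Y \<epsilon> t w) (Y \<epsilon> 0 w) \<partial>M \<epsilon>)"
    and "second_moment (M \<epsilon>) (\<Delta> \<epsilon>) t = (\<integral>w. outer (Y \<epsilon> t w) (Y \<epsilon> t w) \<partial>M \<epsilon>)"
    and "corr_vs (M \<epsilon>) (\<lambda>t w. outer (\<Delta> \<epsilon> t w) (\<Delta> \<epsilon> t w)) (\<zeta> \<epsilon>) t =
      (\<integral>w. \<zeta> \<epsilon> 0 w *\<^sub>R outer (Y \<epsilon> t w) (Y \<epsilon> t w) \<partial>M \<epsilon>)"
    and "corr_vs (M \<epsilon>) (\<lambda>t w. Bz \<epsilon> (t - 1) w + Vz \<epsilon> (t - 1) w + \<Delta> \<epsilon> t w) (\<zeta> \<epsilon>) t =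
      (\<integral>w. \<zeta> \<epsilon> 0 w *\<^sub>R (Bz \<epsilon> (t - 1) w + Vz \<epsilon> (t - 1) w + Y \<epsilon> t w) \<partial>M \<epsilon>)"
    and "corr_vv (M \<epsilon>) (\<lambda>t w. Bz \<epsilon> (t - 1) w + Vz \<epsilon> (t - 1) w + \<Delta> \<epsilon> t w)
        (\<lambda>t w. Bz \<epsilon> (t - 1) w + Vz \<epsilon> (t - 1) w + \<Delta> \<epsilon> t w) t =
      (\<integral>w. outer (Bz \<epsilon> (t - 1) w + Vz \<epsilon> (t - 1) w + Y \<epsilon> t w)
        (Bz \<epsilon> (- 1) w + Vz \<epsilon> (- 1) w + Y \<epsilon> 0 w) \<partial>M \<epsilon>)"
proof -
  note m = measurable_Bz[OF \<epsilon>] measurable_Vz[OF \<epsilon>] measurable_env[OF \<epsilon>] measurable_outer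
    borel_measurable_scaleR borel_measurable_add
  show "corr_vv (M \<epsilon>) (Bz \<epsilon>) (\<Delta> \<epsilon>) t = (\<integral>w. outer (Bz \<epsilon> t w) (Y \<epsilon> 0 w) \<partial>M \<epsilon>)"
    unfolding corr_vv_def by (rule integral_innovation[OF \<epsilon>, of "\<lambda>w u v. outer (Bz \<epsilon> t w) v"]) (intro m)
  show "corr_vv (M \<epsilon>) (Vz \<epsilon>) (\<Delta> \<epsilon>) t = (\<integral>w. outer (Vz \<epsilon> t w) (Y \<epsilon> 0 w) \<partial>M \<epsilon>)"
    unfolding corr_vv_def by (rule integral_innovation[OF \<epsilon>, of "\<lambda>w u v. outer (Vz \<epsilon> t w) v"]) (intro m)
  show "corr_vv (M \<epsilon>) (\<Delta> \<epsilon>) (\<Delta> \<epsilon>) t = (\<integral>w. outer (Y \<epsilon> t w) (Y \<epsilon> 0 w) \<partial>M \<epsilon>)"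
    unfolding corr_vv_def by (rule integral_innovation[OF \<epsilon>, of "\<lambda>w u v. outer u v"]) (intro m)
  show "second_moment (M \<epsilon>) (\<Delta> \<epsilon>) t = (\<integral>w. outer (Y \<epsilon> t w) (Y \<epsilon> t w) \<partial>M \<epsilon>)"
    unfolding second_moment_def by (rule integral_innovation[OF \<epsilon>, of "\<lambda>w u v. outer u v"]) (intro m)
  show "corr_vs (M \<epsilon>) (\<lambda>t w. outer (\<Delta> \<epsilon> t w) (\<Delta> \<epsilon> t w)) (\<zeta> \<epsilon>) t =
      (\<integral>w. \<zeta> \<epsilon> 0 w *\<^sub>R outer (Y \<epsilon> t w) (Y \<epsilon> t w) \<partial>M \<epsilon>)"
    unfolding corr_vs_def
    by (rule integral_innovation[OF \<epsilon>, of "\<lambda>w u v. \<zeta> \<epsilon> 0 w *\<^sub>R outer u v"]) (intro m)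
  show "corr_vs (M \<epsilon>) (\<lambda>t w. Bz \<epsilon> (t - 1) w + Vz \<epsilon> (t - 1) w + \<Delta> \<epsilon> t w) (\<zeta> \<epsilon>) t =
      (\<integral>w. \<zeta> \<epsilon> 0 w *\<^sub>R (Bz \<epsilon> (t - 1) w + Vz \<epsilon> (t - 1) w + Y \<epsilon> t w) \<partial>M \<epsilon>)"
    unfolding corr_vs_def
    by (rule integral_innovation[OF \<epsilon>, of "\<lambda>w u v. \<zeta> \<epsilon> 0 w *\<^sub>R (Bz \<epsilon> (t - 1) w + Vz \<epsilon> (t - 1) w + u)"]) (intro m)
  show "corr_vv (M \<epsilon>) (\<lambda>t w. Bz \<epsilon> (t - 1) w + Vz \<epsilon> (t - 1) w + \<Delta> \<epsilon> t w)
        (\<lambda>t w. Bz \<epsilon> (t - 1) w + Vz \<epsilon> (t - 1) w + \<Delta> \<epsilon> t w) t =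
      (\<integral>w. outer (Bz \<epsilon> (t - 1) w + Vz \<epsilon> (t - 1) w + Y \<epsilon> t w)
        (Bz \<epsilon> (- 1) w + Vz \<epsilon> (- 1) w + Y \<epsilon> 0 w) \<partial>M \<epsilon>)"
    unfolding corr_vv_def diff_0
    by (rule integral_innovation[OF \<epsilon>, of "\<lambda>w u v. outer (Bz \<epsilon> (t - 1) w + Vz \<epsilon> (t - 1) w + u)
        (Bz \<epsilon> (- 1) w + Vz \<epsilon> (- 1) w + v)"]) (intro m)
qed

lemma second_moment_base:
  assumes \<epsilon>: "\<epsilon> \<in> I"
  shows "second_moment (M \<epsilon>) (innovation P (\<lambda>_ _. 0) (\<Gamma>b \<epsilon>) (Nb \<epsilon>)) t = \<Sigma>b"
proof -
  interpret c: coupled_chains "M \<epsilon>" P \<pi>\<^sub>0 "\<zeta> \<epsilon>" "\<Gamma> \<epsilon>" "\<Gamma>b \<epsilon>" "No \<epsilon>" "Nb \<epsilon>" by (rule chains[OF \<epsilon>])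
  have "second_moment (M \<epsilon>) (innovation P (\<lambda>_ _. 0) (\<Gamma>b \<epsilon>) (Nb \<epsilon>)) t =
      (\<integral>w. outer (c.base.Y t w) (c.base.Y t w) \<partial>M \<epsilon>)"
    unfolding second_moment_def
  proof (rule integral_cong_AE)
    show "AE w in M \<epsilon>. outer (innovation P (\<lambda>_ _. 0) (\<Gamma>b \<epsilon>) (Nb \<epsilon>) t w) (innovation P (\<lambda>_ _. 0) (\<Gamma>b \<epsilon>) (Nb \<epsilon>) t w) =
        outer (c.base.Y t w) (c.base.Y t w)"
      using c.innovation_base_AE[of t] by eventually_elim simp
  qed (intro measurable_outer c.measurable_innovation bounded_rv_measurable[OF c.base.bounded_M(4)])+
  then show ?thesis by (simp add: c.integral_outer_base_Y)
qed

text \<open>The later of the two factors is an innovation and the other one is known before it. For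
  negative \<open>t\<close> this is \<open>Y\<close> at time 0, since the weighted states up to time
  -1 belong to \<open>F (- 1)\<close>; for positive \<open>t\<close> it is \<open>Y\<close> at time
  \<open>t\<close>.\<close>

lemma integral_outer_Y_zero:
  assumes \<epsilon>: "\<epsilon> \<in> I"
  shows "t \<noteq> 0 \<Longrightarrow> (\<integral>w. outer (Y \<epsilon> t w) (Y \<epsilon> 0 w) \<partial>M \<epsilon>) = 0"
    and "t < 0 \<Longrightarrow> (\<integral>w. outer (Bz \<epsilon> t w) (Y \<epsilon> 0 w) \<partial>M \<epsilon>) = 0"
    and "t < 0 \<Longrightarrow> (\<integral>w. outer (Vz \<epsilon> t w) (Y \<epsilon> 0 w) \<partial>M \<epsilon>) = 0"
proof -
  interpret c: coupled_chains "M \<epsilon>" P \<pi>\<^sub>0 "\<zeta> \<epsilon>" "\<Gamma> \<epsilon>" "\<Gamma>b \<epsilon>" "No \<epsilon>" "Nb \<epsilon>" by (rule chains[OF \<epsilon>])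
  have *: "(\<integral>w. outer (g w) (Y \<epsilon> 0 w) \<partial>M \<epsilon>) = 0" if "bounded_rv (M \<epsilon>) (c.F (- 1)) g" for g :: "'w \<Rightarrow> 'n rvec"
    using c.chain.integral_outer_Y[OF that] by simp
  show "(\<integral>w. outer (Y \<epsilon> t w) (Y \<epsilon> 0 w) \<partial>M \<epsilon>) = 0" if "t \<noteq> 0"
  proof (cases "t < 0")
    case True
    then show ?thesis by (intro * c.chain.bounded_Y) simp
  next
    case False
    then have "bounded_rv (M \<epsilon>) (c.F (t - 1)) (Y \<epsilon> 0)" using that by (intro c.chain.bounded_Y) simp
    from c.chain.integral_outer_Y'[OF this] show ?thesis by simp
  qed
  show "(\<integral>w. outer (Bz \<epsilon> t w) (Y \<epsilon> 0 w) \<partial>M \<epsilon>) = 0"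
    "(\<integral>w. outer (Vz \<epsilon> t w) (Y \<epsilon> 0 w) \<partial>M \<epsilon>) = 0" if "t < 0"
    using that by (intro * bounded_rv_intros c.bounded_env_F c.chain.bounded_X; simp)+
qed

text \<open>The constant matrices leave the integral on the left, transposed, and leave moments of
  the form expanded above.\<close>

lemma integral_outer_Bz_Y:
  assumes "\<epsilon> \<in> I"
  shows "(\<integral>w. outer (Bz \<epsilon> t w) (Y \<epsilon> 0 w) \<partial>M \<epsilon>) =
      transpose E ** (\<integral>w. \<zeta> \<epsilon> t w *\<^sub>R outer (\<Gamma> \<epsilon> t w) (Y \<epsilon> 0 w) \<partial>M \<epsilon>)"
    and "(\<integral>w. outer (Vz \<epsilon> t w) (Y \<epsilon> 0 w) \<partial>M \<epsilon>) =
      ((1/2) *\<^sub>R transpose W) ** (\<integral>w. (\<zeta> \<epsilon> t w * \<zeta> \<epsilon> t w) *\<^sub>R outer (\<Gamma> \<epsilon> t w) (Y \<epsilon> 0 w) \<partial>M \<epsilon>)"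
proof -
  note sc = bounded_bilinear.scaleR_left[OF bounded_bilinear_outer]
    bounded_bilinear.scaleR_left[OF bounded_bilinear_matrix_matrix]
    bounded_bilinear.scaleR_right[OF bounded_bilinear_matrix_matrix]
  have "outer (Bz \<epsilon> t w) (Y \<epsilon> 0 w) = transpose E ** (\<zeta> \<epsilon> t w *\<^sub>R outer (\<Gamma> \<epsilon> t w) (Y \<epsilon> 0 w))" for w
    by (simp add: sc outer_vector_matrix_left)
  then show "(\<integral>w. outer (Bz \<epsilon> t w) (Y \<epsilon> 0 w) \<partial>M \<epsilon>) =
      transpose E ** (\<integral>w. \<zeta> \<epsilon> t w *\<^sub>R outer (\<Gamma> \<epsilon> t w) (Y \<epsilon> 0 w) \<partial>M \<epsilon>)"
    using integral_bounded_linear[OF bounded_linear_matrix_matrix_right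
        rv_O_integrable[OF rv_O_scaleR[OF rv_O_env rv_O_outer[OF rv_O_state rv_O_Y]] assms]] by simp
  have "outer (Vz \<epsilon> t w) (Y \<epsilon> 0 w) =
      ((1/2) *\<^sub>R transpose W) ** ((\<zeta> \<epsilon> t w * \<zeta> \<epsilon> t w) *\<^sub>R outer (\<Gamma> \<epsilon> t w) (Y \<epsilon> 0 w))" for w
    by (simp add: sc outer_vector_matrix_left power2_eq_square)
  then show "(\<integral>w. outer (Vz \<epsilon> t w) (Y \<epsilon> 0 w) \<partial>M \<epsilon>) =
      ((1/2) *\<^sub>R transpose W) ** (\<integral>w. (\<zeta> \<epsilon> t w * \<zeta> \<epsilon> t w) *\<^sub>R outer (\<Gamma> \<epsilon> t w) (Y \<epsilon> 0 w) \<partial>M \<epsilon>)"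
    using integral_bounded_linear[OF bounded_linear_matrix_matrix_right
        rv_O_integrable[OF rv_O_scaleR[OF rv_O_env2 rv_O_outer[OF rv_O_state rv_O_Y]] assms]] by simp
qed

text \<open>With the additional factor \<open>\<zeta>\<close> the quadratic term is of order three,
  and the innovation contributes nothing because the environment at any time is an admissible test
  function. The linear term has two factors \<open>\<zeta>\<close> and is evaluated by
  \<open>integral_env2_state\<close>.\<close>

lemma disturbance_env_correlation:
  "eq_O3 \<epsilon>\<^sub>0 (\<lambda>\<epsilon>. \<integral>w. \<zeta> \<epsilon> 0 w *\<^sub>R (Bz \<epsilon> (t - 1) w + Vz \<epsilon> (t - 1) w + Y \<epsilon> t w) \<partial>M \<epsilon>)
    (\<lambda>\<epsilon>. R\<zeta> \<epsilon> (t - 1) *\<^sub>R (\<pi>\<^sub>0 v* E))"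
proof -
  let ?b = "\<lambda>\<epsilon> w. (\<zeta> \<epsilon> (t - 1) w * \<zeta> \<epsilon> 0 w) *\<^sub>R (\<Gamma> \<epsilon> (t - 1) w v* E)"
  let ?y = "\<lambda>\<epsilon> w. \<zeta> \<epsilon> 0 w *\<^sub>R Y \<epsilon> t w"
  have b: "rv_O 2 ?b" by (rule rv_O_weaken[OF rv_O_scaleR[OF rv_O_env2 rv_O_vm[OF rv_O_state rv_O_const]]]) simp
  have y: "rv_O 1 ?y" by (rule rv_O_weaken[OF rv_O_scaleR[OF rv_O_env rv_O_Y]]) simp
  have D: "rv_O 0 (\<lambda>\<epsilon> w. Bz \<epsilon> (t - 1) w + Vz \<epsilon> (t - 1) w + Y \<epsilon> t w)"
    by (intro rv_O_add rv_O_Y rv_O_weaken[OF rv_O_Bz] rv_O_weaken[OF rv_O_Vz]) simp_all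
  have 1: "eq_O3 \<epsilon>\<^sub>0 (\<lambda>\<epsilon>. \<integral>w. \<zeta> \<epsilon> 0 w *\<^sub>R (Bz \<epsilon> (t - 1) w + Vz \<epsilon> (t - 1) w + Y \<epsilon> t w) \<partial>M \<epsilon>)
      (\<lambda>\<epsilon>. \<integral>w. ?b \<epsilon> w + ?y \<epsilon> w \<partial>M \<epsilon>)"
  proof (rule eq_O3_integral[OF rv_O_scaleR[OF rv_O_env D] rv_O_add[OF rv_O_weaken[OF b] y]])
    have "rv_O 3 (\<lambda>\<epsilon> w. \<zeta> \<epsilon> 0 w *\<^sub>R Vz \<epsilon> (t - 1) w)"
      by (rule rv_O_weaken[OF rv_O_scaleR[OF rv_O_env rv_O_Vz]]) simp
    moreover have "\<zeta> \<epsilon> 0 w *\<^sub>R (Bz \<epsilon> (t - 1) w + v + y) -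
        (?b \<epsilon> w + \<zeta> \<epsilon> 0 w *\<^sub>R y) = \<zeta> \<epsilon> 0 w *\<^sub>R v" for \<epsilon> w v y
      by (simp add: scaleR_right_distrib mult.commute)
    ultimately show "rv_O 3 (\<lambda>\<epsilon> w. \<zeta> \<epsilon> 0 w *\<^sub>R (Bz \<epsilon> (t - 1) w + Vz \<epsilon> (t - 1) w + Y \<epsilon> t w) - (?b \<epsilon> w + ?y \<epsilon> w))"
      by (simp only:)
  qed simp
  have 2: "eq_O3 \<epsilon>\<^sub>0 (\<lambda>\<epsilon>. \<integral>w. ?b \<epsilon> w \<partial>M \<epsilon>) (\<lambda>\<epsilon>. R\<zeta> \<epsilon> (t - 1 - 0) *\<^sub>R (\<pi>\<^sub>0 v* E))"
    by (rule integral_env2_state[OF bounded_linear_vector_matrix_left])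
  have 3: "(\<integral>w. ?b \<epsilon> w + ?y \<epsilon> w \<partial>M \<epsilon>) = (\<integral>w. ?b \<epsilon> w \<partial>M \<epsilon>)" if \<epsilon>: "\<epsilon> \<in> I" for \<epsilon>
  proof -
    interpret c: coupled_chains "M \<epsilon>" P \<pi>\<^sub>0 "\<zeta> \<epsilon>" "\<Gamma> \<epsilon>" "\<Gamma>b \<epsilon>" "No \<epsilon>" "Nb \<epsilon>" by (rule chains[OF \<epsilon>])
    have "(\<integral>w. ?y \<epsilon> w \<partial>M \<epsilon>) = 0"
      using c.chain.integral_scaleR_Y[OF c.bounded_env_F, of 0 "t - 1"] by simp
    then show ?thesis
      using rv_O_integrable[OF b \<epsilon>] rv_O_integrable[OF y \<epsilon>] by simp
  qed
  show ?thesis using eq_O3_trans[OF 1 eq_O3_cong_left[OF 3 2]] by simp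
qed

text \<open>Of the nine products, the two mixing \<open>Bz\<close> with \<open>Vz\<close> have order
  three and the square of \<open>Vz\<close> order four. Of the other six, those with the innovation
  on the left are transposes, moved by stationarity to have the innovation at time 0. The lags
  differ from \<open>t\<close> by one because the disturbance at time \<open>t\<close> contains
  \<open>Bz\<close> and \<open>Vz\<close> at time \<open>t - 1\<close>.\<close>

lemma disturbance_correlation:
  "eq_O3 \<epsilon>\<^sub>0 (\<lambda>\<epsilon>. \<integral>w. outer (Bz \<epsilon> (t - 1) w + Vz \<epsilon> (t - 1) w + Y \<epsilon> t w)
        (Bz \<epsilon> (- 1) w + Vz \<epsilon> (- 1) w + Y \<epsilon> 0 w) \<partial>M \<epsilon>)
    (\<lambda>\<epsilon>. (\<integral>w. outer (Bz \<epsilon> t w) (Bz \<epsilon> 0 w) \<partial>M \<epsilon>) + (\<integral>w. outer (Y \<epsilon> t w) (Y \<epsilon> 0 w) \<partial>M \<epsilon>)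
      + (\<integral>w. outer (Bz \<epsilon> (t - 1) w) (Y \<epsilon> 0 w) \<partial>M \<epsilon>)
      + transpose (\<integral>w. outer (Bz \<epsilon> (- t - 1) w) (Y \<epsilon> 0 w) \<partial>M \<epsilon>)
      + (\<integral>w. outer (Vz \<epsilon> (t - 1) w) (Y \<epsilon> 0 w) \<partial>M \<epsilon>)
      + transpose (\<integral>w. outer (Vz \<epsilon> (- t - 1) w) (Y \<epsilon> 0 w) \<partial>M \<epsilon>))"
proof -
  have D: "rv_O 0 (\<lambda>\<epsilon> w. Bz \<epsilon> (t - 1) w + Vz \<epsilon> (t - 1) w + Y \<epsilon> t w)" for t
    by (intro rv_O_add rv_O_Y rv_O_weaken[OF rv_O_Bz] rv_O_weaken[OF rv_O_Vz]) simp_all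
  have D0: "rv_O 0 (\<lambda>\<epsilon> w. Bz \<epsilon> (- 1) w + Vz \<epsilon> (- 1) w + Y \<epsilon> 0 w)"
    using D[of 0] by simp
  note o = rv_O_weaken[OF rv_O_outer[OF rv_O_Bz rv_O_Bz]] rv_O_weaken[OF rv_O_outer[OF rv_O_Y rv_O_Y]]
    rv_O_weaken[OF rv_O_outer[OF rv_O_Bz rv_O_Y]] rv_O_weaken[OF rv_O_outer[OF rv_O_Y rv_O_Bz]]
    rv_O_weaken[OF rv_O_outer[OF rv_O_Vz rv_O_Y]] rv_O_weaken[OF rv_O_outer[OF rv_O_Y rv_O_Vz]]
    rv_O_weaken[OF rv_O_outer[OF rv_O_Bz rv_O_Vz]] rv_O_weaken[OF rv_O_outer[OF rv_O_Vz rv_O_Bz]]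
    rv_O_weaken[OF rv_O_outer[OF rv_O_Vz rv_O_Vz]]
  let ?G = "\<lambda>\<epsilon> w. outer (Bz \<epsilon> (t - 1) w) (Bz \<epsilon> (- 1) w) + outer (Y \<epsilon> t w) (Y \<epsilon> 0 w)
      + outer (Bz \<epsilon> (t - 1) w) (Y \<epsilon> 0 w) + outer (Y \<epsilon> t w) (Bz \<epsilon> (- 1) w)
      + outer (Vz \<epsilon> (t - 1) w) (Y \<epsilon> 0 w) + outer (Y \<epsilon> t w) (Vz \<epsilon> (- 1) w)"
  have G: "rv_O 0 ?G" by (intro rv_O_add o) simp_all
  have 1: "eq_O3 \<epsilon>\<^sub>0 (\<lambda>\<epsilon>. \<integral>w. outer (Bz \<epsilon> (t - 1) w + Vz \<epsilon> (t - 1) w + Y \<epsilon> t w)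
        (Bz \<epsilon> (- 1) w + Vz \<epsilon> (- 1) w + Y \<epsilon> 0 w) \<partial>M \<epsilon>) (\<lambda>\<epsilon>. \<integral>w. ?G \<epsilon> w \<partial>M \<epsilon>)"
  proof (rule eq_O3_integral[OF rv_O_outer[OF D D0] G])
    have "rv_O 3 (\<lambda>\<epsilon> w. outer (Bz \<epsilon> (t - 1) w) (Vz \<epsilon> (- 1) w) + outer (Vz \<epsilon> (t - 1) w) (Bz \<epsilon> (- 1) w)
        + outer (Vz \<epsilon> (t - 1) w) (Vz \<epsilon> (- 1) w))"
      by (intro rv_O_add o) simp_all
    moreover have "outer (b + v + y) (b' + v' + y') - (outer b b' + outer y y' + outer b y' + outer y b' + outer v y' + outer y v') =
        outer b v' + outer v b' + outer v v'" for b v y b' v' y' :: "'n rvec"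
      by (simp add: bounded_bilinear.add_left[OF bounded_bilinear_outer]
          bounded_bilinear.add_right[OF bounded_bilinear_outer])
    ultimately show "rv_O 3 (\<lambda>\<epsilon> w. outer (Bz \<epsilon> (t - 1) w + Vz \<epsilon> (t - 1) w + Y \<epsilon> t w)
        (Bz \<epsilon> (- 1) w + Vz \<epsilon> (- 1) w + Y \<epsilon> 0 w) - ?G \<epsilon> w)"
      by (simp only:)
  qed
  show ?thesis
  proof (rule eq_O3_cong_right[OF 1])
    fix \<epsilon> assume \<epsilon>: "\<epsilon> \<in> I"
    then interpret c: coupled_chains "M \<epsilon>" P \<pi>\<^sub>0 "\<zeta> \<epsilon>" "\<Gamma> \<epsilon>" "\<Gamma>b \<epsilon>" "No \<epsilon>" "Nb \<epsilon>" by (rule chains)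
    note i = rv_O_integrable[OF _ \<epsilon>, OF rv_O_outer[OF rv_O_Bz rv_O_Bz]] rv_O_integrable[OF _ \<epsilon>, OF rv_O_outer[OF rv_O_Y rv_O_Y]]
      rv_O_integrable[OF _ \<epsilon>, OF rv_O_outer[OF rv_O_Bz rv_O_Y]] rv_O_integrable[OF _ \<epsilon>, OF rv_O_outer[OF rv_O_Y rv_O_Bz]]
      rv_O_integrable[OF _ \<epsilon>, OF rv_O_outer[OF rv_O_Vz rv_O_Y]] rv_O_integrable[OF _ \<epsilon>, OF rv_O_outer[OF rv_O_Y rv_O_Vz]]
    have tr: "(\<integral>w. outer (Y \<epsilon> t w) (g w) \<partial>M \<epsilon>) = transpose (\<integral>w. outer (g w) (Y \<epsilon> t w) \<partial>M \<epsilon>)"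
      if "integrable (M \<epsilon>) (\<lambda>w. outer (g w) (Y \<epsilon> t w))" for g :: "'w \<Rightarrow> 'n rvec"
      using integral_bounded_linear[OF bounded_linear_transpose that] by (simp add: transpose_outer)
    have sum: "(\<integral>w. f1 w + f2 w + f3 w + f4 w + f5 w + f6 w \<partial>N) =
        integral\<^sup>L N f1 + integral\<^sup>L N f2 + integral\<^sup>L N f3 + integral\<^sup>L N f4 + integral\<^sup>L N f5 + integral\<^sup>L N f6"
      if "integrable N f1" "integrable N f2" "integrable N f3" "integrable N f4" "integrable N f5" "integrable N f6"
      for N :: "'w measure" and f1 f2 f3 f4 f5 f6 :: "'w \<Rightarrow> 'n rmat"
      using that by simp
    \<comment> \<open>Moving the innovation from time \<open>t\<close> to 0 moves the other factor
      from -1 to \<open>- 1 - t\<close>.\<close>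
    have e: "- 1 - t = - t - 1" by simp
    have B: "(\<integral>w. outer (Y \<epsilon> t w) (Bz \<epsilon> (- 1) w) \<partial>M \<epsilon>) = transpose (\<integral>w. outer (Bz \<epsilon> (- t - 1) w) (Y \<epsilon> 0 w) \<partial>M \<epsilon>)"
      unfolding tr[OF i(3)] using c.integral_shift_Y[of "\<lambda>x. x" "- 1" E t, unfolded e] by simp
    \<comment> \<open>The one half of \<open>Vz\<close> is absorbed in the scalar function of the
      environment.\<close>
    have V: "(\<integral>w. outer (Y \<epsilon> t w) (Vz \<epsilon> (- 1) w) \<partial>M \<epsilon>) = transpose (\<integral>w. outer (Vz \<epsilon> (- t - 1) w) (Y \<epsilon> 0 w) \<partial>M \<epsilon>)"
      unfolding tr[OF i(5)] using c.integral_shift_Y[of "\<lambda>x. x\<^sup>2 * (1/2)" "- 1" W t, unfolded e] by simp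
    have BB: "(\<integral>w. outer (Bz \<epsilon> (t - 1) w) (Bz \<epsilon> (- 1) w) \<partial>M \<epsilon>) = (\<integral>w. outer (Bz \<epsilon> t w) (Bz \<epsilon> 0 w) \<partial>M \<epsilon>)"
      using c.integral_shift_X_X[of "t - 1" E "- 1"] by simp
    show "(\<integral>w. ?G \<epsilon> w \<partial>M \<epsilon>) =
      (\<integral>w. outer (Bz \<epsilon> t w) (Bz \<epsilon> 0 w) \<partial>M \<epsilon>) + (\<integral>w. outer (Y \<epsilon> t w) (Y \<epsilon> 0 w) \<partial>M \<epsilon>)
      + (\<integral>w. outer (Bz \<epsilon> (t - 1) w) (Y \<epsilon> 0 w) \<partial>M \<epsilon>)
      + transpose (\<integral>w. outer (Bz \<epsilon> (- t - 1) w) (Y \<epsilon> 0 w) \<partial>M \<epsilon>)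
      + (\<integral>w. outer (Vz \<epsilon> (t - 1) w) (Y \<epsilon> 0 w) \<partial>M \<epsilon>)
      + transpose (\<integral>w. outer (Vz \<epsilon> (- t - 1) w) (Y \<epsilon> 0 w) \<partial>M \<epsilon>)"
      unfolding B[symmetric] V[symmetric] BB[symmetric]
      by (rule sum[OF i(1) i(2) i(3) i(4) i(5) i(6)])
  qed
qed

text \<open>Multiplication by \<open>E\<close> on both sides is a linear map, so the estimate for
  two states with two factors \<open>\<zeta>\<close> transfers directly.\<close>

lemma integral_outer_Bz_Bz:
  "eq_O3 \<epsilon>\<^sub>0 (\<lambda>\<epsilon>. \<integral>w. outer (Bz \<epsilon> (int n) w) (Bz \<epsilon> 0 w) \<partial>M \<epsilon>)
    (\<lambda>\<epsilon>. R\<zeta> \<epsilon> (int n) *\<^sub>R (transpose (mpow (P 0) n ** E) ** diag \<pi>\<^sub>0 ** E))"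
proof -
  let ?L = "\<lambda>m. transpose E ** m ** E"
  have L: "bounded_linear ?L"
    by (intro bounded_linear_compose[OF bounded_linear_matrix_matrix_left] bounded_linear_matrix_matrix_right)
  note sc = bounded_bilinear.scaleR_left[OF bounded_bilinear_outer] bounded_bilinear.scaleR_right[OF bounded_bilinear_outer]
    bounded_bilinear.scaleR_left[OF bounded_bilinear_matrix_matrix]
    bounded_bilinear.scaleR_right[OF bounded_bilinear_matrix_matrix]
  show ?thesis
  proof (rule eq_O3_cong_left[OF _ eq_O3_cong_right[OF eq_O3_linear[OF L integral_env2_outer_state[of "int n" 0 n]]]])
    fix \<epsilon> assume \<epsilon>: "\<epsilon> \<in> I"
    have "outer (Bz \<epsilon> (int n) w) (Bz \<epsilon> 0 w) =
        ?L ((\<zeta> \<epsilon> (int n) w * \<zeta> \<epsilon> 0 w) *\<^sub>R outer (\<Gamma> \<epsilon> (int n) w) (\<Gamma> \<epsilon> 0 w))" for w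
      by (simp add: sc outer_vector_matrix_left outer_vector_matrix_right matrix_mul_assoc)
    then show "(\<integral>w. outer (Bz \<epsilon> (int n) w) (Bz \<epsilon> 0 w) \<partial>M \<epsilon>) =
        ?L (\<integral>w. (\<zeta> \<epsilon> (int n) w * \<zeta> \<epsilon> 0 w) *\<^sub>R outer (\<Gamma> \<epsilon> (int n) w) (\<Gamma> \<epsilon> 0 w) \<partial>M \<epsilon>)"
      using integral_bounded_linear[OF L
          rv_O_integrable[OF rv_O_scaleR[OF rv_O_env2 rv_O_outer[OF rv_O_state rv_O_state]] \<epsilon>]] by simp
    show "?L (R\<zeta> \<epsilon> (int n - 0) *\<^sub>R (transpose (mpow (P 0) n) ** diag \<pi>\<^sub>0)) =
        R\<zeta> \<epsilon> (int n) *\<^sub>R (transpose (mpow (P 0) n ** E) ** diag \<pi>\<^sub>0 ** E)"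
      by (simp add: sc matrix_transpose_mul matrix_mul_assoc)
  qed
qed

end

section \<open>The expansions\<close>

text \<open>The one-time moments are taken at an arbitrary time \<open>s\<close>, which stationarity
  makes immaterial. In the expansions the constant may depend on the lag \<open>t\<close>, whereas
  the vanishing correlations and the covariance of the unperturbed innovation are exact for every
  \<open>\<epsilon>\<close>.\<close>

theorem theorem2p4:
  fixes P :: "real \<Rightarrow> 'n::{finite, linorder} rmat"
    and \<pi>\<^sub>0 :: "'n rvec"
    and \<epsilon>\<^sub>0 :: real
    and M :: "real \<Rightarrow> 'w measure"
    and \<zeta>1 \<zeta> No Nb :: "real \<Rightarrow> int \<Rightarrow> 'w \<Rightarrow> real"
    and \<Gamma> \<Gamma>b B V \<Delta> \<Delta>b D B\<zeta> V\<zeta>2 :: "real \<Rightarrow> int \<Rightarrow> 'w \<Rightarrow> 'n rvec"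
    and E W A :: "'n rmat"
    and R\<zeta> :: "real \<Rightarrow> int \<Rightarrow> real"
    and RD\<zeta> R\<Gamma>\<zeta> :: "real \<Rightarrow> int \<Rightarrow> 'n rvec"
    and RD RB\<zeta> R\<Delta> RB\<zeta>\<Delta> RV\<zeta>2\<Delta> R\<Delta>2\<zeta> :: "real \<Rightarrow> int \<Rightarrow> 'n rmat"
    and S Sb :: "real \<Rightarrow> 'n rmat"
    and p :: "real \<Rightarrow> 'n rvec"
    and \<sigma>2 :: "real \<Rightarrow> real"
    and s :: int
  assumes P: "transition_family P"
    and A1: "assumption_A1 P"
    and \<pi>\<^sub>0: "invariant_probability (P 0) \<pi>\<^sub>0"
    and \<epsilon>\<^sub>0: "0 < \<epsilon>\<^sub>0"
    and M: "\<And>\<epsilon>. \<epsilon> \<in> {0<..\<epsilon>\<^sub>0} \<Longrightarrow> prob_space (M \<epsilon>)"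
    and A2: "\<And>\<epsilon>. \<epsilon> \<in> {0<..\<epsilon>\<^sub>0} \<Longrightarrow> assumption_A2 (M \<epsilon>) (\<zeta>1 \<epsilon>)"
    and law: "\<And>\<epsilon> \<epsilon>'. \<epsilon> \<in> {0<..\<epsilon>\<^sub>0} \<Longrightarrow> \<epsilon>' \<in> {0<..\<epsilon>\<^sub>0} \<Longrightarrow>
                process_law (M \<epsilon>) (\<zeta>1 \<epsilon>) = process_law (M \<epsilon>') (\<zeta>1 \<epsilon>')"
  defines "\<zeta> \<equiv> \<lambda>\<epsilon> t \<omega>. \<epsilon> * \<zeta>1 \<epsilon> t \<omega>"
  assumes process: "\<And>\<epsilon>. \<epsilon> \<in> {0<..\<epsilon>\<^sub>0} \<Longrightarrow>
                coupled_process P (M \<epsilon>) (\<zeta> \<epsilon>) (\<Gamma> \<epsilon>) (\<Gamma>b \<epsilon>) (No \<epsilon>) (Nb \<epsilon>)"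
    and coupling: "\<exists>K. \<forall>\<epsilon>\<in>{0<..\<epsilon>\<^sub>0}. \<forall>t. (\<integral>\<omega>. norm (\<Gamma> \<epsilon> t \<omega> - \<Gamma>b \<epsilon> t \<omega>) \<partial>M \<epsilon>) \<le> K * \<epsilon>"
  defines "E \<equiv> deriv1 P 0"
    and "W \<equiv> deriv2 P 0"
    and "A \<equiv> transpose (P 0)"
    and "B \<equiv> \<lambda>\<epsilon> t \<omega>. \<Gamma> \<epsilon> t \<omega> v* E"
    and "V \<equiv> \<lambda>\<epsilon> t \<omega>. (1/2) *\<^sub>R (\<Gamma> \<epsilon> t \<omega> v* W)"
    and "\<Delta> \<equiv> \<lambda>\<epsilon>. innovation P (\<zeta> \<epsilon>) (\<Gamma> \<epsilon>) (driving_noise (\<Gamma> \<epsilon>) (\<Gamma>b \<epsilon>) (No \<epsilon>) (Nb \<epsilon>))"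
    and "\<Delta>b \<equiv> \<lambda>\<epsilon>. innovation P (\<lambda>_ _. 0) (\<Gamma>b \<epsilon>) (Nb \<epsilon>)"
    and "B\<zeta> \<equiv> \<lambda>\<epsilon> t \<omega>. \<zeta> \<epsilon> t \<omega> *\<^sub>R B \<epsilon> t \<omega>"
    and "V\<zeta>2 \<equiv> \<lambda>\<epsilon> t \<omega>. (\<zeta> \<epsilon> t \<omega>)\<^sup>2 *\<^sub>R V \<epsilon> t \<omega>"
    and "D \<equiv> \<lambda>\<epsilon> t \<omega>. B\<zeta> \<epsilon> (t - 1) \<omega> + V\<zeta>2 \<epsilon> (t - 1) \<omega> + \<Delta> \<epsilon> t \<omega>"
    and "R\<zeta> \<equiv> \<lambda>\<epsilon>. corr_ss (M \<epsilon>) (\<zeta> \<epsilon>) (\<zeta> \<epsilon>)"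
    and "RD\<zeta> \<equiv> \<lambda>\<epsilon>. corr_vs (M \<epsilon>) (D \<epsilon>) (\<zeta> \<epsilon>)"
    and "R\<Gamma>\<zeta> \<equiv> \<lambda>\<epsilon>. corr_vs (M \<epsilon>) (\<Gamma> \<epsilon>) (\<zeta> \<epsilon>)"
    and "RD \<equiv> \<lambda>\<epsilon>. corr_vv (M \<epsilon>) (D \<epsilon>) (D \<epsilon>)"
    and "RB\<zeta> \<equiv> \<lambda>\<epsilon>. corr_vv (M \<epsilon>) (B\<zeta> \<epsilon>) (B\<zeta> \<epsilon>)"
    and "R\<Delta> \<equiv> \<lambda>\<epsilon>. corr_vv (M \<epsilon>) (\<Delta> \<epsilon>) (\<Delta> \<epsilon>)"
    and "RB\<zeta>\<Delta> \<equiv> \<lambda>\<epsilon>. corr_vv (M \<epsilon>) (B\<zeta> \<epsilon>) (\<Delta> \<epsilon>)"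
    and "RV\<zeta>2\<Delta> \<equiv> \<lambda>\<epsilon>. corr_vv (M \<epsilon>) (V\<zeta>2 \<epsilon>) (\<Delta> \<epsilon>)"
    and "R\<Delta>2\<zeta> \<equiv> \<lambda>\<epsilon>. corr_vs (M \<epsilon>) (\<lambda>t \<omega>. outer (\<Delta> \<epsilon> t \<omega>) (\<Delta> \<epsilon> t \<omega>)) (\<zeta> \<epsilon>)"
    and "S \<equiv> \<lambda>\<epsilon>. second_moment (M \<epsilon>) (\<Delta> \<epsilon>) s"
    and "Sb \<equiv> \<lambda>\<epsilon>. second_moment (M \<epsilon>) (\<Delta>b \<epsilon>) s"
    and "p \<equiv> \<lambda>\<epsilon>. (\<integral>\<omega>. \<Gamma> \<epsilon> s \<omega> \<partial>M \<epsilon>)"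
    and "\<sigma>2 \<equiv> \<lambda>\<epsilon>. (\<integral>\<omega>. (\<zeta> \<epsilon> s \<omega>)\<^sup>2 \<partial>M \<epsilon>)"
  shows
    "(\<forall>t. eq_O3 \<epsilon>\<^sub>0 (\<lambda>\<epsilon>. RD\<zeta> \<epsilon> t) (\<lambda>\<epsilon>. R\<zeta> \<epsilon> (t - 1) *\<^sub>R (\<pi>\<^sub>0 v* E)))
   \<and> (\<forall>t. eq_O3 \<epsilon>\<^sub>0 (\<lambda>\<epsilon>. RD \<epsilon> t)
        (\<lambda>\<epsilon>. RB\<zeta> \<epsilon> t + R\<Delta> \<epsilon> t
             + RB\<zeta>\<Delta> \<epsilon> (t - 1) + transpose (RB\<zeta>\<Delta> \<epsilon> (- t - 1))
             + RV\<zeta>2\<Delta> \<epsilon> (t - 1) + transpose (RV\<zeta>2\<Delta> \<epsilon> (- t - 1))))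
   \<and> (\<forall>t\<ge>0. eq_O3 \<epsilon>\<^sub>0 (\<lambda>\<epsilon>. RB\<zeta> \<epsilon> t)
        (\<lambda>\<epsilon>. R\<zeta> \<epsilon> t *\<^sub>R (transpose (mpow (P 0) (nat t) ** E) ** diag \<pi>\<^sub>0 ** E)))
   \<and> (\<forall>t. t \<noteq> 0 \<longrightarrow> (\<forall>\<epsilon>\<in>{0<..\<epsilon>\<^sub>0}. R\<Delta> \<epsilon> t = 0))
   \<and> (\<forall>\<epsilon>\<in>{0<..\<epsilon>\<^sub>0}. R\<Delta> \<epsilon> 0 = S \<epsilon>)
   \<and> eq_O3 \<epsilon>\<^sub>0 S
        (\<lambda>\<epsilon>. diag (p \<epsilon>) - transpose (P 0) ** diag (p \<epsilon>) ** P 0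
             - (transpose (P 0) ** diag (R\<Gamma>\<zeta> \<epsilon> 0) ** E + transpose E ** diag (R\<Gamma>\<zeta> \<epsilon> 0) ** P 0)
             - (1/2 * R\<zeta> \<epsilon> 0) *\<^sub>R
                 (transpose (P 0) ** diag \<pi>\<^sub>0 ** W
                  + 2 *\<^sub>R (transpose E ** diag \<pi>\<^sub>0 ** E)
                  + transpose W ** diag \<pi>\<^sub>0 ** P 0))
   \<and> (\<forall>\<epsilon>\<in>{0<..\<epsilon>\<^sub>0}. Sb \<epsilon> = diag \<pi>\<^sub>0 - transpose (P 0) ** diag \<pi>\<^sub>0 ** P 0)
   \<and> (\<forall>t<0. \<forall>\<epsilon>\<in>{0<..\<epsilon>\<^sub>0}. RB\<zeta>\<Delta> \<epsilon> t = 0)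
   \<and> eq_O3 \<epsilon>\<^sub>0 (\<lambda>\<epsilon>. RB\<zeta>\<Delta> \<epsilon> 0) (\<lambda>\<epsilon>. transpose E ** R\<Delta>2\<zeta> \<epsilon> 0)
   \<and> (\<forall>t\<ge>1. eq_O3 \<epsilon>\<^sub>0 (\<lambda>\<epsilon>. RB\<zeta>\<Delta> \<epsilon> t)
        (\<lambda>\<epsilon>. transpose E ** mpow A (nat t) ** R\<Delta>2\<zeta> \<epsilon> (- t)
             + transpose E
               ** (\<Sum>i<nat t. R\<zeta> \<epsilon> (t - int i) *\<^sub>R
                     (mpow A (nat t - 1 - i) ** transpose E ** mpow A i))
               ** Sb \<epsilon>))
   \<and> (\<forall>t<0. \<forall>\<epsilon>\<in>{0<..\<epsilon>\<^sub>0}. RV\<zeta>2\<Delta> \<epsilon> t = 0)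
   \<and> (\<forall>t\<ge>0. eq_O3 \<epsilon>\<^sub>0 (\<lambda>\<epsilon>. RV\<zeta>2\<Delta> \<epsilon> t)
        (\<lambda>\<epsilon>. (1/2 * \<sigma>2 \<epsilon>) *\<^sub>R (transpose (mpow (P 0) (nat t) ** W) ** Sb \<epsilon>)))"
proof -
  have prob: "prob_family \<epsilon>\<^sub>0 M"
    by (rule prob_family.intro) (rule M)
  have env: "AE w in M \<epsilon>. \<bar>\<zeta> \<epsilon> t w\<bar> \<le> \<epsilon>" if \<epsilon>: "\<epsilon> \<in> {0<..\<epsilon>\<^sub>0}" for \<epsilon> t
  proof -
    have "AE w in M \<epsilon>. \<forall>t. \<bar>\<zeta>1 \<epsilon> t w\<bar> \<le> 1"
      using A2[OF \<epsilon>] by (simp add: assumption_A2_def)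
    then show ?thesis
    proof eventually_elim
      case (elim w)
      then have "\<epsilon> * \<bar>\<zeta>1 \<epsilon> t w\<bar> \<le> \<epsilon> * 1" using \<epsilon> by (intro mult_left_mono) auto
      then show ?case using \<epsilon> by (simp add: \<zeta>_def abs_mult)
    qed
  qed
  have chains: "coupled_chains (M \<epsilon>) P \<pi>\<^sub>0 (\<zeta> \<epsilon>) (\<Gamma> \<epsilon>) (\<Gamma>b \<epsilon>) (No \<epsilon>) (Nb \<epsilon>)"
    if \<epsilon>: "\<epsilon> \<in> {0<..\<epsilon>\<^sub>0}" for \<epsilon>
  proof (rule coupled_chains.intro[OF M[OF \<epsilon>]], unfold_locales)
    show "\<exists>c. AE w in M \<epsilon>. \<bar>\<zeta> \<epsilon> t w\<bar> \<le> c" for t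
      using env[OF \<epsilon>] by blast
  qed (use P A1 \<pi>\<^sub>0 process[OF \<epsilon>] in \<open>simp_all add: assumption_A1_def\<close>)
  interpret f: coupled_family \<epsilon>\<^sub>0 M P \<pi>\<^sub>0 \<zeta> \<Gamma> \<Gamma>b No Nb
    using prob \<epsilon>\<^sub>0 A1 chains env coupling
    by (intro coupled_family.intro coupled_family_axioms.intro) simp_all
  note defs = E_def W_def A_def B_def V_def \<Delta>_def \<Delta>b_def B\<zeta>_def V\<zeta>2_def D_def R\<zeta>_def RD\<zeta>_def
    R\<Gamma>\<zeta>_def RD_def RB\<zeta>_def R\<Delta>_def RB\<zeta>\<Delta>_def RV\<zeta>2\<Delta>_def R\<Delta>2\<zeta>_def S_def Sb_def p_def \<sigma>2_def
  note left = bounded_linear_matrix_matrix_right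
  show ?thesis
    unfolding defs
  proof (intro conjI allI impI ballI)
    show "eq_O3 \<epsilon>\<^sub>0 (\<lambda>\<epsilon>. corr_vs (M \<epsilon>) (\<lambda>t w. f.Bz \<epsilon> (t - 1) w + f.Vz \<epsilon> (t - 1) w + f.\<Delta> \<epsilon> t w) (\<zeta> \<epsilon>) t)
        (\<lambda>\<epsilon>. f.R\<zeta> \<epsilon> (t - 1) *\<^sub>R (\<pi>\<^sub>0 v* f.E))" for t
      by (rule eq_O3_cong_left[OF f.correlations(6) f.disturbance_env_correlation])
  next
    fix t
    show "eq_O3 \<epsilon>\<^sub>0 (\<lambda>\<epsilon>. corr_vv (M \<epsilon>) (\<lambda>t w. f.Bz \<epsilon> (t - 1) w + f.Vz \<epsilon> (t - 1) w + f.\<Delta> \<epsilon> t w)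
          (\<lambda>t w. f.Bz \<epsilon> (t - 1) w + f.Vz \<epsilon> (t - 1) w + f.\<Delta> \<epsilon> t w) t)
        (\<lambda>\<epsilon>. corr_vv (M \<epsilon>) (f.Bz \<epsilon>) (f.Bz \<epsilon>) t + corr_vv (M \<epsilon>) (f.\<Delta> \<epsilon>) (f.\<Delta> \<epsilon>) t
          + corr_vv (M \<epsilon>) (f.Bz \<epsilon>) (f.\<Delta> \<epsilon>) (t - 1) + transpose (corr_vv (M \<epsilon>) (f.Bz \<epsilon>) (f.\<Delta> \<epsilon>) (- t - 1))
          + corr_vv (M \<epsilon>) (f.Vz \<epsilon>) (f.\<Delta> \<epsilon>) (t - 1) + transpose (corr_vv (M \<epsilon>) (f.Vz \<epsilon>) (f.\<Delta> \<epsilon>) (- t - 1)))"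
    proof (rule eq_O3_cong_left[OF f.correlations(7) eq_O3_cong_right[OF f.disturbance_correlation]])
      fix \<epsilon> assume \<epsilon>: "\<epsilon> \<in> {0<..\<epsilon>\<^sub>0}"
      show "(\<integral>w. outer (f.Bz \<epsilon> t w) (f.Bz \<epsilon> 0 w) \<partial>M \<epsilon>) + (\<integral>w. outer (f.Y \<epsilon> t w) (f.Y \<epsilon> 0 w) \<partial>M \<epsilon>)
          + (\<integral>w. outer (f.Bz \<epsilon> (t - 1) w) (f.Y \<epsilon> 0 w) \<partial>M \<epsilon>)
          + transpose (\<integral>w. outer (f.Bz \<epsilon> (- t - 1) w) (f.Y \<epsilon> 0 w) \<partial>M \<epsilon>)
          + (\<integral>w. outer (f.Vz \<epsilon> (t - 1) w) (f.Y \<epsilon> 0 w) \<partial>M \<epsilon>)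
          + transpose (\<integral>w. outer (f.Vz \<epsilon> (- t - 1) w) (f.Y \<epsilon> 0 w) \<partial>M \<epsilon>) =
        corr_vv (M \<epsilon>) (f.Bz \<epsilon>) (f.Bz \<epsilon>) t + corr_vv (M \<epsilon>) (f.\<Delta> \<epsilon>) (f.\<Delta> \<epsilon>) t
          + corr_vv (M \<epsilon>) (f.Bz \<epsilon>) (f.\<Delta> \<epsilon>) (t - 1) + transpose (corr_vv (M \<epsilon>) (f.Bz \<epsilon>) (f.\<Delta> \<epsilon>) (- t - 1))
          + corr_vv (M \<epsilon>) (f.Vz \<epsilon>) (f.\<Delta> \<epsilon>) (t - 1) + transpose (corr_vv (M \<epsilon>) (f.Vz \<epsilon>) (f.\<Delta> \<epsilon>) (- t - 1))"
        unfolding f.correlations(1-3)[OF \<epsilon>] corr_vv_def[of _ "f.Bz \<epsilon>" "f.Bz \<epsilon>"] ..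
    qed
  next
    fix t :: int assume "0 \<le> t"
    then obtain n where t: "t = int n" by (rule nonneg_int_cases)
    show "eq_O3 \<epsilon>\<^sub>0 (\<lambda>\<epsilon>. corr_vv (M \<epsilon>) (f.Bz \<epsilon>) (f.Bz \<epsilon>) t)
        (\<lambda>\<epsilon>. f.R\<zeta> \<epsilon> t *\<^sub>R (transpose (mpow (P 0) (nat t) ** f.E) ** diag \<pi>\<^sub>0 ** f.E))"
      unfolding t nat_int corr_vv_def by (rule f.integral_outer_Bz_Bz)
  next
    fix t :: int and \<epsilon> assume "t \<noteq> 0" and \<epsilon>: "\<epsilon> \<in> {0<..\<epsilon>\<^sub>0}"
    then show "corr_vv (M \<epsilon>) (f.\<Delta> \<epsilon>) (f.\<Delta> \<epsilon>) t = 0"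
      unfolding f.correlations[OF \<epsilon>] by (intro f.integral_outer_Y_zero)
  next
    fix \<epsilon> assume \<epsilon>: "\<epsilon> \<in> {0<..\<epsilon>\<^sub>0}"
    show "corr_vv (M \<epsilon>) (f.\<Delta> \<epsilon>) (f.\<Delta> \<epsilon>) 0 = second_moment (M \<epsilon>) (f.\<Delta> \<epsilon>) s"
      unfolding f.correlations[OF \<epsilon>] by (rule coupled_chains.integral_shift_Y_Y[OF chains[OF \<epsilon>]])
  next
    show "eq_O3 \<epsilon>\<^sub>0 (\<lambda>\<epsilon>. second_moment (M \<epsilon>) (f.\<Delta> \<epsilon>) s)
        (\<lambda>\<epsilon>. diag (\<integral>w. \<Gamma> \<epsilon> s w \<partial>M \<epsilon>) - transpose (P 0) ** diag (\<integral>w. \<Gamma> \<epsilon> s w \<partial>M \<epsilon>) ** P 0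
             - (transpose (P 0) ** diag (corr_vs (M \<epsilon>) (\<Gamma> \<epsilon>) (\<zeta> \<epsilon>) 0) ** f.E
                + transpose f.E ** diag (corr_vs (M \<epsilon>) (\<Gamma> \<epsilon>) (\<zeta> \<epsilon>) 0) ** P 0)
             - (1/2 * f.R\<zeta> \<epsilon> 0) *\<^sub>R
                 (transpose (P 0) ** diag \<pi>\<^sub>0 ** f.W
                  + 2 *\<^sub>R (transpose f.E ** diag \<pi>\<^sub>0 ** f.E)
                  + transpose f.W ** diag \<pi>\<^sub>0 ** P 0))"
      unfolding corr_vs_def by (rule eq_O3_cong_left[OF f.correlations(4) f.integral_Y_Y])
  next
    fix \<epsilon> assume \<epsilon>: "\<epsilon> \<in> {0<..\<epsilon>\<^sub>0}"
    show "second_moment (M \<epsilon>) (innovation P (\<lambda>_ _. 0) (\<Gamma>b \<epsilon>) (Nb \<epsilon>)) s = f.\<Sigma>b"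
      by (rule f.second_moment_base[OF \<epsilon>])
  next
    fix t :: int and \<epsilon> assume "t < 0" and \<epsilon>: "\<epsilon> \<in> {0<..\<epsilon>\<^sub>0}"
    then show "corr_vv (M \<epsilon>) (f.Bz \<epsilon>) (f.\<Delta> \<epsilon>) t = 0" "corr_vv (M \<epsilon>) (f.Vz \<epsilon>) (f.\<Delta> \<epsilon>) t = 0"
      using f.integral_outer_Y_zero(2,3)[OF \<epsilon>] by (simp_all only: f.correlations[OF \<epsilon>])
  next
    show "eq_O3 \<epsilon>\<^sub>0 (\<lambda>\<epsilon>. corr_vv (M \<epsilon>) (f.Bz \<epsilon>) (f.\<Delta> \<epsilon>) 0)
        (\<lambda>\<epsilon>. transpose f.E ** corr_vs (M \<epsilon>) (\<lambda>t w. outer (f.\<Delta> \<epsilon> t w) (f.\<Delta> \<epsilon> t w)) (\<zeta> \<epsilon>) 0)"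
    \<comment> \<open>At lag 0 the variation of constants formula has power 0 and an empty sum, so
      only the initial moment remains.\<close>
    proof (rule eq_O3_cong_left[OF _ eq_O3_cong_right[OF
            eq_O3_linear[OF left f.integral_env_outer_state_Y[of 0 0]]]])
      fix \<epsilon> assume \<epsilon>: "\<epsilon> \<in> {0<..\<epsilon>\<^sub>0}"
      show "corr_vv (M \<epsilon>) (f.Bz \<epsilon>) (f.\<Delta> \<epsilon>) 0 =
          transpose f.E ** (\<integral>w. \<zeta> \<epsilon> 0 w *\<^sub>R outer (\<Gamma> \<epsilon> (int 0) w) (f.Y \<epsilon> 0 w) \<partial>M \<epsilon>)"
        unfolding f.correlations[OF \<epsilon>] f.integral_outer_Bz_Y[OF \<epsilon>] by simp
      show "transpose f.E ** (mpow (transpose (P 0)) 0 ** (\<integral>w. \<zeta> \<epsilon> 0 w *\<^sub>R outer (f.Y \<epsilon> 0 w) (f.Y \<epsilon> 0 w) \<partial>M \<epsilon>) +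
          (\<Sum>i<0. f.R\<zeta> \<epsilon> (0 - int i) *\<^sub>R
            (mpow (transpose (P 0)) (0 - 1 - i) ** transpose f.E ** mpow (transpose (P 0)) i)) ** f.\<Sigma>b) =
          transpose f.E ** corr_vs (M \<epsilon>) (\<lambda>t w. outer (f.\<Delta> \<epsilon> t w) (f.\<Delta> \<epsilon> t w)) (\<zeta> \<epsilon>) 0"
        unfolding f.correlations[OF \<epsilon>]
        by (simp add: bounded_bilinear.zero_left[OF bounded_bilinear_matrix_matrix])
    qed
  next
    fix t :: int assume "1 \<le> t"
    then have "0 \<le> t" by simp
    then obtain n where t: "t = int n" by (rule nonneg_int_cases)
    let ?A = "transpose (P 0)" and ?Sb = "\<lambda>\<epsilon>. second_moment (M \<epsilon>) (innovation P (\<lambda>_ _. 0) (\<Gamma>b \<epsilon>) (Nb \<epsilon>)) s"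
    show "eq_O3 \<epsilon>\<^sub>0 (\<lambda>\<epsilon>. corr_vv (M \<epsilon>) (f.Bz \<epsilon>) (f.\<Delta> \<epsilon>) t)
        (\<lambda>\<epsilon>. transpose f.E ** mpow ?A (nat t) **
               corr_vs (M \<epsilon>) (\<lambda>t w. outer (f.\<Delta> \<epsilon> t w) (f.\<Delta> \<epsilon> t w)) (\<zeta> \<epsilon>) (- t)
             + transpose f.E
               ** (\<Sum>i<nat t. f.R\<zeta> \<epsilon> (t - int i) *\<^sub>R
                     (mpow ?A (nat t - 1 - i) ** transpose f.E ** mpow ?A i))
               ** ?Sb \<epsilon>)"
    proof (rule eq_O3_cong_left[OF _ eq_O3_cong_right[OF
            eq_O3_linear[OF left f.integral_env_outer_state_Y[of t n]]]])
      fix \<epsilon> assume \<epsilon>: "\<epsilon> \<in> {0<..\<epsilon>\<^sub>0}"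
      show "corr_vv (M \<epsilon>) (f.Bz \<epsilon>) (f.\<Delta> \<epsilon>) t =
          transpose f.E ** (\<integral>w. \<zeta> \<epsilon> t w *\<^sub>R outer (\<Gamma> \<epsilon> (int n) w) (f.Y \<epsilon> 0 w) \<partial>M \<epsilon>)"
        unfolding f.correlations[OF \<epsilon>] f.integral_outer_Bz_Y[OF \<epsilon>] t ..
      \<comment> \<open>The expansion has the environment at time \<open>t\<close> and the squared
        innovation at time 0. Shifting the environment to time 0 explains the argument
        \<open>- t\<close> of the correlation.\<close>
      have "(\<integral>w. \<zeta> \<epsilon> t w *\<^sub>R outer (f.Y \<epsilon> 0 w) (f.Y \<epsilon> 0 w) \<partial>M \<epsilon>) =
          (\<integral>w. \<zeta> \<epsilon> 0 w *\<^sub>R outer (f.Y \<epsilon> (- t) w) (f.Y \<epsilon> (- t) w) \<partial>M \<epsilon>)"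
        using coupled_chains.integral_shift_env_Y_Y[OF chains[OF \<epsilon>], of t 0] by simp
      then show "transpose f.E ** (mpow ?A n ** (\<integral>w. \<zeta> \<epsilon> t w *\<^sub>R outer (f.Y \<epsilon> 0 w) (f.Y \<epsilon> 0 w) \<partial>M \<epsilon>) +
          (\<Sum>i<n. f.R\<zeta> \<epsilon> (t - int i) *\<^sub>R (mpow ?A (n - 1 - i) ** transpose f.E ** mpow ?A i)) ** f.\<Sigma>b) =
          transpose f.E ** mpow ?A (nat t) **
               corr_vs (M \<epsilon>) (\<lambda>t w. outer (f.\<Delta> \<epsilon> t w) (f.\<Delta> \<epsilon> t w)) (\<zeta> \<epsilon>) (- t)
             + transpose f.E
               ** (\<Sum>i<nat t. f.R\<zeta> \<epsilon> (t - int i) *\<^sub>R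
                     (mpow ?A (nat t - 1 - i) ** transpose f.E ** mpow ?A i))
               ** ?Sb \<epsilon>"
        unfolding f.correlations[OF \<epsilon>] f.second_moment_base[OF \<epsilon>]
        by (simp only: t nat_int matrix_add_ldistrib matrix_mul_assoc)
    qed
  next
    fix t :: int assume "0 \<le> t"
    then obtain n where t: "t = int n" by (rule nonneg_int_cases)
    let ?Sb = "\<lambda>\<epsilon>. second_moment (M \<epsilon>) (innovation P (\<lambda>_ _. 0) (\<Gamma>b \<epsilon>) (Nb \<epsilon>)) s"
    show "eq_O3 \<epsilon>\<^sub>0 (\<lambda>\<epsilon>. corr_vv (M \<epsilon>) (f.Vz \<epsilon>) (f.\<Delta> \<epsilon>) t)
        (\<lambda>\<epsilon>. (1/2 * (\<integral>w. (\<zeta> \<epsilon> s w)\<^sup>2 \<partial>M \<epsilon>)) *\<^sub>R (transpose (mpow (P 0) (nat t) ** f.W) ** ?Sb \<epsilon>))"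
    proof (rule eq_O3_cong_left[OF _ eq_O3_cong_right[OF
            eq_O3_linear[OF left f.integral_env2_outer_state_Y[of t t n]]]])
      fix \<epsilon> assume \<epsilon>: "\<epsilon> \<in> {0<..\<epsilon>\<^sub>0}"
      show "corr_vv (M \<epsilon>) (f.Vz \<epsilon>) (f.\<Delta> \<epsilon>) t =
          ((1/2) *\<^sub>R transpose f.W) ** (\<integral>w. (\<zeta> \<epsilon> t w * \<zeta> \<epsilon> t w) *\<^sub>R outer (\<Gamma> \<epsilon> (int n) w) (f.Y \<epsilon> 0 w) \<partial>M \<epsilon>)"
        unfolding f.correlations[OF \<epsilon>] f.integral_outer_Bz_Y[OF \<epsilon>] t ..
      \<comment> \<open>The expansion is used with both factors \<open>\<zeta>\<close> at time
        \<open>t\<close>, so the variance appears as the correlation at lag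
        \<open>t - t\<close>.\<close>
      have "(\<integral>w. (\<zeta> \<epsilon> s w)\<^sup>2 \<partial>M \<epsilon>) = f.R\<zeta> \<epsilon> (t - t)"
        using coupled_chains.integral_shift_env[OF chains[OF \<epsilon>], of s s] by (simp add: power2_eq_square)
      then show "((1/2) *\<^sub>R transpose f.W) ** (f.R\<zeta> \<epsilon> (t - t) *\<^sub>R (mpow (transpose (P 0)) n ** f.\<Sigma>b)) =
          (1/2 * (\<integral>w. (\<zeta> \<epsilon> s w)\<^sup>2 \<partial>M \<epsilon>)) *\<^sub>R (transpose (mpow (P 0) (nat t) ** f.W) ** ?Sb \<epsilon>)"
        unfolding f.second_moment_base[OF \<epsilon>]
        by (simp add: t mpow_transpose matrix_transpose_mul matrix_mul_assoc
            bounded_bilinear.scaleR_left[OF bounded_bilinear_matrix_matrix]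
            bounded_bilinear.scaleR_right[OF bounded_bilinear_matrix_matrix])
    qed
  qed
qed

end
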